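(* Let $n\ge1$, let $P:\mathbb{R}^n\to\mathbb{R}$ be continuous, and let $p\ge1$. Suppose there exist $m>0$ and $s_0>0$ such that $$|P(\xi)|\lesssim|\xi|^m,\qquad|\xi|\to+\infty,$$ and such that for each $s>s_0$, $$\Big\|\sup_{0<t<1}|e^{itP(D)}f|\Big\|_{L^p(B(0,1))}\lesssim\|f\|_{H^s(\mathbb{R}^n)}\qquad\text{for all } f\in H^s(\mathbb{R}^n).$$ Then for every $s>s_0$, every $0\le\delta<m$ and every $f\in H^{s+\delta}(\mathbb{R}^n)$, $$e^{itP(D)}f(x)-f(x)=o(t^{\delta/m})\quad\text{as } t\to0^+,\qquad\text{for almost every } x\in\mathbb{R}^n.$$
   Context: For a real continuous function $P$ on $\mathbb{R}^n$, the operator $e^{itP(D)}$ is given (formally) by $$e^{itP(D)}f(x)=\int_{\mathbb{R}^n}e^{ix\cdot\xi+itP(\xi)}\hat f(\xi)\,d\xi,$$ the solution of $\partial_t u-iP(D)u=0$, $u(x,0)=f(x)$, where $\hat f$ is the Fourier transform of $f$, normalised so that $f(x)=\int_{\mathbb{R}^n}e^{ix\cdot\xi}\hat f(\xi)\,d\xi$. $H^s(\mathbb{R}^n)$ is the usual $L^2$-based inhomogeneous Sobolev space, and $B(0,1)$ is the unit ball of $\mathbb{R}^n$ centred at $0$. "$|P(\xi)|\lesssim|\xi|^m$, $|\xi|\to+\infty$" means there are constants $C,R_0>0$ with $|P(\xi)|\le C|\xi|^m$ for all $|\xi|\ge R_0$. In the norm estimate, $A\lesssim B$ means $A\le CB$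 with $C$ independent of $f$ (it may depend on $s$, $p$, $n$, $P$). *)

theory Defs
  imports "HOL-Analysis.Analysis" "HOL-Library.Landau_Symbols"
begin

definition square_integrable :: "('a::euclidean_space \<Rightarrow> complex) \<Rightarrow> bool" where
  "square_integrable f \<longleftrightarrow>
     f \<in> borel_measurable lebesgue \<and> integrable lebesgue (\<lambda>x. (cmod (f x))\<^sup>2)"

(* Limit in L^2 as R tends to infinity; the limit is unique up to null sets. The distance is
   written with the nonnegative integral, so that no junk value 0 can arise. *)
definition has_L2_limit ::
  "(real \<Rightarrow> 'a::euclidean_space \<Rightarrow> complex) \<Rightarrow> ('a \<Rightarrow> complex) \<Rightarrow> bool" where
  "has_L2_limit F g \<longleftrightarrow> square_integrable g \<and>
     ((\<lambda>R. \<integral>\<^sup>+x. ennreal ((cmod (F R x - g x))\<^sup>2) \<partial>lebesgue) \<longlongrightarrow> 0) at_top"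

(* Plancherel's definition of the Fourier transform on L^2. The factor (2 pi)^(-n) is placed here,
   so that the inversion formula carries no constant. A representative is chosen. *)
definition fourier :: "('a::euclidean_space \<Rightarrow> complex) \<Rightarrow> 'a \<Rightarrow> complex" where
  "fourier f = (SOME g. has_L2_limit
     (\<lambda>R \<xi>. (1 / (2 * pi) ^ DIM('a)) *\<^sub>R (LINT x:ball 0 R|lebesgue. cis (- (x \<bullet> \<xi>)) * f x)) g)"

definition bessel_weight :: "real \<Rightarrow> ('a::euclidean_space \<Rightarrow> complex) \<Rightarrow> 'a \<Rightarrow> complex" where
  "bessel_weight s g \<xi> = (1 + (norm \<xi>)\<^sup>2) powr (s / 2) *\<^sub>R g \<xi>"

(* Only meant for s \<ge> 0, where H^s is contained in L^2. *)
definition sobolev :: "real \<Rightarrow> ('a::euclidean_space \<Rightarrow> complex) set" where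
  "sobolev s = {f. square_integrable f \<and> square_integrable (bessel_weight s (fourier f))}"

definition sobolev_norm :: "real \<Rightarrow> ('a::euclidean_space \<Rightarrow> complex) \<Rightarrow> real" where
  "sobolev_norm s f = sqrt (LINT \<xi>|lebesgue. (cmod (bessel_weight s (fourier f) \<xi>))\<^sup>2)"

(* h is (a representative of) the L^2 function exp(i t P(D)) f. The transform of f need not be
   integrable, so the oscillatory integral is taken as an L^2 limit of truncations. *)
definition is_evolution ::
  "('a::euclidean_space \<Rightarrow> real) \<Rightarrow> real \<Rightarrow> ('a \<Rightarrow> complex) \<Rightarrow> ('a \<Rightarrow> complex) \<Rightarrow> bool" where
  "is_evolution P t f h \<longleftrightarrow> has_L2_limit
     (\<lambda>R x. LINT \<xi>:ball 0 R|lebesgue. cis (x \<bullet> \<xi> + t * P \<xi>) * fourier f \<xi>) h"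

(* For each t, exp(i t P(D)) f is determined only up to a null set that may depend on t, whereas
   suprema over t and limits in t at a fixed x involve uncountably many t. The representatives are
   therefore chosen so that t \<mapsto> u t x is continuous on (0,1) for almost every x; any two such
   choices agree for all t in (0,1) outside a single null set of x. Nothing is required at t = 0. *)
definition evolution_version ::
  "('a::euclidean_space \<Rightarrow> real) \<Rightarrow> ('a \<Rightarrow> complex) \<Rightarrow> (real \<Rightarrow> 'a \<Rightarrow> complex) \<Rightarrow> bool" where
  "evolution_version P f u \<longleftrightarrow>
     (\<forall>t\<in>{0<..<1}. is_evolution P t f (u t)) \<and>
     (AE x in lebesgue. continuous_on {0<..<1} (\<lambda>t. u t x))"

(* Meant for exponents a > 0. *)
definition ennreal_powr :: "ennreal \<Rightarrow> real \<Rightarrow> ennreal" where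
  "ennreal_powr y a = (if y = top then top else ennreal (enn2real y powr a))"

definition Lp_norm_on :: "real \<Rightarrow> 'a::euclidean_space set \<Rightarrow> ('a \<Rightarrow> ennreal) \<Rightarrow> ennreal" where
  "Lp_norm_on p A g =
     ennreal_powr (\<integral>\<^sup>+x\<in>A. ennreal_powr (g x) p \<partial>lebesgue) (1 / p)"

definition maximal_function :: "(real \<Rightarrow> 'a \<Rightarrow> complex) \<Rightarrow> 'a \<Rightarrow> ennreal" where
  "maximal_function u x = (SUP t\<in>{0<..<1}. ennreal (cmod (u t x)))"

end

theory Submission
  imports Defs "HOL-Probability.Probability"
begin

text \<open>
  Cut the Fourier transform of \<open>f\<close> into dyadic annuli, \<open>f = \<Sum>k. f\<^sub>k\<close>, and let \<open>u\<^sub>k\<close> be the evolution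
  of \<open>f\<^sub>k\<close>. Each \<open>u\<^sub>k\<close> is an honest oscillatory integral, with
  \<open>\<bar>u\<^sub>k t - f\<^sub>k\<bar> \<le> min (2 * sup\<^sub>r \<bar>u\<^sub>k r\<bar>) (t * sup\<^sub>r \<bar>P(D) u\<^sub>k r\<bar>)\<close>. The maximal estimate at a regularity
  slightly above \<open>s\<^sub>0\<close>, applied to \<open>f\<^sub>k\<close> and to \<open>P(D) f\<^sub>k\<close> and moved to every unit ball by modulating
  the transform, bounds the two suprema in \<open>L\<^sup>p\<close> by geometric sequences in \<open>k\<close> with ratios
  \<open>2 powr (- a)\<close> and \<open>2 powr (m - a)\<close>, where \<open>a > \<delta>\<close>; almost everywhere the suprema themselves then
  decay at slightly worse rates. Summing over \<open>k\<close> gives \<open>O(t powr (\<delta>' / m))\<close> almost everywhere for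
  some \<open>\<delta>' > \<delta>\<close>, which is stronger than the claim. The same series yields a version of the evolution
  that is continuous in time.

  The underlying \<open>L\<^sup>2\<close> theory rests on Parseval's identity for square integrable functions of bounded
  support, which follows by inserting a Gaussian weight and letting it tend to 1; inversion then
  comes from expanding \<open>\<parallel>F\<^sub>R - f\<parallel>\<^sup>2\<close> and using that the transforms are adjoint to each other.
\<close>

section \<open>Square integrable functions\<close>

text \<open>At a given time the evolution is only an L^2 class, so the maximal hypothesis can be
  used only on data with a known version. For a transform of bounded support the integral converges
  absolutely at every point and is itself such a version. With z = t 2^(mk), the second bound on a
  piece is z times the first, up to constants, and min 1 z \<le> z powr (\<delta>' / m) costs a
  factor 2^(\<delta>' k): this is the origin of the exponent \<delta>' / m. The available decay is
  \<open>s + \<delta> - s'\<close>, where s' is the midpoint of \<open>s\<^sub>0\<close> and s. It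
  exceeds \<delta> by s - s', and this surplus pays for three strict losses: from L^p norms to
  pointwise bounds, from interpolated bounds to a convergent series in k, and from O with \<delta>'
  to o with \<delta>, which also covers \<delta> = 0. The conclusion concerns every version, while
  only one is constructed; two versions agree at all rational times off a single null set, and
  continuity in time does the rest.\<close>

lemma sigma_finite_lebesgue: "sigma_finite_measure (lebesgue :: 'a::euclidean_space measure)"
proof
  obtain A :: "'a set set" where "countable A" "A \<subseteq> sets lborel" "\<Union>A = space lborel"
      "\<forall>a\<in>A. emeasure lborel a \<noteq> \<infinity>"
    using lborel.sigma_finite_countable by blast
  then show "\<exists>A::'a set set. countable A \<and> A \<subseteq> sets lebesgue \<and> \<Union>A = space lebesgue \<and>
      (\<forall>a\<in>A. emeasure lebesgue a \<noteq> \<infinity>)"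
    by (intro exI[of _ A] conjI) (auto intro: sets_completionI_sets)
qed

text \<open>Fubini for the kernel \<open>cis (x \<bullet> \<xi>)\<close> is applied on two copies of
  \<open>lebesgue\<close>, which calls for sigma-finiteness of the completed measure.\<close>

interpretation lebesgue: sigma_finite_measure "lebesgue :: 'a::euclidean_space measure"
  by (rule sigma_finite_lebesgue)

lemma borel_measurable_lebesgueI: "f \<in> borel_measurable borel \<Longrightarrow> f \<in> borel_measurable lebesgue"
  by (rule measurable_completion) (simp only: measurable_lborel2)

lemma continuous_borel_measurable_lebesgue:
  "continuous_on UNIV f \<Longrightarrow> f \<in> borel_measurable lebesgue"
  by (intro borel_measurable_lebesgueI borel_measurable_continuous_onI)

lemma measurable_ident_lebesgue_borel: "(\<lambda>x. x) \<in> lebesgue \<rightarrow>\<^sub>M borel"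
  by (rule continuous_borel_measurable_lebesgue) auto

text \<open>The square of the norm keeps expansions and limits polynomial. Where the integral does
  not exist the value is 0 by default, so square integrability is carried as a separate
  fact.\<close>

definition L2sq :: "('a::euclidean_space \<Rightarrow> complex) \<Rightarrow> real" where
  "L2sq f = (LINT x|lebesgue. (cmod (f x))\<^sup>2)"

lemma L2sq_nonneg: "0 \<le> L2sq f"
  unfolding L2sq_def by (rule integral_nonneg_AE) auto

lemma square_integrable_nn_integral:
  assumes "square_integrable f"
  shows "(\<integral>\<^sup>+x. ennreal ((cmod (f x))\<^sup>2) \<partial>lebesgue) = ennreal (L2sq f)"
  using assms unfolding square_integrable_def L2sq_def
  by (intro nn_integral_eq_integral) auto

lemma square_integrableI_nn_integral:
  assumes "f \<in> borel_measurable lebesgue"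
    and "(\<integral>\<^sup>+x. ennreal ((cmod (f x))\<^sup>2) \<partial>lebesgue) < \<infinity>"
  shows "square_integrable f"
  unfolding square_integrable_def
  using assms by (auto intro!: integrableI_nonneg)

lemma square_integrableD:
  assumes "square_integrable f"
  shows "f \<in> borel_measurable lebesgue" "integrable lebesgue (\<lambda>x. (cmod (f x))\<^sup>2)"
  using assms by (auto simp: square_integrable_def)

lemma square_integrable_bound:
  assumes "square_integrable g" "f \<in> borel_measurable lebesgue"
    and "\<And>x. cmod (f x) \<le> C * cmod (g x)"
  shows "square_integrable f"
  unfolding square_integrable_def
proof
  note [measurable] = assms(2)
  show "f \<in> borel_measurable lebesgue" by fact
  show "integrable lebesgue (\<lambda>x. (cmod (f x))\<^sup>2)"
  proof (rule Bochner_Integration.integrable_bound)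
    show "integrable lebesgue (\<lambda>x. C\<^sup>2 * (cmod (g x))\<^sup>2)"
      using square_integrableD[OF assms(1)] by simp
    show "AE x in lebesgue. norm ((cmod (f x))\<^sup>2) \<le> norm (C\<^sup>2 * (cmod (g x))\<^sup>2)"
      using power_mono[OF assms(3), where n=2] by (auto simp: power_mult_distrib)
  qed simp
qed

lemma square_integrable_add:
  assumes "square_integrable f" "square_integrable g"
  shows "square_integrable (\<lambda>x. f x + g x)"
  unfolding square_integrable_def
proof
  note [measurable] = square_integrableD(1)[OF assms(1)] square_integrableD(1)[OF assms(2)]
  show "(\<lambda>x. f x + g x) \<in> borel_measurable lebesgue" by simp
  have *: "(cmod (a + b))\<^sup>2 \<le> 2 * (cmod a)\<^sup>2 + 2 * (cmod b)\<^sup>2" for a b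
  proof -
    have "(cmod (a + b))\<^sup>2 \<le> (cmod a + cmod b)\<^sup>2"
      by (intro power_mono norm_triangle_ineq) auto
    also have "\<dots> \<le> 2 * (cmod a)\<^sup>2 + 2 * (cmod b)\<^sup>2"
      using sum_squares_bound[of "cmod a" "cmod b"] by (simp add: power2_sum)
    finally show ?thesis .
  qed
  show "integrable lebesgue (\<lambda>x. (cmod (f x + g x))\<^sup>2)"
  proof (rule Bochner_Integration.integrable_bound)
    show "integrable lebesgue (\<lambda>x. 2 * (cmod (f x))\<^sup>2 + 2 * (cmod (g x))\<^sup>2)"
      using square_integrableD[OF assms(1)] square_integrableD[OF assms(2)] by simp
    show "AE x in lebesgue. norm ((cmod (f x + g x))\<^sup>2)
        \<le> norm (2 * (cmod (f x))\<^sup>2 + 2 * (cmod (g x))\<^sup>2)"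
      using * by auto
  qed simp
qed

lemma square_integrable_mult_bounded:
  assumes "square_integrable g" "h \<in> borel_measurable lebesgue" "\<And>x. cmod (h x) \<le> C"
  shows "square_integrable (\<lambda>x. h x * g x)"
proof (rule square_integrable_bound[OF assms(1)])
  note [measurable] = assms(2) square_integrableD(1)[OF assms(1)]
  show "(\<lambda>x. h x * g x) \<in> borel_measurable lebesgue" by simp
  show "cmod (h x * g x) \<le> C * cmod (g x)" for x
    using assms(3)[of x] by (simp add: norm_mult mult_right_mono)
qed

lemma square_integrable_cmult: "square_integrable g \<Longrightarrow> square_integrable (\<lambda>x. c * g x)"
  by (rule square_integrable_mult_bounded[where C="cmod c"]) auto

lemma square_integrable_cnj: "square_integrable g \<Longrightarrow> square_integrable (\<lambda>x. cnj (g x))"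
  unfolding square_integrable_def
  by (auto intro!: borel_measurable_continuous_on[where f=cnj] continuous_intros)

lemma square_integrable_diff:
  assumes "square_integrable f" "square_integrable g"
  shows "square_integrable (\<lambda>x. f x - g x)"
  using square_integrable_add[OF assms(1) square_integrable_cmult[OF assms(2), of "-1"]] by simp

lemma square_integrable_indicator:
  assumes "square_integrable g" "A \<in> sets lebesgue"
  shows "square_integrable (\<lambda>x. indicator A x * g x)"
  by (rule square_integrable_mult_bounded[OF assms(1), where C=1])
    (use assms(2) in \<open>auto simp: indicator_def\<close>)

lemma square_integrable_mult_integrable:
  assumes "square_integrable f" "square_integrable g"
  shows "integrable lebesgue (\<lambda>x. f x * g x)"
proof (rule Bochner_Integration.integrable_bound)
  note [measurable] = square_integrableD(1)[OF assms(1)] square_integrableD(1)[OF assms(2)]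
  show "integrable lebesgue (\<lambda>x. (cmod (f x))\<^sup>2 + (cmod (g x))\<^sup>2)"
    using square_integrableD[OF assms(1)] square_integrableD[OF assms(2)] by simp
  show "AE x in lebesgue. norm (f x * g x) \<le> norm ((cmod (f x))\<^sup>2 + (cmod (g x))\<^sup>2)"
  proof (intro AE_I2)
    fix x
    have "2 * (cmod (f x) * cmod (g x)) \<le> (cmod (f x))\<^sup>2 + (cmod (g x))\<^sup>2"
      using sum_squares_bound[of "cmod (f x)" "cmod (g x)"] by simp
    moreover have "0 \<le> cmod (f x) * cmod (g x)" by simp
    ultimately show "norm (f x * g x) \<le> norm ((cmod (f x))\<^sup>2 + (cmod (g x))\<^sup>2)"
      by (simp add: norm_mult del: mult_nonneg_nonneg)
  qed
  show "(\<lambda>x. f x * g x) \<in> borel_measurable lebesgue" by simp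
qed

text \<open>Expanding the square reduces a statement of L^2 convergence to two norms and one inner
  product; both inversion results are obtained in this way.\<close>

lemma L2sq_diff:
  assumes "square_integrable f" "square_integrable g"
  shows "L2sq (\<lambda>x. f x - g x) = L2sq f - 2 * Re (LINT x|lebesgue. f x * cnj (g x)) + L2sq g"
proof -
  have i: "integrable lebesgue (\<lambda>x. f x * cnj (g x))"
    by (intro square_integrable_mult_integrable square_integrable_cnj assms)
  have *: "(cmod (a - b))\<^sup>2 = (cmod a)\<^sup>2 - 2 * Re (a * cnj b) + (cmod b)\<^sup>2" for a b
    unfolding cmod_power2 by (simp add: power2_eq_square algebra_simps)
  have r: "integrable lebesgue (\<lambda>x. 2 * Re (f x * cnj (g x)))"
    by (intro integrable_mult_right integrable_Re i)
  note fg = square_integrableD(2)[OF assms(1)] square_integrableD(2)[OF assms(2)]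
  have "L2sq (\<lambda>x. f x - g x) = L2sq f - (LINT x|lebesgue. 2 * Re (f x * cnj (g x))) + L2sq g"
    unfolding L2sq_def *
    by (subst Bochner_Integration.integral_add[OF Bochner_Integration.integrable_diff[OF fg(1) r] fg(2)],
        subst Bochner_Integration.integral_diff[OF fg(1) r]) (rule refl)
  also have "(LINT x|lebesgue. 2 * Re (f x * cnj (g x))) = 2 * Re (LINT x|lebesgue. f x * cnj (g x))"
    by (subst integral_mult_right_zero) (simp only: integral_Re[OF i])
  finally show ?thesis .
qed

lemma L2sq_cmult: "L2sq (\<lambda>x. c * f x) = (cmod c)\<^sup>2 * L2sq f"
  unfolding L2sq_def by (simp add: norm_mult power_mult_distrib)

lemma L2sq_cnj: "L2sq (\<lambda>x. cnj (f x)) = L2sq f"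
  unfolding L2sq_def by simp

lemma L2sq_minus_commute: "L2sq (\<lambda>x. f x - g x) = L2sq (\<lambda>x. g x - f x)"
  unfolding L2sq_def by (simp add: norm_minus_commute)

lemma inner_self_L2sq: "(LINT x|lebesgue. f x * cnj (f x)) = of_real (L2sq f)"
  unfolding L2sq_def by (simp add: complex_norm_square[symmetric] integral_complex_of_real del: of_real_power)

lemma L2sq_mono:
  assumes "square_integrable g" "f \<in> borel_measurable lebesgue" "\<And>x. cmod (f x) \<le> cmod (g x)"
  shows "L2sq f \<le> L2sq g"
  unfolding L2sq_def
  using square_integrableD(2)[OF square_integrable_bound[OF assms(1,2), of 1]]
    square_integrableD(2)[OF assms(1)] assms(3)
  by (intro integral_mono power_mono) auto

text \<open>The parallelogram law with one term dropped. It stands in for the triangle inequality;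
  the factor 2 is harmless for distances that tend to 0.\<close>

lemma L2sq_add_le:
  assumes "square_integrable f" "square_integrable g"
  shows "L2sq (\<lambda>x. f x + g x) \<le> 2 * L2sq f + 2 * L2sq g"
proof -
  have "L2sq (\<lambda>x. f x + g x) + L2sq (\<lambda>x. f x - g x) = 2 * L2sq f + 2 * L2sq g"
    using L2sq_diff[OF assms] L2sq_diff[OF assms(1) square_integrable_cmult[OF assms(2), of "-1"]]
      L2sq_cmult[of "-1" g]
    by simp
  then show ?thesis using L2sq_nonneg[of "\<lambda>x. f x - g x"] by linarith
qed

text \<open>The quantity \<open>L2sq\<close> of \<open>f - t * I * g\<close> is nonnegative for real
  \<open>t\<close>. Taking the multiplier in the direction of the inner product \<open>I\<close>
  itself makes the cross term real, which leaves a real quadratic in \<open>t\<close>.\<close>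

lemma cauchy_schwarz:
  assumes "square_integrable f" "square_integrable g"
  shows "(cmod (LINT x|lebesgue. f x * cnj (g x)))\<^sup>2 \<le> L2sq f * L2sq g"
proof -
  define I where "I = (LINT x|lebesgue. f x * cnj (g x))"
  have key: "0 \<le> L2sq f - 2 * t * (cmod I)\<^sup>2 + t\<^sup>2 * (cmod I)\<^sup>2 * L2sq g" for t :: real
  proof -
    have "L2sq (\<lambda>x. f x - (of_real t * I) * g x)
        = L2sq f - 2 * Re (LINT x|lebesgue. f x * cnj ((of_real t * I) * g x)) + t\<^sup>2 * (cmod I)\<^sup>2 * L2sq g"
      by (subst L2sq_diff[OF assms(1) square_integrable_cmult[OF assms(2)]])
        (simp add: L2sq_cmult norm_mult power_mult_distrib)
    also have "(LINT x|lebesgue. f x * cnj ((of_real t * I) * g x))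
        = (LINT x|lebesgue. (of_real t * cnj I) * (f x * cnj (g x)))"
      by (simp add: mult_ac)
    also have "\<dots> = of_real (t * (cmod I)\<^sup>2)"
      by (simp add: I_def[symmetric] complex_norm_square mult_ac del: of_real_power)
    finally show ?thesis using L2sq_nonneg[of "\<lambda>x. f x - (of_real t * I) * g x"] by simp
  qed
  show ?thesis
  proof (cases "L2sq g = 0")
    case True
    have "(cmod I)\<^sup>2 = 0"
    proof (rule ccontr)
      assume *: "(cmod I)\<^sup>2 \<noteq> 0"
      \<comment> \<open>With \<open>L2sq g = 0\<close> the inequality is affine in \<open>t\<close>,
        and this \<open>t\<close> makes its right-hand side \<open>- L2sq f - 2\<close>.\<close>
      show False using key[of "(L2sq f + 1) / (cmod I)\<^sup>2"] * True L2sq_nonneg[of f] by simp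
    qed
    then show ?thesis using True by (simp add: I_def)
  next
    case False
    then have "L2sq g > 0" using L2sq_nonneg[of g] by simp
    then show ?thesis using key[of "1 / L2sq g"] unfolding I_def[symmetric]
      by (simp add: field_simps power2_eq_square)
  qed
qed

section \<open>Limits in L^2\<close>

lemma L2_inner_tendsto:
  assumes "\<And>n. square_integrable (F n)" "square_integrable f" "square_integrable g"
    and "((\<lambda>n. L2sq (\<lambda>x. F n x - f x)) \<longlongrightarrow> 0) net"
  shows "((\<lambda>n. LINT x|lebesgue. F n x * cnj (g x)) \<longlongrightarrow> (LINT x|lebesgue. f x * cnj (g x))) net"
proof -
  have i: "integrable lebesgue (\<lambda>x. h x * cnj (g x))" if "square_integrable h" for h
    by (intro square_integrable_mult_integrable square_integrable_cnj that assms)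
  have eq: "(LINT x|lebesgue. F n x * cnj (g x)) - (LINT x|lebesgue. f x * cnj (g x))
      = (LINT x|lebesgue. (F n x - f x) * cnj (g x))" for n
    by (simp add: Bochner_Integration.integral_diff[OF i[OF assms(1)] i[OF assms(2)], symmetric]
        left_diff_distrib)
  have "((\<lambda>n. sqrt (L2sq (\<lambda>x. F n x - f x) * L2sq g)) \<longlongrightarrow> 0) net"
    using tendsto_real_sqrt[OF tendsto_mult_left_zero[OF assms(4), of "L2sq g"]] by simp
  moreover have "norm ((LINT x|lebesgue. F n x * cnj (g x)) - (LINT x|lebesgue. f x * cnj (g x)))
      \<le> sqrt (L2sq (\<lambda>x. F n x - f x) * L2sq g)" for n
    unfolding eq
    by (intro real_le_rsqrt cauchy_schwarz square_integrable_diff assms)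
  ultimately have "((\<lambda>n. (LINT x|lebesgue. F n x * cnj (g x)) - (LINT x|lebesgue. f x * cnj (g x)))
      \<longlongrightarrow> 0) net"
    by (rule Lim_null_comparison[OF always_eventually[OF allI], rotated])
  then show ?thesis by (subst Lim_null)
qed

lemma L2sq_tendsto:
  assumes "\<And>n. square_integrable (F n)" "square_integrable f"
    and "((\<lambda>n. L2sq (\<lambda>x. F n x - f x)) \<longlongrightarrow> 0) net"
  shows "((\<lambda>n. L2sq (F n)) \<longlongrightarrow> L2sq f) net"
proof -
  have "L2sq (F n) = L2sq (\<lambda>x. F n x - f x) + 2 * Re (LINT x|lebesgue. F n x * cnj (f x)) - L2sq f" for n
    using L2sq_diff[OF assms(1)[of n] assms(2)] by simp
  moreover have "((\<lambda>n. L2sq (\<lambda>x. F n x - f x) + 2 * Re (LINT x|lebesgue. F n x * cnj (f x)) - L2sq f)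
    \<longlongrightarrow> 0 + 2 * Re (LINT x|lebesgue. f x * cnj (f x)) - L2sq f) net"
    by (intro tendsto_intros assms L2_inner_tendsto)
  ultimately show ?thesis by (simp add: inner_self_L2sq)
qed

lemma has_L2_limit_iff:
  assumes "\<And>R. square_integrable (F R)" "square_integrable g"
  shows "has_L2_limit F g \<longleftrightarrow> ((\<lambda>R. L2sq (\<lambda>x. F R x - g x)) \<longlongrightarrow> 0) at_top"
proof -
  have "(\<integral>\<^sup>+x. ennreal ((cmod (F R x - g x))\<^sup>2) \<partial>lebesgue) = ennreal (L2sq (\<lambda>x. F R x - g x))" for R
    by (intro square_integrable_nn_integral square_integrable_diff assms)
  then show ?thesis unfolding has_L2_limit_def using assms(2)
    by (simp add: tendsto_ennreal_iff[of _ _ 0, simplified] L2sq_nonneg)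
qed

lemma L2sq_eq_0_AE:
  assumes "square_integrable (\<lambda>x. f x - g x)" "L2sq (\<lambda>x. f x - g x) = 0"
  shows "AE x in lebesgue. f x = g x"
  using assms integral_nonneg_eq_0_iff_AE[OF square_integrableD(2)[OF assms(1)]]
  by (auto simp: L2sq_def)

lemma L2_limit_unique:
  assumes "\<And>n. square_integrable (F n)" "square_integrable f" "square_integrable g"
    and "((\<lambda>n. L2sq (\<lambda>x. F n x - f x)) \<longlongrightarrow> 0) net" "((\<lambda>n. L2sq (\<lambda>x. F n x - g x)) \<longlongrightarrow> 0) net"
    and "net \<noteq> bot"
  shows "AE x in lebesgue. f x = g x"
proof (rule L2sq_eq_0_AE)
  show "square_integrable (\<lambda>x. f x - g x)" by (intro square_integrable_diff assms)
  have le: "L2sq (\<lambda>x. f x - g x) \<le> 2 * L2sq (\<lambda>x. F n x - g x) + 2 * L2sq (\<lambda>x. F n x - f x)" for n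
    using L2sq_add_le[OF square_integrable_diff[OF assms(1,3)] square_integrable_diff[OF assms(2,1)], of n n]
    by (simp add: L2sq_minus_commute[of "F n" f])
  have "((\<lambda>n. 2 * L2sq (\<lambda>x. F n x - g x) + 2 * L2sq (\<lambda>x. F n x - f x)) \<longlongrightarrow> 2 * 0 + 2 * 0) net"
    by (intro tendsto_intros assms)
  then have "L2sq (\<lambda>x. f x - g x) \<le> 2 * 0 + 2 * 0"
    by (rule tendsto_lowerbound) (auto intro!: always_eventually le assms)
  then show "L2sq (\<lambda>x. f x - g x) = 0" using L2sq_nonneg[of "\<lambda>x. f x - g x"] by simp
qed

text \<open>Bounds an almost everywhere limit that is not yet known to be square integrable, hence
  the formulation in \<open>ennreal\<close>. Applied to differences, it turns a Cauchy estimate into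
  an estimate of the distance to the limit.\<close>

lemma L2_fatou:
  assumes "\<And>n. F n \<in> borel_measurable lebesgue" "f \<in> borel_measurable lebesgue"
    and "AE x in lebesgue. (\<lambda>n. F n x) \<longlonglongrightarrow> f x"
    and "eventually (\<lambda>n. (\<integral>\<^sup>+x. ennreal ((cmod (F n x))\<^sup>2) \<partial>lebesgue) \<le> C) sequentially"
  shows "(\<integral>\<^sup>+x. ennreal ((cmod (f x))\<^sup>2) \<partial>lebesgue) \<le> C"
proof -
  note [measurable] = assms(1,2)
  have "(\<integral>\<^sup>+x. ennreal ((cmod (f x))\<^sup>2) \<partial>lebesgue)
      = (\<integral>\<^sup>+x. liminf (\<lambda>n. ennreal ((cmod (F n x))\<^sup>2)) \<partial>lebesgue)"
  proof (intro nn_integral_cong_AE, use assms(3) in eventually_elim)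
    case (elim x)
    then have "(\<lambda>n. ennreal ((cmod (F n x))\<^sup>2)) \<longlonglongrightarrow> ennreal ((cmod (f x))\<^sup>2)"
      by (intro tendsto_ennrealI tendsto_intros)
    then show ?case using lim_imp_Liminf by force
  qed
  also have "\<dots> \<le> liminf (\<lambda>n. \<integral>\<^sup>+x. ennreal ((cmod (F n x))\<^sup>2) \<partial>lebesgue)"
    by (rule nn_integral_liminf) simp
  also have "\<dots> \<le> liminf (\<lambda>n::nat. C)"
    by (rule Liminf_mono) (use assms(4) in simp)
  also have "\<dots> = C" by (simp add: Liminf_const)
  finally show ?thesis .
qed

section \<open>Oscillatory integrals and Gaussians\<close>

text \<open>The inverse Fourier transform in the present normalisation. For integrable
  \<open>h\<close> it is a continuous function with a value at every point rather than an L^2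
  class.\<close>

definition osc_int :: "('a::euclidean_space \<Rightarrow> complex) \<Rightarrow> 'a \<Rightarrow> complex" where
  "osc_int h x = (LINT \<xi>|lebesgue. cis (x \<bullet> \<xi>) * h \<xi>)"

lemma character_measurable_lebesgue [measurable]: "(\<lambda>\<xi>. cis (x \<bullet> \<xi>)) \<in> borel_measurable lebesgue"
  by (intro continuous_borel_measurable_lebesgue continuous_intros)

lemma integrable_character_mult:
  "integrable lebesgue h \<Longrightarrow> integrable lebesgue (\<lambda>\<xi>. cis (x \<bullet> \<xi>) * h \<xi>)"
  by (rule Bochner_Integration.integrable_bound[of _ h]) (auto simp: norm_mult)

lemma continuous_on_osc_int:
  assumes "integrable lebesgue h"
  shows "continuous_on UNIV (osc_int h)"
proof (rule continuous_on_sequentiallyI)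
  fix u :: "nat \<Rightarrow> 'a" and a
  assume u: "u \<longlonglongrightarrow> a"
  show "(\<lambda>n. osc_int h (u n)) \<longlonglongrightarrow> osc_int h a"
    unfolding osc_int_def
  proof (rule integral_dominated_convergence[where w="\<lambda>\<xi>. norm (h \<xi>)"])
    show "AE \<xi> in lebesgue. (\<lambda>n. cis (u n \<bullet> \<xi>) * h \<xi>) \<longlonglongrightarrow> cis (a \<bullet> \<xi>) * h \<xi>"
      by (intro AE_I2 tendsto_intros u)
  qed (use assms in \<open>auto intro!: borel_measurable_integrable[OF integrable_character_mult] simp: norm_mult\<close>)
qed

lemma osc_int_measurable: "integrable lebesgue h \<Longrightarrow> osc_int h \<in> borel_measurable lebesgue"
  by (intro continuous_borel_measurable_lebesgue continuous_on_osc_int)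

lemma cmod_osc_int_le: "cmod (osc_int h x) \<le> (LINT \<xi>|lebesgue. cmod (h \<xi>))"
  unfolding osc_int_def
  by (rule order_trans[OF integral_norm_bound]) (simp add: norm_mult)

lemma osc_int_diff:
  assumes "integrable lebesgue g" "integrable lebesgue h"
  shows "osc_int (\<lambda>\<xi>. g \<xi> - h \<xi>) x = osc_int g x - osc_int h x"
  unfolding osc_int_def right_diff_distrib
  by (intro Bochner_Integration.integral_diff integrable_character_mult assms)

text \<open>Fubini for \<open>cis (x \<bullet> \<xi>) * h \<xi> * k x\<close>, which is integrable
  on the product because its modulus splits into those of \<open>h\<close> and \<open>k\<close>; the
  kernel is symmetric in \<open>x\<close> and \<open>\<xi>\<close>.\<close>

lemma multiplication_formula:
  assumes "integrable lebesgue h" "integrable lebesgue k"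
  shows "(LINT x|lebesgue. osc_int h x * k x) = (LINT \<xi>|lebesgue. h \<xi> * osc_int k \<xi>)"
proof -
  interpret P: pair_sigma_finite "lebesgue :: 'a measure" "lebesgue :: 'a measure" ..
  define f where "f x \<xi> = cis (x \<bullet> \<xi>) * h \<xi> * k x" for x \<xi>
  have [measurable]: "h \<in> borel_measurable lebesgue" "k \<in> borel_measurable lebesgue"
    using assms by auto
  have m: "(\<lambda>z. cis (fst z \<bullet> snd z)) \<in> borel_measurable (lebesgue \<Otimes>\<^sub>M lebesgue :: ('a \<times> 'a) measure)"
  proof (rule borel_measurable_continuous_on[where f=cis])
    have "fst \<in> lebesgue \<Otimes>\<^sub>M (lebesgue :: 'a measure) \<rightarrow>\<^sub>M (borel :: 'a measure)"
      by (rule measurable_compose[OF measurable_fst measurable_ident_lebesgue_borel])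
    moreover have "snd \<in> (lebesgue :: 'a measure) \<Otimes>\<^sub>M lebesgue \<rightarrow>\<^sub>M (borel :: 'a measure)"
      by (rule measurable_compose[OF measurable_snd measurable_ident_lebesgue_borel])
    ultimately show "(\<lambda>z. fst z \<bullet> snd z) \<in> borel_measurable (lebesgue \<Otimes>\<^sub>M lebesgue :: ('a \<times> 'a) measure)"
      by (rule borel_measurable_inner)
  qed (intro continuous_intros)
  have fm: "case_prod f \<in> borel_measurable (lebesgue \<Otimes>\<^sub>M lebesgue)"
    unfolding f_def case_prod_beta
    by (intro borel_measurable_times m measurable_compose[OF measurable_snd] measurable_compose[OF measurable_fst])
      simp_all
  have int: "integrable (lebesgue \<Otimes>\<^sub>M lebesgue) (case_prod f)"
  proof (rule P.Fubini_integrable[OF fm])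
    have "norm (case_prod f (x, \<xi>)) = norm (k x) * norm (h \<xi>)" for x \<xi>
      by (simp add: f_def norm_mult)
    then show "integrable lebesgue (\<lambda>x. LINT y|lebesgue. norm (case_prod f (x, y)))"
      using assms by simp
    show "AE x in lebesgue. integrable lebesgue (\<lambda>y. case_prod f (x, y))"
      using integrable_character_mult[OF assms(1)] by (simp add: f_def)
  qed
  have "(LINT x|lebesgue. osc_int h x * k x) = (LINT x|lebesgue. LINT \<xi>|lebesgue. f x \<xi>)"
    by (simp add: osc_int_def f_def integral_mult_left_zero)
  also have "\<dots> = (LINT \<xi>|lebesgue. LINT x|lebesgue. f x \<xi>)"
    by (rule P.Fubini_integral[OF int, symmetric])
  also have "\<dots> = (LINT \<xi>|lebesgue. h \<xi> * osc_int k \<xi>)"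
  proof -
    have "f x \<xi> = h \<xi> * (cis (\<xi> \<bullet> x) * k x)" for x \<xi>
      by (simp add: f_def inner_commute mult_ac)
    then show ?thesis by (simp add: osc_int_def integral_mult_right_zero)
  qed
  finally show ?thesis .
qed

text \<open>The parameter is an inverse width: the function tends to 1 pointwise as \<epsilon> tends
  to 0, and dilating the argument by \<open>c\<close> multiplies \<epsilon> by
  \<open>c\<close>.\<close>

definition gauss :: "real \<Rightarrow> 'a::euclidean_space \<Rightarrow> complex" where
  "gauss \<epsilon> x = of_real (exp (- (\<epsilon> * norm x)\<^sup>2 / 2))"

lemma continuous_on_gauss: "continuous_on UNIV (gauss \<epsilon>)"
  unfolding gauss_def by (intro continuous_intros) auto

lemma gauss_measurable [measurable]: "gauss \<epsilon> \<in> borel_measurable borel"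
  by (intro borel_measurable_continuous_onI continuous_on_gauss)

text \<open>This is the characteristic function of the standard normal law, freed of the normalising
  factor of the density.\<close>

lemma
  fixes t :: real
  shows integrable_gauss_real: "integrable lborel (\<lambda>x. cis (t * x) * gauss 1 (x::real))" (is ?A)
    and integral_gauss_real: "(LINT x|lborel. cis (t * x) * gauss 1 (x::real)) = of_real (sqrt (2 * pi)) * gauss 1 t" (is ?B)
proof -
  have eq: "cis (t * x) * gauss 1 x = of_real (sqrt (2 * pi)) * (std_normal_density x *\<^sub>R iexp (t * x))" for x :: real
    by (simp add: gauss_def std_normal_density_def cis_conv_exp scaleR_conv_of_real)
  have i: "integrable lborel (\<lambda>x. std_normal_density x *\<^sub>R iexp (t * x))"
  proof (rule Bochner_Integration.integrable_bound)
    show "integrable lborel std_normal_density"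
      using integrable_std_normal_moment[of 0] by simp
  qed (auto simp: norm_mult)
  show ?A unfolding eq by (rule integrable_mult_right[OF i])
  have "(LINT x|lborel. std_normal_density x *\<^sub>R iexp (t * x)) = char std_normal_distribution t"
    unfolding char_def by (subst integral_density) auto
  also have "\<dots> = gauss 1 t" by (simp add: char_std_normal_distribution gauss_def)
  finally show ?B unfolding eq by (simp only: integral_mult_right_zero)
qed

text \<open>Both the character and the Gaussian factor over \<open>Basis\<close>, and
  \<open>lborel\<close> is the image of a product of one-dimensional Lebesgue measures, so the
  integral is a product of one-dimensional ones.\<close>

lemma
  fixes \<zeta> :: "'a::euclidean_space"
  shows integrable_gauss1: "integrable lborel (\<lambda>x. cis (\<zeta> \<bullet> x) * gauss 1 (x::'a))" (is ?A)
    and integral_gauss1: "(LINT x|lborel. cis (\<zeta> \<bullet> x) * gauss 1 (x::'a))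
      = of_real (sqrt (2 * pi) ^ DIM('a)) * gauss 1 \<zeta>" (is ?B)
proof -
  interpret product_sigma_finite "\<lambda>b::'a. lborel :: real measure" ..
  let ?F = "\<lambda>b t. cis ((\<zeta> \<bullet> b) * t) * gauss 1 (t::real)"
  have split: "gauss 1 x = (\<Prod>b\<in>Basis. gauss 1 (x \<bullet> b))" for x :: 'a
  proof -
    have "(norm x)\<^sup>2 = (\<Sum>b\<in>Basis. (x \<bullet> b)\<^sup>2)"
      unfolding power2_norm_eq_inner by (subst euclidean_inner) (simp add: power2_eq_square)
    then show ?thesis unfolding gauss_def
      by (simp add: sum_divide_distrib sum_negf[symmetric] exp_sum flip: of_real_prod)
  qed
  have split2: "cis (\<zeta> \<bullet> x) = (\<Prod>b\<in>Basis. cis ((\<zeta> \<bullet> b) * (x \<bullet> b)))" for x :: 'a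
    by (simp add: euclidean_inner[of \<zeta> x] cis_conv_exp sum_distrib_left exp_sum)
  have eq: "cis (\<zeta> \<bullet> x) * gauss 1 x = (\<Prod>b\<in>Basis. ?F b (x \<bullet> b))" for x :: 'a
    unfolding split split2 by (rule prod.distrib[symmetric])
  have ev: "(\<Sum>b\<in>Basis. f b *\<^sub>R b) \<bullet> b = f b" if "b \<in> Basis" for b :: 'a and f
    using that by (simp add: inner_sum_left inner_Basis if_distrib sum.delta' cong: if_cong)
  have eq2: "cis (\<zeta> \<bullet> (\<Sum>b\<in>Basis. f b *\<^sub>R b)) * gauss 1 (\<Sum>b\<in>Basis. f b *\<^sub>R b) = (\<Prod>b\<in>Basis. ?F b (f b))" for f
    unfolding eq by (intro prod.cong refl) (simp add: ev)
  have m: "(\<lambda>x. cis (\<zeta> \<bullet> x) * gauss 1 (x::'a)) \<in> borel_measurable borel"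
    by (intro borel_measurable_continuous_onI continuous_intros continuous_on_gauss)
  have p: "(\<lambda>f. \<Sum>b\<in>Basis. f b *\<^sub>R b) \<in> (\<Pi>\<^sub>M b\<in>(Basis::'a set). lborel) \<rightarrow>\<^sub>M borel"
    by simp
  show ?A
    unfolding lborel_eq[where 'a='a]
    by (subst integrable_distr_eq[OF p m])
      (unfold eq2, intro product_integrable_prod, auto intro: integrable_gauss_real)
  have "(LINT x|lborel. cis (\<zeta> \<bullet> x) * gauss 1 (x::'a)) = (\<Prod>b\<in>(Basis::'a set). LINT t|lborel. ?F b t)"
    unfolding lborel_eq[where 'a='a]
    by (subst integral_distr[OF p m])
      (unfold eq2, intro product_integral_prod, auto intro: integrable_gauss_real)
  also have "\<dots> = (\<Prod>b\<in>(Basis::'a set). of_real (sqrt (2 * pi)) * gauss 1 (\<zeta> \<bullet> b))"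
    by (simp only: integral_gauss_real)
  also have "\<dots> = of_real (sqrt (2 * pi) ^ DIM('a)) * gauss 1 \<zeta>"
    by (simp add: prod.distrib split)
  finally show ?B .
qed

lemma integral_lborel_affine:
  fixes f :: "'a::euclidean_space \<Rightarrow> complex"
  assumes [measurable]: "f \<in> borel_measurable borel" and c: "c \<noteq> 0"
  shows "(LINT x|lborel. f x) = \<bar>c\<bar> ^ DIM('a) *\<^sub>R (LINT x|lborel. f (t + c *\<^sub>R x))"
proof -
  have "(LINT x|lborel. f x) = (LINT x|density (distr lborel borel (\<lambda>x. t + c *\<^sub>R x)) (\<lambda>_. \<bar>c\<bar> ^ DIM('a)). f x)"
    by (subst lborel_affine[OF c, of t]) simp
  also have "\<dots> = \<bar>c\<bar> ^ DIM('a) *\<^sub>R (LINT x|lborel. f (t + c *\<^sub>R x))"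
    by (subst integral_density) (auto simp: integral_distr)
  finally show ?thesis .
qed

lemma integrable_lborel_affine:
  fixes f :: "'a::euclidean_space \<Rightarrow> complex"
  assumes f: "integrable lborel f" and c: "c \<noteq> 0"
  shows "integrable lborel (\<lambda>x. f (t + c *\<^sub>R x))"
proof -
  have [measurable]: "f \<in> borel_measurable borel" using f by auto
  have "integrable (density (distr lborel borel (\<lambda>x. t + c *\<^sub>R x)) (\<lambda>_. \<bar>c\<bar> ^ DIM('a))) f"
    using f by (subst lborel_affine[OF c, of t, symmetric])
  then have "integrable lborel (\<lambda>x. \<bar>c\<bar> ^ DIM('a) *\<^sub>R f (t + c *\<^sub>R x))"
    by (subst (asm) integrable_density) (auto simp: integrable_distr_eq)
  from integrable_scaleR_right[OF this, of "inverse (\<bar>c\<bar> ^ DIM('a))"] show ?thesis using c by simp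
qed

lemma gauss_scaleR: "gauss \<epsilon> (c *\<^sub>R x) = gauss (\<epsilon> * c) x"
  by (simp add: gauss_def power_mult_distrib mult_ac)

lemma integrable_gauss:
  assumes "\<epsilon> > 0"
  shows "integrable lebesgue (gauss \<epsilon> :: 'a::euclidean_space \<Rightarrow> complex)"
proof -
  have "integrable lborel (\<lambda>x. gauss 1 (0 + \<epsilon> *\<^sub>R x :: 'a))"
    by (rule integrable_lborel_affine) (use integrable_gauss1[of "0::'a"] assms in auto)
  then show ?thesis by (simp add: gauss_scaleR integrable_completion)
qed

lemma osc_int_gauss:
  fixes \<zeta> :: "'a::euclidean_space"
  assumes "\<epsilon> > 0"
  shows "osc_int (gauss \<epsilon>) \<zeta> = of_real (sqrt (2 * pi) ^ DIM('a) / \<epsilon> ^ DIM('a)) * gauss (1 / \<epsilon>) \<zeta>"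
proof -
  have m: "(\<lambda>x. cis (\<zeta> \<bullet> x) * gauss \<epsilon> (x::'a)) \<in> borel_measurable borel"
    by (intro borel_measurable_continuous_onI continuous_intros continuous_on_gauss)
  have "osc_int (gauss \<epsilon>) \<zeta> = (LINT x|lborel. cis (\<zeta> \<bullet> x) * gauss \<epsilon> (x::'a))"
    unfolding osc_int_def by (rule integral_completion) (use m in simp)
  also have "\<dots> = (1 / \<epsilon>) ^ DIM('a) *\<^sub>R (LINT x|lborel. cis ((\<zeta> /\<^sub>R \<epsilon>) \<bullet> x) * gauss 1 (x::'a))"
    using integral_lborel_affine[OF m, of "1 / \<epsilon>" 0] assms by (simp add: gauss_scaleR divide_inverse)
  also have "\<dots> = (1 / \<epsilon>) ^ DIM('a) *\<^sub>R (of_real (sqrt (2 * pi) ^ DIM('a)) * gauss 1 ((1 / \<epsilon>) *\<^sub>R \<zeta>))"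
    by (subst integral_gauss1) (simp add: divide_inverse)
  finally show ?thesis by (simp add: gauss_scaleR scaleR_conv_of_real power_one_over field_simps)
qed

lemma gauss_le_1: "cmod (gauss \<epsilon> x) \<le> 1"
  by (simp add: gauss_def)

section \<open>Parseval identity\<close>

text \<open>For integrable \<open>h\<close> the function \<open>osc_int h\<close> is merely bounded,
  and the Gaussian makes the integrand on the left integrable. The multiplication formula is used
  twice: to move one transform off \<open>h\<close>, and to evaluate the transform that appears,
  which is a conjugated convolution of \<open>h\<close> with the transform of the Gaussian.\<close>

lemma regularized_parseval:
  assumes h: "integrable lebesgue h" and "\<epsilon> > 0"
  shows "(LINT x|lebesgue. osc_int h x * (cnj (osc_int h x) * gauss \<epsilon> x))
    = (LINT \<xi>|lebesgue. h \<xi> * cnj (LINT \<eta>|lebesgue. h \<eta> * osc_int (gauss \<epsilon>) (\<eta> - \<xi>)))"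
proof -
  note g = integrable_gauss[OF \<open>\<epsilon> > 0\<close>]
  let ?M = "LINT \<xi>|lebesgue. cmod (h \<xi>)"
  have [measurable]: "osc_int h \<in> borel_measurable lebesgue" by (rule osc_int_measurable[OF h])
  have m: "(\<lambda>x. cnj (osc_int h x)) \<in> borel_measurable lebesgue"
    by (intro continuous_borel_measurable_lebesgue continuous_intros continuous_on_osc_int h)
  have gm: "gauss \<epsilon> \<in> borel_measurable lebesgue"
    by (intro borel_measurable_lebesgueI gauss_measurable)
  have i: "integrable lebesgue (\<lambda>x. cnj (osc_int h x) * gauss \<epsilon> x)"
  proof (rule Bochner_Integration.integrable_bound[OF integrable_mult_right[OF g, of "of_real ?M"]])
    show "AE x in lebesgue. norm (cnj (osc_int h x) * gauss \<epsilon> x) \<le> norm (of_real ?M * gauss \<epsilon> x)"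
      by (auto simp: norm_mult intro!: mult_right_mono order_trans[OF cmod_osc_int_le])
    show "(\<lambda>x. cnj (osc_int h x) * gauss \<epsilon> x) \<in> borel_measurable lebesgue"
      by (intro borel_measurable_times m gm)
  qed
  have inner: "osc_int (\<lambda>x. cnj (osc_int h x) * gauss \<epsilon> x) \<xi>
      = cnj (LINT \<eta>|lebesgue. h \<eta> * osc_int (gauss \<epsilon>) (\<eta> - \<xi>))" for \<xi>
  proof -
    let ?k = "\<lambda>x. cis (- \<xi> \<bullet> x) * gauss \<epsilon> x"
    have k: "integrable lebesgue ?k" by (rule integrable_character_mult[OF g])
    have "osc_int (\<lambda>x. cnj (osc_int h x) * gauss \<epsilon> x) \<xi> = (LINT x|lebesgue. cnj (osc_int h x * ?k x))"
      unfolding osc_int_def[of "\<lambda>x. cnj (osc_int h x) * gauss \<epsilon> x"]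
      by (simp add: gauss_def cis_cnj mult_ac)
    also have "\<dots> = cnj (LINT x|lebesgue. osc_int h x * ?k x)"
      by (rule Bochner_Integration.integral_cnj)
    also have "(LINT x|lebesgue. osc_int h x * ?k x) = (LINT \<eta>|lebesgue. h \<eta> * osc_int ?k \<eta>)"
      by (rule multiplication_formula[OF h k])
    also have "osc_int ?k = (\<lambda>\<eta>. osc_int (gauss \<epsilon>) (\<eta> - \<xi>))"
      unfolding osc_int_def by (simp add: inner_diff_left cis_mult mult.assoc[symmetric])
    finally show ?thesis .
  qed
  show ?thesis unfolding multiplication_formula[OF h i] inner ..
qed

lemma ball_sets_lebesgue [measurable, simp]: "ball a R \<in> sets (lebesgue :: 'a::euclidean_space measure)"
  by (rule fmeasurableD[OF lmeasurable_ball])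

lemma square_integrable_bounded_support:
  assumes "f \<in> borel_measurable lebesgue" "\<And>x. cmod (f x) \<le> M" "\<And>x. norm x \<ge> R \<Longrightarrow> f x = 0"
  shows "square_integrable f"
proof (rule square_integrable_bound[where C=M and g="indicator (ball 0 R)"])
  have "integrable lebesgue (indicat_real (ball (0::'a) R))"
    using fmeasurableD2[OF lmeasurable_ball, of "0::'a" R]
    by (intro integrable_real_indicator) (auto simp: less_top)
  moreover have "(cmod (indicator (ball (0::'a) R) x))\<^sup>2 = indicat_real (ball 0 R) x" for x
    by (simp add: indicator_def)
  ultimately show "square_integrable (indicator (ball 0 R) :: 'a \<Rightarrow> complex)"
    unfolding square_integrable_def by (simp add: borel_measurable_indicator)
  show "cmod (f x) \<le> M * cmod (indicator (ball 0 R) x)" for x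
    using assms(2)[of x] assms(3)[of x] by (auto simp: indicator_def)
qed fact

text \<open>Pairing with this function expresses the value of \<open>osc_int\<close> at a point as
  an L^2 inner product when the support lies in the ball. Thus L^2 convergence with common bounded
  support gives pointwise convergence of the transforms.\<close>

lemma square_integrable_character_ball:
  "square_integrable (\<lambda>\<xi>. indicator (ball 0 R) \<xi> * cis (x \<bullet> \<xi>))"
proof (rule square_integrable_bounded_support[where M=1 and R=R])
  show "(\<lambda>\<xi>. indicator (ball 0 R) \<xi> * cis (x \<bullet> \<xi>)) \<in> borel_measurable lebesgue"
    by (intro borel_measurable_times borel_measurable_indicator character_measurable_lebesgue) simp
qed (auto simp: indicator_def)

lemma square_integrable_imp_integrable:
  assumes "square_integrable f" "\<And>x. norm x \<ge> R \<Longrightarrow> f x = 0"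
  shows "integrable lebesgue f"
proof -
  \<comment> \<open>The character with frequency 0 is constantly 1, so the factor is just the
    indicator of the ball.\<close>
  have "integrable lebesgue (\<lambda>x. f x * (indicator (ball 0 R) x * cis (0 \<bullet> x)))"
    by (rule square_integrable_mult_integrable[OF assms(1) square_integrable_character_ball])
  moreover have "(\<lambda>x. f x * (indicator (ball 0 R) x * cis (0 \<bullet> x))) = f"
    using assms(2) by (auto simp: indicator_def fun_eq_iff)
  ultimately show ?thesis by simp
qed

text \<open>Substituting \<open>\<eta> = \<xi> + \<epsilon> *\<^sub>R z\<close> produces the
  Jacobian \<open>\<epsilon> ^ DIM('a)\<close>, which cancels the same power in the denominator of
  the transformed Gaussian.\<close>

lemma gauss_smoothing:
  fixes h :: "'a::euclidean_space \<Rightarrow> complex"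
  assumes h: "continuous_on UNIV h" and \<epsilon>: "\<epsilon> > 0"
  shows "(LINT \<eta>|lebesgue. h \<eta> * osc_int (gauss \<epsilon>) (\<eta> - \<xi>))
    = of_real (sqrt (2 * pi) ^ DIM('a)) * (LINT z|lborel. h (\<xi> + \<epsilon> *\<^sub>R z) * gauss 1 z)"
proof -
  have m: "(\<lambda>\<eta>. h \<eta> * osc_int (gauss \<epsilon>) (\<eta> - \<xi>)) \<in> borel_measurable borel"
    unfolding osc_int_gauss[OF \<epsilon>]
    by (intro borel_measurable_continuous_onI continuous_intros h
        continuous_on_compose2[OF continuous_on_gauss]) auto
  have "(LINT \<eta>|lebesgue. h \<eta> * osc_int (gauss \<epsilon>) (\<eta> - \<xi>)) = (LINT \<eta>|lborel. h \<eta> * osc_int (gauss \<epsilon>) (\<eta> - \<xi>))"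
    by (rule integral_completion) (use m in simp)
  also have "\<dots> = \<epsilon> ^ DIM('a) *\<^sub>R (LINT z|lborel. h (\<xi> + \<epsilon> *\<^sub>R z) * osc_int (gauss \<epsilon>) (\<epsilon> *\<^sub>R z))"
    using integral_lborel_affine[OF m, of \<epsilon> \<xi>] \<epsilon> by simp
  also have "(\<lambda>z. h (\<xi> + \<epsilon> *\<^sub>R z) * osc_int (gauss \<epsilon>) (\<epsilon> *\<^sub>R z))
     = (\<lambda>z. of_real (sqrt (2 * pi) ^ DIM('a) / \<epsilon> ^ DIM('a)) * (h (\<xi> + \<epsilon> *\<^sub>R z) * gauss 1 z))"
    using \<epsilon> by (simp add: osc_int_gauss[OF \<epsilon>] gauss_scaleR mult_ac)
  finally show ?thesis using \<epsilon> by (simp add: scaleR_conv_of_real)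
qed

lemma tendsto_gauss_1:
  assumes "e \<longlonglongrightarrow> 0"
  shows "(\<lambda>n. gauss (e n) x) \<longlonglongrightarrow> 1"
proof -
  have "(\<lambda>n. exp (- (e n * norm x)\<^sup>2 / 2)) \<longlonglongrightarrow> exp (- (0 * norm x)\<^sup>2 / 2)"
    by (intro tendsto_intros assms) auto
  from tendsto_of_real[OF this, where 'a=complex] show ?thesis by (simp add: gauss_def)
qed

text \<open>The smoothed function is an approximate identity applied to \<open>h\<close>. Dominated
  convergence is used in \<open>z\<close>, by continuity and boundedness of \<open>h\<close>, and
  then in \<open>\<xi>\<close>, dominated by a multiple of the modulus of \<open>h\<close>. Of the
  two factors \<open>sqrt (2 * pi) ^ DIM('a)\<close>, one comes from the transform of the Gaussian
  and one from its total mass.\<close>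

lemma regularized_parseval_tendsto:
  fixes h :: "'a::euclidean_space \<Rightarrow> complex"
  assumes h: "continuous_on UNIV h" and M: "\<And>x. cmod (h x) \<le> M" and R: "\<And>x. norm x \<ge> R \<Longrightarrow> h x = 0"
    and e: "e \<longlonglongrightarrow> 0" "\<And>n. e n > 0"
  shows "(\<lambda>n. LINT x|lebesgue. osc_int h x * (cnj (osc_int h x) * gauss (e n) x))
    \<longlonglongrightarrow> of_real ((2 * pi) ^ DIM('a) * L2sq h)"
proof -
  let ?s = "sqrt (2 * pi) ^ DIM('a)"
  have hm: "h \<in> borel_measurable lebesgue" by (rule continuous_borel_measurable_lebesgue[OF h])
  have hi: "integrable lebesgue h"
    by (rule square_integrable_imp_integrable[OF square_integrable_bounded_support[OF hm M R] R])
  have g: "integrable lborel (gauss 1 :: 'a \<Rightarrow> complex)"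
    using integrable_gauss1[of "0::'a"] by simp
  have g0: "(LINT z|lborel. gauss 1 (z::'a)) = of_real ?s"
    using integral_gauss1[of "0::'a"] by (simp add: gauss_def)
  have [measurable]: "h \<in> borel_measurable borel" by (intro borel_measurable_continuous_onI h)
  have M0: "M \<ge> 0" using M[of 0] norm_ge_zero order_trans by blast
  define Q where "Q n \<xi> = (LINT z|lborel. h (\<xi> + e n *\<^sub>R z) * gauss 1 z)" for n \<xi>
  have gi: "integrable lborel (\<lambda>z. M * norm (gauss 1 (z::'a)))"
    using g by simp
  have Qlim: "(\<lambda>n. Q n \<xi>) \<longlonglongrightarrow> h \<xi> * of_real ?s" for \<xi>
  proof -
    have "(\<lambda>n. Q n \<xi>) \<longlonglongrightarrow> (LINT z|lborel. h \<xi> * gauss 1 (z::'a))"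
      unfolding Q_def
    proof (rule integral_dominated_convergence[where w="\<lambda>z. M * norm (gauss 1 z)"])
      show "integrable lborel (\<lambda>z. M * norm (gauss 1 (z::'a)))" by (rule gi)
      show "AE z in lborel. (\<lambda>n. h (\<xi> + e n *\<^sub>R z) * gauss 1 z) \<longlonglongrightarrow> h \<xi> * gauss 1 z"
      proof (intro AE_I2 tendsto_mult tendsto_const)
        fix z
        have "(\<lambda>n. \<xi> + e n *\<^sub>R z) \<longlonglongrightarrow> \<xi> + 0 *\<^sub>R z" by (intro tendsto_intros e)
        then show "(\<lambda>n. h (\<xi> + e n *\<^sub>R z)) \<longlonglongrightarrow> h \<xi>"
          using continuous_on_tendsto_compose[OF h, of "\<lambda>n. \<xi> + e n *\<^sub>R z" \<xi>] by simp
      qed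
      show "AE z in lborel. norm (h (\<xi> + e n *\<^sub>R z) * gauss 1 z) \<le> M * norm (gauss 1 z)" for n
        using M by (auto simp: norm_mult intro!: mult_right_mono)
    qed simp_all
    then show ?thesis by (simp only: integral_mult_right_zero g0)
  qed
  have Qbd: "cmod (Q n \<xi>) \<le> M * (LINT z|lborel. norm (gauss 1 (z::'a)))" for n \<xi>
  proof -
    have "cmod (Q n \<xi>) \<le> (LINT z|lborel. M * norm (gauss 1 (z::'a)))"
      unfolding Q_def
    proof (rule Bochner_Integration.integral_norm_bound_integral[OF _ gi])
      show "integrable lborel (\<lambda>z. h (\<xi> + e n *\<^sub>R z) * gauss 1 z)"
        by (rule Bochner_Integration.integrable_bound[OF gi])
          (use M M0 in \<open>auto simp: norm_mult intro!: mult_right_mono\<close>)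
    qed (use M in \<open>auto simp: norm_mult intro!: mult_right_mono\<close>)
    then show ?thesis by simp
  qed
  have Qm: "(\<lambda>\<xi>. cnj (of_real ?s * Q n \<xi>)) \<in> borel_measurable lebesgue" for n
  proof -
    have "Q n \<in> borel_measurable borel" unfolding Q_def by measurable
    then have "(\<lambda>\<xi>. cnj (of_real ?s * Q n \<xi>)) \<in> borel_measurable borel"
      by (intro borel_measurable_continuous_on[where f=cnj] continuous_intros) simp
    then show ?thesis by (rule borel_measurable_lebesgueI)
  qed
  have eq: "(LINT x|lebesgue. osc_int h x * (cnj (osc_int h x) * gauss (e n) x))
     = (LINT \<xi>|lebesgue. h \<xi> * cnj (of_real ?s * Q n \<xi>))" for n
    unfolding regularized_parseval[OF hi e(2)] gauss_smoothing[OF h e(2)] Q_def ..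
  have "(\<lambda>n. LINT \<xi>|lebesgue. h \<xi> * cnj (of_real ?s * Q n \<xi>))
    \<longlonglongrightarrow> (LINT \<xi>|lebesgue. h \<xi> * cnj (of_real ?s * (h \<xi> * of_real ?s)))"
  proof (rule integral_dominated_convergence)
    show "integrable lebesgue (\<lambda>\<xi>. norm (h \<xi>) * (?s * (M * (LINT z|lborel. norm (gauss 1 (z::'a))))))"
      using hi by simp
    show "(\<lambda>\<xi>. h \<xi> * cnj (of_real ?s * (h \<xi> * of_real ?s))) \<in> borel_measurable lebesgue"
      by (intro continuous_borel_measurable_lebesgue continuous_intros h)
    show "(\<lambda>\<xi>. h \<xi> * cnj (of_real ?s * Q n \<xi>)) \<in> borel_measurable lebesgue" for n
      by (intro borel_measurable_times hm Qm)
    show "AE \<xi> in lebesgue. (\<lambda>n. h \<xi> * cnj (of_real ?s * Q n \<xi>)) \<longlonglongrightarrow> h \<xi> * cnj (of_real ?s * (h \<xi> * of_real ?s))"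
      by (intro AE_I2 tendsto_intros Qlim)
    show "AE \<xi> in lebesgue. norm (h \<xi> * cnj (of_real ?s * Q n \<xi>))
        \<le> norm (h \<xi>) * (?s * (M * (LINT z|lborel. norm (gauss 1 (z::'a)))))" for n
      by (intro AE_I2) (auto simp: norm_mult norm_power intro!: mult_left_mono Qbd)
  qed
  also have "(LINT \<xi>|lebesgue. h \<xi> * cnj (of_real ?s * (h \<xi> * of_real ?s)))
      = of_real (?s * ?s) * (LINT \<xi>|lebesgue. h \<xi> * cnj (h \<xi>))"
    by (subst integral_mult_right_zero[symmetric]) (simp add: mult_ac)
  also have "\<dots> = of_real ((2 * pi) ^ DIM('a) * L2sq h)"
  proof -
    have "?s * ?s = (2 * pi) ^ DIM('a)"
      unfolding power_mult_distrib[symmetric] by simp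
    then show ?thesis unfolding inner_self_L2sq by (simp only: of_real_mult)
  qed
  finally show ?thesis unfolding eq .
qed

text \<open>The regularised integrals are squared norms of \<open>osc_int h\<close> damped by a
  Gaussian. Fatou bounds the undamped norm by their limit, and the damping factor, being at most 1,
  gives the opposite inequality.\<close>

lemma parseval_continuous:
  fixes h :: "'a::euclidean_space \<Rightarrow> complex"
  assumes h: "continuous_on UNIV h" and R: "\<And>x. norm x \<ge> R \<Longrightarrow> h x = 0"
  shows "square_integrable (osc_int h)" "L2sq (osc_int h) = (2 * pi) ^ DIM('a) * L2sq h"
proof -
  let ?c = "(2 * pi) ^ DIM('a) * L2sq h"
  have "bounded (h ` cball 0 R)"
    by (intro compact_imp_bounded compact_continuous_image continuous_on_subset[OF h]) auto
  then obtain M where "\<forall>y\<in>h ` cball 0 R. cmod y \<le> M" "M > 0" using bounded_pos by blast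
  then have M: "cmod (h x) \<le> M" for x
    using R[of x] by (cases "norm x \<le> R") auto
  have hm: "h \<in> borel_measurable lebesgue" by (rule continuous_borel_measurable_lebesgue[OF h])
  have hi: "integrable lebesgue h"
    by (rule square_integrable_imp_integrable[OF square_integrable_bounded_support[OF hm M R] R])
  note Em = osc_int_measurable[OF hi]
  define e where "e n = inverse (real (Suc n))" for n
  have e: "e \<longlonglongrightarrow> 0" "e n > 0" for n unfolding e_def by (rule LIMSEQ_inverse_real_of_nat) simp
  define F where "F n x = osc_int h x * gauss (e n) x" for n x
  have gm: "gauss (e n) \<in> borel_measurable lebesgue" for n
    by (intro borel_measurable_lebesgueI gauss_measurable)
  have Fm: "F n \<in> borel_measurable lebesgue" for n
    unfolding F_def by (intro borel_measurable_times Em gm)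
  \<comment> \<open>Width parameter \<open>sqrt 2 * e n\<close> makes the weight a perfect square,
    so that it can be split evenly between \<open>osc_int h\<close> and its conjugate.\<close>
  have g2: "gauss (sqrt 2 * e n) x = gauss (e n) x * cnj (gauss (e n) x)" for n x
    by (simp add: gauss_def power_mult_distrib flip: exp_add of_real_mult)
  have g3: "cmod (gauss (sqrt 2 * e n) x) = (cmod (gauss (e n) x))\<^sup>2" for n x
    unfolding g2 by (simp add: norm_mult power2_eq_square)
  have Fi: "integrable lebesgue (\<lambda>x. (cmod (F n x))\<^sup>2)" for n
  proof (rule Bochner_Integration.integrable_bound)
    show "integrable lebesgue (\<lambda>x. (LINT \<xi>|lebesgue. cmod (h \<xi>))\<^sup>2 * norm (gauss (sqrt 2 * e n) x))"
      by (intro integrable_mult_right integrable_norm integrable_gauss) (simp add: e(2))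
    show "AE x in lebesgue. norm ((cmod (F n x))\<^sup>2) \<le> norm ((LINT \<xi>|lebesgue. cmod (h \<xi>))\<^sup>2 * norm (gauss (sqrt 2 * e n) x))"
      unfolding F_def g3
      by (intro AE_I2) (auto simp: norm_mult power_mult_distrib
          intro!: mult_right_mono power_mono cmod_osc_int_le)
  qed (use Fm in simp)
  have Fs: "square_integrable (F n)" for n using Fi Fm by (auto simp: square_integrable_def)
  have "(\<lambda>n. sqrt 2 * e n) \<longlonglongrightarrow> sqrt 2 * 0" by (intro tendsto_intros e)
  then have "(\<lambda>n. LINT x|lebesgue. osc_int h x * (cnj (osc_int h x) * gauss (sqrt 2 * e n) x)) \<longlonglongrightarrow> of_real ?c"
    using e by (intro regularized_parseval_tendsto[OF h M R]) auto
  also have "(\<lambda>n. LINT x|lebesgue. osc_int h x * (cnj (osc_int h x) * gauss (sqrt 2 * e n) x)) = (\<lambda>n. of_real (L2sq (F n)))"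
    unfolding g2 inner_self_L2sq[symmetric] F_def by (simp add: mult_ac)
  finally have lim: "(\<lambda>n. L2sq (F n)) \<longlonglongrightarrow> ?c" by (simp only: tendsto_of_real_iff)
  \<comment> \<open>The norms converge to \<open>?c\<close> but need not lie below it, so a slack
    \<open>d\<close> provides an eventual bound for Fatou; \<open>d = 1\<close> yields square
    integrability, and arbitrary \<open>d\<close> the sharp inequality.\<close>
  have le: "(\<integral>\<^sup>+x. ennreal ((cmod (osc_int h x))\<^sup>2) \<partial>lebesgue) \<le> ennreal (?c + d)" if "d > 0" for d
  proof (rule L2_fatou[OF Fm Em])
    show "AE x in lebesgue. (\<lambda>n. F n x) \<longlonglongrightarrow> osc_int h x"
      using tendsto_mult[OF tendsto_const tendsto_gauss_1[OF e(1)]] by (auto simp: F_def)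
    have "eventually (\<lambda>n. L2sq (F n) < ?c + d) sequentially"
      using order_tendstoD(2)[OF lim, of "?c + d"] that by simp
    then show "\<forall>\<^sub>F n in sequentially. (\<integral>\<^sup>+x. ennreal ((cmod (F n x))\<^sup>2) \<partial>lebesgue) \<le> ennreal (?c + d)"
      by eventually_elim (simp add: square_integrable_nn_integral[OF Fs] ennreal_leI)
  qed
  show s: "square_integrable (osc_int h)"
    by (rule square_integrableI_nn_integral[OF Em]) (use le[of 1] in \<open>auto intro: le_less_trans\<close>)
  have c0: "?c \<ge> 0" by (simp add: L2sq_nonneg)
  have "L2sq (osc_int h) \<le> ?c + d" if "d > 0" for d
    using le[OF that] that c0 unfolding square_integrable_nn_integral[OF s]
    by (subst (asm) ennreal_le_iff) auto
  then have "L2sq (osc_int h) \<le> ?c" by (rule field_le_epsilon)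
  moreover have "?c \<le> L2sq (osc_int h)"
  proof (rule LIMSEQ_le_const2[OF lim], intro exI allI impI)
    fix n
    show "L2sq (F n) \<le> L2sq (osc_int h)"
      by (rule L2sq_mono[OF s Fm]) (simp add: F_def norm_mult mult_left_le gauss_le_1)
  qed
  ultimately show "L2sq (osc_int h) = ?c" by simp
qed

section \<open>Approximation by continuous functions and the general Parseval identity\<close>

lemma L2sq_dominated_convergence:
  assumes "\<And>n. F n \<in> borel_measurable lebesgue" "square_integrable w"
    and "\<And>n x. cmod (F n x) \<le> cmod (w x)" and "AE x in lebesgue. (\<lambda>n. F n x) \<longlonglongrightarrow> 0"
  shows "(\<lambda>n. L2sq (F n)) \<longlonglongrightarrow> 0"
proof -
  have "(\<lambda>n. LINT x|lebesgue. (cmod (F n x))\<^sup>2) \<longlonglongrightarrow> (LINT x|(lebesgue :: 'a measure). 0)"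
  proof (rule integral_dominated_convergence[where w="\<lambda>x. (cmod (w x))\<^sup>2"])
    note [measurable] = assms(1)
    show "(\<lambda>x. (cmod (F n x))\<^sup>2) \<in> borel_measurable lebesgue" for n by measurable
    show "AE x in lebesgue. (\<lambda>n. (cmod (F n x))\<^sup>2) \<longlonglongrightarrow> 0"
      using assms(4)
    proof eventually_elim
      case (elim x)
      then have "(\<lambda>n. (cmod (F n x))\<^sup>2) \<longlonglongrightarrow> (cmod 0)\<^sup>2" by (intro tendsto_intros)
      then show ?case by simp
    qed
    show "AE x in lebesgue. norm ((cmod (F n x))\<^sup>2) \<le> (cmod (w x))\<^sup>2" for n
      using assms(3) by (auto intro!: power_mono)
  qed (use square_integrableD[OF assms(2)] in auto)
  then show ?thesis by (simp add: L2sq_def)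
qed

text \<open>The radial retraction onto the closed disc of radius \<open>M\<close>. The maximum in
  the denominator keeps it continuous, also at 0.\<close>

definition clamp_disc :: "real \<Rightarrow> complex \<Rightarrow> complex" where
  "clamp_disc M z = (M / max M (cmod z)) *\<^sub>R z"

lemma cmod_clamp_disc: "M > 0 \<Longrightarrow> cmod (clamp_disc M z) \<le> M"
  by (cases "cmod z \<le> M") (auto simp: clamp_disc_def max_def)

lemma clamp_disc_le: "M > 0 \<Longrightarrow> cmod (clamp_disc M z) \<le> cmod z"
  by (cases "cmod z \<le> M") (auto simp: clamp_disc_def max_def)

lemma clamp_disc_eq: "M > 0 \<Longrightarrow> cmod z \<le> M \<Longrightarrow> clamp_disc M z = z"
  by (auto simp: clamp_disc_def max_def)

lemma continuous_on_clamp_disc: "M > 0 \<Longrightarrow> continuous_on UNIV (clamp_disc M)"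
  unfolding clamp_disc_def by (intro continuous_intros) (auto simp: max_def)

text \<open>A measurable function is an almost everywhere limit of continuous ones. Clamping the
  values and multiplying by a radial cutoff leaves the limit unchanged and gives a common bound and
  support, so dominated convergence applies.\<close>

lemma continuous_dense_L2_bounded:
  fixes g :: "'a::euclidean_space \<Rightarrow> complex"
  assumes gm: "g \<in> borel_measurable lebesgue" and M: "\<And>x. cmod (g x) \<le> M" "M > 0"
    and R: "\<And>x. norm x \<ge> R \<Longrightarrow> g x = 0" and "e > 0"
  shows "\<exists>h. continuous_on UNIV h \<and> (\<forall>x. norm x \<ge> R + 1 \<longrightarrow> h x = 0) \<and> L2sq (\<lambda>x. h x - g x) < e"
proof -
  have "g measurable_on UNIV" by (rule lebesgue_measurable_imp_measurable_on[OF gm]) simp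
  then obtain N H where N: "negligible N" and H: "\<And>n. continuous_on UNIV (H n)"
      and lim: "\<And>x. x \<notin> N \<Longrightarrow> (\<lambda>n. H n x) \<longlonglongrightarrow> g x"
    unfolding measurable_on_def by auto
  \<comment> \<open>Equal to 1 for \<open>norm x \<le> R\<close> and to 0 from \<open>R + 1\<close>
    on; the unit collar is where continuity is bought.\<close>
  define ch where "ch x = max 0 (min 1 (R + 1 - norm x))" for x :: 'a
  have ch: "continuous_on UNIV ch" unfolding ch_def by (intro continuous_intros)
  define h where "h n x = ch x *\<^sub>R clamp_disc M (H n x)" for n x
  have hc: "continuous_on UNIV (h n)" for n
    unfolding h_def
    by (intro continuous_intros ch continuous_on_compose2[OF continuous_on_clamp_disc[OF M(2)] H]) auto
  have h0: "h n x = 0" if "norm x \<ge> R + 1" for n x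
    using that by (simp add: h_def ch_def)
  have hb: "cmod (h n x) \<le> M" for n x
  proof -
    have "cmod (h n x) \<le> 1 * M"
      unfolding h_def norm_scaleR by (intro mult_mono cmod_clamp_disc M) (auto simp: ch_def)
    then show ?thesis by simp
  qed
  define w :: "'a \<Rightarrow> complex" where "w x = indicator (ball 0 (R + 1)) x * of_real (2 * M)" for x
  have "(\<lambda>n. L2sq (\<lambda>x. h n x - g x)) \<longlonglongrightarrow> 0"
  proof (rule L2sq_dominated_convergence)
    show "(\<lambda>x. h n x - g x) \<in> borel_measurable lebesgue" for n
      by (intro borel_measurable_diff continuous_borel_measurable_lebesgue hc gm)
    show "square_integrable w"
    proof (rule square_integrable_bounded_support)
      show "w \<in> borel_measurable lebesgue" unfolding w_def
        by (intro borel_measurable_times borel_measurable_indicator) auto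
      show "cmod (w x) \<le> 2 * M" for x using M(2) by (auto simp: w_def indicator_def)
      show "w x = 0" if "R + 1 \<le> norm x" for x using that by (auto simp: w_def indicator_def)
    qed
    show "cmod (h n x - g x) \<le> cmod (w x)" for n x
    proof (cases "norm x < R + 1")
      case True
      have "cmod (h n x - g x) \<le> M + M" by (rule norm_triangle_le_diff[OF add_mono[OF hb M(1)]])
      then show ?thesis using True M(2) by (simp add: w_def norm_mult)
    next
      case False
      then show ?thesis using h0[of x n] R[of x] by simp
    qed
    have "AE x in lebesgue. x \<notin> N"
      using N by (simp add: AE_not_in negligible_iff_null_sets)
    then show "AE x in lebesgue. (\<lambda>n. h n x - g x) \<longlonglongrightarrow> 0"
    proof eventually_elim
      case (elim x)
      have "(\<lambda>n. h n x - g x) \<longlonglongrightarrow> ch x *\<^sub>R clamp_disc M (g x) - g x"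
        unfolding h_def
        by (intro tendsto_intros continuous_on_tendsto_compose[OF continuous_on_clamp_disc[OF M(2)] lim[OF elim]]) auto
      moreover have "ch x *\<^sub>R clamp_disc M (g x) = g x"
      proof (cases "norm x < R")
        case True
        then show ?thesis using clamp_disc_eq[OF M(2,1), of x] by (simp add: ch_def)
      next
        case False
        then show ?thesis using R[of x] by (simp add: clamp_disc_def)
      qed
      ultimately show ?case by simp
    qed
  qed
  then have "eventually (\<lambda>n. L2sq (\<lambda>x. h n x - g x) < e) sequentially"
    using \<open>e > 0\<close> by (rule order_tendstoD(2))
  then obtain n where "L2sq (\<lambda>x. h n x - g x) < e" by (auto simp: eventually_sequentially)
  then show ?thesis using hc[of n] h0[of _ n] by blast
qed

text \<open>Clamping at height \<open>Suc n\<close> reduces to bounded functions. Each of the two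
  errors is below \<open>e / 4\<close>, and \<open>L2sq_add_le\<close> doubles both.\<close>

lemma continuous_dense_L2:
  fixes g :: "'a::euclidean_space \<Rightarrow> complex"
  assumes g: "square_integrable g" and R: "\<And>x. norm x \<ge> R \<Longrightarrow> g x = 0" and e: "e > 0"
  shows "\<exists>h. continuous_on UNIV h \<and> (\<forall>x. norm x \<ge> R + 1 \<longrightarrow> h x = 0) \<and> L2sq (\<lambda>x. h x - g x) < e"
proof -
  define k where "k n x = clamp_disc (real (Suc n)) (g x)" for n x
  note gm = square_integrableD(1)[OF g]
  have km: "k n \<in> borel_measurable lebesgue" for n
    unfolding k_def by (rule borel_measurable_continuous_on[OF continuous_on_clamp_disc gm]) simp
  have kle: "cmod (k n x) \<le> cmod (g x)" for n x unfolding k_def by (rule clamp_disc_le) simp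
  have ks: "square_integrable (k n)" for n
    by (rule square_integrable_bound[OF g km, where C=1]) (simp add: kle)
  have "(\<lambda>n. L2sq (\<lambda>x. k n x - g x)) \<longlonglongrightarrow> 0"
  proof (rule L2sq_dominated_convergence)
    show "(\<lambda>x. k n x - g x) \<in> borel_measurable lebesgue" for n
      by (intro borel_measurable_diff km gm)
    show "square_integrable (\<lambda>x. 2 * g x)" by (rule square_integrable_cmult[OF g])
    show "cmod (k n x - g x) \<le> cmod (2 * g x)" for n x
      using norm_triangle_ineq4[of "k n x" "g x"] kle[of n x] by (simp add: norm_mult)
    show "AE x in lebesgue. (\<lambda>n. k n x - g x) \<longlonglongrightarrow> 0"
    proof (intro AE_I2 tendsto_eventually)
      fix x
      obtain N where "cmod (g x) < real N" using reals_Archimedean2 by blast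
      then have "k n x - g x = 0" if "n \<ge> N" for n
        using that by (simp add: k_def clamp_disc_eq)
      then show "eventually (\<lambda>n. k n x - g x = 0) sequentially"
        by (auto simp: eventually_sequentially)
    qed
  qed
  then have "eventually (\<lambda>n. L2sq (\<lambda>x. k n x - g x) < e / 4) sequentially"
    using e by (intro order_tendstoD(2)) auto
  then obtain n where n: "L2sq (\<lambda>x. k n x - g x) < e / 4" by (auto simp: eventually_sequentially)
  have "\<exists>h. continuous_on UNIV h \<and> (\<forall>x. norm x \<ge> R + 1 \<longrightarrow> h x = 0) \<and> L2sq (\<lambda>x. h x - k n x) < e / 4"
  proof (rule continuous_dense_L2_bounded[OF km])
    show "cmod (k n x) \<le> real (Suc n)" for x unfolding k_def by (rule cmod_clamp_disc) simp
  qed (use e R in \<open>auto simp: k_def clamp_disc_def\<close>)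
  then obtain h where h: "continuous_on UNIV h" "\<forall>x. norm x \<ge> R + 1 \<longrightarrow> h x = 0"
    "L2sq (\<lambda>x. h x - k n x) < e / 4" by blast
  have hs: "square_integrable (\<lambda>x. h x - k n x)"
  proof -
    have "bounded (h ` cball 0 (R + 1))"
      by (intro compact_imp_bounded compact_continuous_image continuous_on_subset[OF h(1)]) auto
    then obtain M where "\<forall>y\<in>h ` cball 0 (R + 1). cmod y \<le> M" "M > 0" using bounded_pos by blast
    then have M: "cmod (h x) \<le> M" for x
      using h(2) by (cases "norm x \<le> R + 1") auto
    have "square_integrable h"
      by (rule square_integrable_bounded_support[OF continuous_borel_measurable_lebesgue[OF h(1)] M])
        (use h(2) in blast)
    then show ?thesis by (rule square_integrable_diff[OF _ ks])
  qed
  have "L2sq (\<lambda>x. h x - g x) \<le> 2 * L2sq (\<lambda>x. h x - k n x) + 2 * L2sq (\<lambda>x. k n x - g x)"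
    using L2sq_add_le[OF hs square_integrable_diff[OF ks g], of n] by simp
  then have "L2sq (\<lambda>x. h x - g x) < e" using n h(3) by simp
  then show ?thesis using h by blast
qed

text \<open>Continuous approximants supported in one common ball have transforms converging
  pointwise. Parseval for their differences makes these transforms Cauchy in L^2, and Fatou
  identifies the limit as \<open>osc_int g\<close>.\<close>

lemma
  fixes g :: "'a::euclidean_space \<Rightarrow> complex"
  assumes g: "square_integrable g" and R: "\<And>x. norm x \<ge> R \<Longrightarrow> g x = 0"
  shows square_integrable_osc_int: "square_integrable (osc_int g)"
    and parseval: "L2sq (osc_int g) = (2 * pi) ^ DIM('a) * L2sq g"
proof -
  let ?c = "(2 * pi) ^ DIM('a) :: real"
  have c: "?c > 0" by simp
  have "\<exists>h. continuous_on UNIV h \<and> (\<forall>x. norm x \<ge> R + 1 \<longrightarrow> h x = 0) \<and> L2sq (\<lambda>x. h x - g x) < inverse (real (Suc n))" for n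
    by (rule continuous_dense_L2[OF g R]) auto
  then obtain h where hc: "\<And>n. continuous_on UNIV (h n)" and h0: "\<And>n x. norm x \<ge> R + 1 \<Longrightarrow> h n x = 0"
    and h: "\<And>n. L2sq (\<lambda>x. h n x - g x) < inverse (real (Suc n))"
    by metis
  have R': "norm x \<ge> R + 1 \<Longrightarrow> g x = 0" for x using R[of x] by simp
  have hs: "square_integrable (h n)" for n
  proof -
    have "bounded (h n ` cball 0 (R + 1))"
      by (intro compact_imp_bounded compact_continuous_image continuous_on_subset[OF hc]) auto
    then obtain M where "\<forall>y\<in>h n ` cball 0 (R + 1). cmod y \<le> M" "M > 0" using bounded_pos by blast
    then have M: "cmod (h n x) \<le> M" for x
      using h0[of x n] by (cases "norm x \<le> R + 1") auto
    show ?thesis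
      by (rule square_integrable_bounded_support[OF continuous_borel_measurable_lebesgue[OF hc] M h0])
  qed
  have ih: "integrable lebesgue (h n)" for n
    by (rule square_integrable_imp_integrable[OF hs]) (rule h0)
  have ig: "integrable lebesgue g"
    by (rule square_integrable_imp_integrable[OF g R])
  have P: "square_integrable (osc_int (h n))" "L2sq (osc_int (h n)) = ?c * L2sq (h n)" for n
    by (rule parseval_continuous[OF hc], rule h0, assumption)+
  define a where "a n = L2sq (\<lambda>x. h n x - g x)" for n
  have a0: "a \<longlonglongrightarrow> 0"
  proof (rule tendsto_sandwich[OF _ _ tendsto_const LIMSEQ_inverse_real_of_nat])
    show "\<forall>\<^sub>F n in sequentially. a n \<le> inverse (real (Suc n))"
      unfolding a_def by (intro always_eventually allI less_imp_le h)
  qed (simp add: a_def L2sq_nonneg)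
  have pw: "(\<lambda>n. osc_int (h n) x) \<longlonglongrightarrow> osc_int g x" for x
  proof -
    have "osc_int f x = (LINT \<xi>|lebesgue. f \<xi> * cnj (indicator (ball 0 (R + 1)) \<xi> * cis (- x \<bullet> \<xi>)))"
      if "\<And>\<xi>. norm \<xi> \<ge> R + 1 \<Longrightarrow> f \<xi> = 0" for f
    proof -
      have "cis (x \<bullet> \<xi>) * f \<xi> = f \<xi> * cnj (indicator (ball 0 (R + 1)) \<xi> * cis (- x \<bullet> \<xi>))" for \<xi>
        using that[of \<xi>] by (auto simp: indicator_def cis_cnj)
      then show ?thesis by (simp only: osc_int_def)
    qed
    note eq = this
    have "osc_int (h n) x = (LINT \<xi>|lebesgue. h n \<xi> * cnj (indicator (ball 0 (R + 1)) \<xi> * cis (- x \<bullet> \<xi>)))" for n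
      by (rule eq) (rule h0)
    moreover have "osc_int g x = (LINT \<xi>|lebesgue. g \<xi> * cnj (indicator (ball 0 (R + 1)) \<xi> * cis (- x \<bullet> \<xi>)))"
      by (rule eq) (rule R')
    ultimately show ?thesis
      using L2_inner_tendsto[OF hs g square_integrable_character_ball a0[unfolded a_def]] by (simp only:)
  qed
  \<comment> \<open>Here \<open>n\<close> is fixed and the second index tends to infinity;
    \<open>inverse (Suc n)\<close> is an eventual bound for \<open>2 * a m\<close>.\<close>
  have bd: "(\<integral>\<^sup>+x. ennreal ((cmod (osc_int (h n) x - osc_int g x))\<^sup>2) \<partial>lebesgue)
      \<le> ennreal (?c * (2 * a n + inverse (Suc n)))" for n
  proof (rule L2_fatou)
    have "eventually (\<lambda>m. 2 * a m < inverse (Suc n)) sequentially"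
      using order_tendstoD(2)[OF a0, of "inverse (Suc n) / 2"] by (auto elim: eventually_mono)
    then show "\<forall>\<^sub>F m in sequentially. (\<integral>\<^sup>+x. ennreal ((cmod (osc_int (h n) x - osc_int (h m) x))\<^sup>2) \<partial>lebesgue)
      \<le> ennreal (?c * (2 * a n + inverse (Suc n)))"
    proof eventually_elim
      case (elim m)
      let ?d = "\<lambda>x. h n x - h m x"
      have d0: "?d x = 0" if "norm x \<ge> R + 1" for x using h0 that by simp
      have dc: "continuous_on UNIV ?d" by (intro continuous_intros hc)
      have "L2sq ?d \<le> 2 * a n + 2 * a m"
        using L2sq_add_le[OF square_integrable_diff[OF hs g] square_integrable_diff[OF g hs], of n m]
        by (simp add: a_def L2sq_minus_commute[of g])
      then have "?c * L2sq ?d \<le> ?c * (2 * a n + inverse (Suc n))"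
        using elim c by (intro mult_left_mono) auto
      then show ?case
        using square_integrable_nn_integral[OF parseval_continuous(1)[OF dc d0]]
          parseval_continuous(2)[OF dc d0]
        by (simp add: osc_int_diff[OF ih ih] ennreal_leI)
    qed
    show "AE x in lebesgue. (\<lambda>m. osc_int (h n) x - osc_int (h m) x) \<longlonglongrightarrow> osc_int (h n) x - osc_int g x"
      by (intro AE_I2 tendsto_intros pw)
  qed (intro borel_measurable_diff osc_int_measurable ih ig)+
  note Es = P(1)
  have ds: "square_integrable (\<lambda>x. osc_int (h n) x - osc_int g x)" for n
    by (rule square_integrableI_nn_integral)
      (use le_less_trans[OF bd[of n]] in \<open>auto intro!: borel_measurable_diff osc_int_measurable ih ig\<close>)
  show s: "square_integrable (osc_int g)"
    using square_integrable_diff[OF Es[of 0] ds[of 0]] by simp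
  have "(\<lambda>n. L2sq (\<lambda>x. osc_int (h n) x - osc_int g x)) \<longlonglongrightarrow> 0"
  proof (rule tendsto_sandwich[OF _ _ tendsto_const])
    show "\<forall>\<^sub>F n in sequentially. L2sq (\<lambda>x. osc_int (h n) x - osc_int g x) \<le> ?c * (2 * a n + inverse (Suc n))"
    proof (intro always_eventually allI)
      fix n
      have "0 \<le> ?c * (2 * a n + inverse (Suc n))" using c by (simp add: a_def L2sq_nonneg)
      then show "L2sq (\<lambda>x. osc_int (h n) x - osc_int g x) \<le> ?c * (2 * a n + inverse (Suc n))"
        using bd[of n] by (simp only: square_integrable_nn_integral[OF ds] ennreal_le_iff)
    qed
    have "(\<lambda>n. ?c * (2 * a n + inverse (Suc n))) \<longlonglongrightarrow> ?c * (2 * 0 + 0)"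
      by (intro tendsto_intros a0 LIMSEQ_inverse_real_of_nat)
    then show "(\<lambda>n. ?c * (2 * a n + inverse (Suc n))) \<longlonglongrightarrow> 0" by simp
  qed (auto intro!: always_eventually L2sq_nonneg)
  from L2sq_tendsto[OF Es s this] have "(\<lambda>n. ?c * L2sq (h n)) \<longlonglongrightarrow> L2sq (osc_int g)"
    by (simp only: P(2))
  moreover have "(\<lambda>n. ?c * L2sq (h n)) \<longlonglongrightarrow> ?c * L2sq g"
    by (intro tendsto_intros L2sq_tendsto[OF hs g] a0[unfolded a_def])
  ultimately show "L2sq (osc_int g) = ?c * L2sq g" by (rule LIMSEQ_unique)
qed

section \<open>Completeness and the Fourier transform on \<open>L\<^sup>2\<close>\<close>

text \<open>The series of \<open>w k x / q' ^ k\<close> has finite integral because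
  \<open>q / q' < 1\<close>, so its sum is finite almost everywhere, and that sum serves as the
  constant \<open>B\<close> at \<open>x\<close>. The strict loss from \<open>q\<close> to
  \<open>q'\<close> is the price of a pointwise bound.\<close>

lemma AE_geometric_decay:
  fixes w :: "nat \<Rightarrow> 'a \<Rightarrow> ennreal"
  assumes m [measurable]: "\<And>k. w k \<in> borel_measurable M"
    and int: "\<And>k. (\<integral>\<^sup>+x. w k x \<partial>M) \<le> ennreal (C * q ^ k)"
    and q: "0 < q" "q < q'" and C: "0 \<le> C"
  shows "AE x in M. \<exists>B::real. B \<ge> 0 \<and> (\<forall>k. w k x \<le> ennreal (B * q' ^ k))"
proof -
  let ?v = "\<lambda>k x. ennreal (1 / q' ^ k) * w k x"
  have q': "q' > 0" using q by simp
  have "(\<integral>\<^sup>+x. (\<Sum>k. ?v k x) \<partial>M) = (\<Sum>k. \<integral>\<^sup>+x. ?v k x \<partial>M)"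
    by (rule nn_integral_suminf) simp
  also have "\<dots> \<le> (\<Sum>k. ennreal (C * (q / q') ^ k))"
  proof (intro suminf_le summableI)
    fix k
    have "(\<integral>\<^sup>+x. ?v k x \<partial>M) = ennreal (1 / q' ^ k) * (\<integral>\<^sup>+x. w k x \<partial>M)"
      by (rule nn_integral_cmult) simp
    also have "\<dots> \<le> ennreal (1 / q' ^ k) * ennreal (C * q ^ k)"
      by (intro mult_left_mono int) simp
    also have "\<dots> = ennreal (C * (q / q') ^ k)"
      using q q' C by (subst ennreal_mult[symmetric]) (auto simp: power_divide)
    finally show "(\<integral>\<^sup>+x. ?v k x \<partial>M) \<le> ennreal (C * (q / q') ^ k)" .
  qed
  also have "\<dots> < \<infinity>"
  proof -
    have "summable (\<lambda>k. C * (q / q') ^ k)"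
      using q q' by (intro summable_mult summable_geometric) simp
    then show ?thesis using q q' C
      by (subst suminf_ennreal2) (auto simp: less_top)
  qed
  finally have "AE x in M. (\<Sum>k. ?v k x) \<noteq> \<infinity>"
    by (intro nn_integral_PInf_AE) auto
  then show ?thesis
  proof eventually_elim
    case (elim x)
    define B where "B = enn2real (\<Sum>k. ?v k x)"
    have B: "ennreal B = (\<Sum>k. ?v k x)" using elim by (simp add: B_def less_top)
    have "w k x \<le> ennreal (B * q' ^ k)" for k
    proof -
      have "?v k x = (\<Sum>i\<in>{k}. ?v i x)" by simp
      also have "\<dots> \<le> (\<Sum>k. ?v k x)" by (rule sum_le_suminf) (auto intro: summableI)
      finally have "ennreal (q' ^ k) * ?v k x \<le> ennreal (q' ^ k) * ennreal B"
        unfolding B by (rule mult_left_mono) simp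
      also have "ennreal (q' ^ k) * ?v k x = w k x"
        using q' by (simp add: mult.assoc[symmetric] ennreal_mult[symmetric])
      finally show ?thesis using q' by (simp add: ennreal_mult[symmetric] B_def mult_ac)
    qed
    then show ?case by (intro exI[of _ B]) (simp add: B_def)
  qed
qed

lemma convergent_geometric_increments:
  fixes a :: "nat \<Rightarrow> complex"
  assumes "\<And>k. cmod (a (Suc k) - a k) \<le> B * q ^ k" "0 \<le> q" "q < 1"
  shows "convergent a"
proof -
  have "summable (\<lambda>k. a (Suc k) - a k)"
    by (rule summable_comparison_test'[where g="\<lambda>k. B * q ^ k" and N=0])
      (use assms in \<open>auto intro!: summable_mult summable_geometric\<close>)
  then have "convergent (\<lambda>n. \<Sum>k<n. a (Suc k) - a k)" by (simp add: summable_iff_convergent)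
  then have "convergent (\<lambda>n. (a n - a 0) + a 0)"
    by (intro convergent_add convergent_const) (simp only: sum_lessThan_telescope)
  then show ?thesis by simp
qed

text \<open>The Riesz-Fischer argument for a family indexed by a real radius: a rapidly Cauchy
  subsequence converges almost everywhere, and Fatou controls the distance of the whole family to
  that limit.\<close>

lemma L2_complete:
  fixes F :: "real \<Rightarrow> 'a::euclidean_space \<Rightarrow> complex"
  assumes F: "\<And>R. square_integrable (F R)"
    and cauchy: "\<And>e. e > 0 \<Longrightarrow> \<exists>N. \<forall>R\<ge>N. \<forall>S\<ge>N. L2sq (\<lambda>x. F R x - F S x) \<le> e"
  shows "\<exists>g. square_integrable g \<and> ((\<lambda>R. L2sq (\<lambda>x. F R x - g x)) \<longlongrightarrow> 0) at_top"
proof -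
  \<comment> \<open>Squared distances of order \<open>(1/8) ^ k\<close> give pointwise squares of
    order \<open>(1/4) ^ k\<close>, hence increments of order \<open>(1/2) ^ k\<close>.\<close>
  have "\<forall>k. \<exists>N. \<forall>R\<ge>N. \<forall>S\<ge>N. L2sq (\<lambda>x. F R x - F S x) \<le> (1/8) ^ k"
    using cauchy by simp
  then obtain N where N: "\<And>k R S. R \<ge> N k \<Longrightarrow> S \<ge> N k \<Longrightarrow> L2sq (\<lambda>x. F R x - F S x) \<le> (1/8) ^ k"
    by metis
  \<comment> \<open>Summing absolute values gives \<open>r j \<ge> N k\<close> for all
    \<open>j \<ge> k\<close> without any monotonicity of \<open>N\<close>; the term
    \<open>real k\<close> sends \<open>r\<close> to infinity.\<close>
  define r where "r k = real k + (\<Sum>j\<le>k. \<bar>N j\<bar>)" for k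
  have rN: "r j \<ge> N k" if "j \<ge> k" for j k
  proof -
    have "N k \<le> \<bar>N k\<bar>" by simp
    also have "\<dots> \<le> (\<Sum>i\<le>j. \<bar>N i\<bar>)" using that by (intro member_le_sum) auto
    finally show ?thesis by (simp add: r_def)
  qed
  have r_ge: "r k \<ge> real k" for k unfolding r_def by (simp add: sum_nonneg)
  note Fm = square_integrableD(1)[OF F]
  note [measurable] = Fm
  define g where "g x = lim (\<lambda>k. F (r k) x)" for x
  have gm: "g \<in> borel_measurable lebesgue" unfolding g_def by (rule borel_measurable_lim_metric) (rule Fm)
  have "AE x in lebesgue. \<exists>B::real. B \<ge> 0 \<and> (\<forall>k. ennreal ((cmod (F (r (Suc k)) x - F (r k) x))\<^sup>2) \<le> ennreal (B * (1/4) ^ k))"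
  proof (rule AE_geometric_decay)
    show "(\<integral>\<^sup>+x. ennreal ((cmod (F (r (Suc k)) x - F (r k) x))\<^sup>2) \<partial>lebesgue) \<le> ennreal (1 * (1/8) ^ k)" for k
      using N[OF rN rN, of k "Suc k" k]
      by (simp add: square_integrable_nn_integral[OF square_integrable_diff[OF F F]] ennreal_leI)
  qed auto
  then have lim: "AE x in lebesgue. (\<lambda>k. F (r k) x) \<longlonglongrightarrow> g x"
  proof eventually_elim
    case (elim x)
    then obtain B where B: "B \<ge> 0"
      "\<And>k. ennreal ((cmod (F (r (Suc k)) x - F (r k) x))\<^sup>2) \<le> ennreal (B * (1/4) ^ k)" by blast
    have "cmod (F (r (Suc k)) x - F (r k) x) \<le> sqrt B * (1/2) ^ k" for k
    proof -
      have "(cmod (F (r (Suc k)) x - F (r k) x))\<^sup>2 \<le> B * (1/4) ^ k"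
        using B(2)[of k] B(1) by (simp add: ennreal_le_iff)
      also have "\<dots> = (sqrt B * (1/2) ^ k)\<^sup>2"
        using B(1) by (simp add: power_mult_distrib power_divide flip: power_mult) (simp add: power_mult mult.commute[of k])
      finally show ?thesis by (rule power2_le_imp_le) (use B(1) in simp)
    qed
    then have "convergent (\<lambda>k. F (r k) x)" by (rule convergent_geometric_increments) auto
    then show ?case unfolding g_def by (simp add: convergent_LIMSEQ_iff)
  qed
  have bd: "(\<integral>\<^sup>+x. ennreal ((cmod (F S x - g x))\<^sup>2) \<partial>lebesgue) \<le> ennreal e"
    if "\<forall>R\<ge>N'. \<forall>S\<ge>N'. L2sq (\<lambda>x. F R x - F S x) \<le> e" "S \<ge> N'" for S e N'
  proof (rule L2_fatou)
    show "AE x in lebesgue. (\<lambda>k. F S x - F (r k) x) \<longlonglongrightarrow> F S x - g x"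
      using lim by eventually_elim (intro tendsto_intros)
    have "eventually (\<lambda>k. real k \<ge> N') sequentially"
      using filterlim_real_sequentially by (simp add: filterlim_at_top)
    then show "\<forall>\<^sub>F k in sequentially. (\<integral>\<^sup>+x. ennreal ((cmod (F S x - F (r k) x))\<^sup>2) \<partial>lebesgue) \<le> ennreal e"
    proof eventually_elim
      case (elim k)
      then have "r k \<ge> N'" using r_ge[of k] by simp
      then show ?case using that
        by (simp add: square_integrable_nn_integral[OF square_integrable_diff[OF F F]] ennreal_leI)
    qed
  qed (intro borel_measurable_diff Fm gm)+
  obtain N1 where N1: "\<forall>R\<ge>N1. \<forall>S\<ge>N1. L2sq (\<lambda>x. F R x - F S x) \<le> 1" using cauchy[of 1] by auto
  have "square_integrable (\<lambda>x. F N1 x - g x)"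
    by (rule square_integrableI_nn_integral)
      (use le_less_trans[OF bd[OF N1, of N1]] gm in \<open>auto intro!: borel_measurable_diff Fm\<close>)
  then have g: "square_integrable g" using square_integrable_diff[OF F[of N1]] by force
  have "((\<lambda>R. L2sq (\<lambda>x. F R x - g x)) \<longlongrightarrow> 0) at_top"
  proof (rule tendstoI)
    fix e :: real assume "e > 0"
    then obtain N' where N': "\<forall>R\<ge>N'. \<forall>S\<ge>N'. L2sq (\<lambda>x. F R x - F S x) \<le> e / 2" using cauchy[of "e / 2"] by auto
    have "L2sq (\<lambda>x. F S x - g x) < e" if "S \<ge> N'" for S
    proof -
      have "L2sq (\<lambda>x. F S x - g x) \<le> e / 2"
        using bd[OF N' that] \<open>e > 0\<close>
        by (simp add: square_integrable_nn_integral[OF square_integrable_diff[OF F g]] ennreal_le_iff)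
      then show ?thesis using \<open>e > 0\<close> by simp
    qed
    then show "\<forall>\<^sub>F R in at_top. dist (L2sq (\<lambda>x. F R x - g x)) 0 < e"
      by (auto simp: eventually_at_top_linorder L2sq_nonneg intro!: exI[of _ N'])
  qed
  with g show ?thesis by blast
qed

section \<open>Plancherel and Fourier inversion through truncated transforms\<close>

definition trunc :: "real \<Rightarrow> ('a::euclidean_space \<Rightarrow> complex) \<Rightarrow> 'a \<Rightarrow> complex" where
  "trunc R f x = indicator (ball 0 R) x * f x"

lemma trunc_eq_0: "norm x \<ge> R \<Longrightarrow> trunc R f x = 0"
  by (simp add: trunc_def)

lemma square_integrable_trunc: "square_integrable f \<Longrightarrow> square_integrable (trunc R f)"
  unfolding trunc_def[abs_def] by (rule square_integrable_indicator) simp_all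

lemma integrable_trunc: "square_integrable f \<Longrightarrow> integrable lebesgue (trunc R f)"
  by (rule square_integrable_imp_integrable[OF square_integrable_trunc trunc_eq_0])

lemma trunc_tendsto:
  assumes "square_integrable f"
  shows "((\<lambda>R. L2sq (\<lambda>x. trunc R f x - f x)) \<longlongrightarrow> 0) at_top"
proof -
  have "((\<lambda>R. LINT x|lebesgue. (cmod (trunc R f x - f x))\<^sup>2) \<longlongrightarrow> (LINT x|(lebesgue :: 'a measure). 0)) at_top"
  proof (rule integral_dominated_convergence_at_top)
    note [measurable] = square_integrableD(1)[OF assms] square_integrableD(1)[OF square_integrable_trunc[OF assms]]
    show "(\<lambda>x. (cmod (trunc R f x - f x))\<^sup>2) \<in> borel_measurable lebesgue" for R by measurable
    show "integrable lebesgue (\<lambda>x. (cmod (f x))\<^sup>2)" using square_integrableD[OF assms] by simp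
    show "AE x in lebesgue. ((\<lambda>R. (cmod (trunc R f x - f x))\<^sup>2) \<longlongrightarrow> 0) at_top"
    proof (intro AE_I2 tendsto_eventually)
      fix x
      show "\<forall>\<^sub>F R in at_top. (cmod (trunc R f x - f x))\<^sup>2 = 0"
        using eventually_gt_at_top[of "norm x"] by eventually_elim (simp add: trunc_def)
    qed
    show "\<forall>\<^sub>F R in at_top. AE x in lebesgue. norm ((cmod (trunc R f x - f x))\<^sup>2) \<le> (cmod (f x))\<^sup>2"
      by (intro always_eventually allI AE_I2) (auto simp: trunc_def indicator_def)
  qed simp
  then show ?thesis by (simp add: L2sq_def)
qed

lemma L2sq_trunc_tendsto:
  assumes "square_integrable f"
  shows "((\<lambda>R. L2sq (trunc R f)) \<longlongrightarrow> L2sq f) at_top"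
  by (rule L2sq_tendsto[OF square_integrable_trunc assms trunc_tendsto]) (rule assms)+

lemma inner_trunc_self:
  "(LINT x|lebesgue. trunc R f x * cnj (f x)) = of_real (L2sq (trunc R f))"
  "(LINT x|lebesgue. f x * cnj (trunc R f x)) = of_real (L2sq (trunc R f))"
  unfolding inner_self_L2sq[symmetric]
  by (intro Bochner_Integration.integral_cong; auto simp: trunc_def indicator_def)+

text \<open>Literally the family under the choice operator of \<open>fourier\<close>, so the two
  match by unfolding.\<close>

definition ft_trunc :: "real \<Rightarrow> ('a::euclidean_space \<Rightarrow> complex) \<Rightarrow> 'a \<Rightarrow> complex" where
  "ft_trunc R f \<xi> = (1 / (2 * pi) ^ DIM('a)) *\<^sub>R (LINT x:ball 0 R|lebesgue. cis (- (x \<bullet> \<xi>)) * f x)"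

text \<open>The forward transform is the conjugate of the inverse transform of the conjugate, up to
  the constant; everything proved for \<open>osc_int\<close> thereby carries over.\<close>

lemma ft_trunc_eq:
  fixes f :: "'a::euclidean_space \<Rightarrow> complex"
  shows "ft_trunc R f \<xi> = of_real (1 / (2 * pi) ^ DIM('a)) * cnj (osc_int (\<lambda>x. cnj (trunc R f x)) \<xi>)"
proof -
  have "(LINT x:ball 0 R|lebesgue. cis (- (x \<bullet> \<xi>)) * f x)
      = (LINT x|lebesgue. cnj (cis (\<xi> \<bullet> x) * cnj (trunc R f x)))"
    unfolding set_lebesgue_integral_def
    by (intro Bochner_Integration.integral_cong) (auto simp: trunc_def indicator_def cis_cnj inner_commute)
  also have "\<dots> = cnj (osc_int (\<lambda>x. cnj (trunc R f x)) \<xi>)"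
    unfolding osc_int_def by (rule Bochner_Integration.integral_cnj)
  finally show ?thesis by (simp add: ft_trunc_def scaleR_conv_of_real)
qed

lemma square_integrable_ft_trunc:
  fixes f :: "'a::euclidean_space \<Rightarrow> complex"
  assumes "square_integrable f"
  shows "square_integrable (ft_trunc R f)"
  unfolding ft_trunc_eq
  by (intro square_integrable_cmult square_integrable_cnj square_integrable_osc_int[where R=R]
      square_integrable_trunc assms) (simp add: trunc_eq_0)

lemma L2sq_ft_trunc_diff:
  fixes f :: "'a::euclidean_space \<Rightarrow> complex"
  assumes "square_integrable f"
  shows "L2sq (\<lambda>\<xi>. ft_trunc R f \<xi> - ft_trunc S f \<xi>)
    = L2sq (\<lambda>x. trunc R f x - trunc S f x) / (2 * pi) ^ DIM('a)"
proof -
  let ?c = "(2 * pi) ^ DIM('a)"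
  let ?d = "\<lambda>x. cnj (trunc R f x) - cnj (trunc S f x)"
  note t = square_integrable_cnj[OF square_integrable_trunc[OF assms]]
  have i: "integrable lebesgue (\<lambda>x. cnj (trunc R f x))" for R
    by (rule square_integrable_imp_integrable[OF t, of R]) (simp add: trunc_eq_0)
  have d0: "?d x = 0" if "norm x \<ge> max R S" for x using that by (simp add: trunc_eq_0)
  have eq: "(\<lambda>\<xi>. ft_trunc R f \<xi> - ft_trunc S f \<xi>) = (\<lambda>\<xi>. of_real (1 / ?c) * cnj (osc_int ?d \<xi>))"
    unfolding osc_int_diff[OF i i] ft_trunc_eq by (simp add: algebra_simps)
  have p: "L2sq (osc_int ?d) = ?c * L2sq ?d"
    by (rule parseval[OF square_integrable_diff[OF t t]]) (rule d0)
  have "L2sq (\<lambda>\<xi>. ft_trunc R f \<xi> - ft_trunc S f \<xi>) = (1 / ?c)\<^sup>2 * (?c * L2sq ?d)"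
    unfolding eq L2sq_cmult L2sq_cnj p norm_of_real power2_abs ..
  also have "L2sq ?d = L2sq (\<lambda>x. trunc R f x - trunc S f x)"
    by (subst L2sq_cnj[symmetric]) simp
  finally show ?thesis by (simp add: power2_eq_square)
qed

lemma L2sq_ft_trunc:
  fixes f :: "'a::euclidean_space \<Rightarrow> complex"
  assumes "square_integrable f"
  shows "L2sq (ft_trunc R f) = L2sq (trunc R f) / (2 * pi) ^ DIM('a)"
  using L2sq_ft_trunc_diff[OF assms, of R 0]
  by (simp add: trunc_def[of 0] ft_trunc_def[of 0] set_lebesgue_integral_def)

text \<open>A conjugated form of \<open>multiplication_formula\<close>. Bounded support of
  \<open>g\<close> makes \<open>g\<close> integrable, so that \<open>osc_int g\<close> is an honest
  integral.\<close>

lemma ft_trunc_inner: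
  fixes f g :: "'a::euclidean_space \<Rightarrow> complex"
  assumes f: "square_integrable f" and g: "square_integrable g" and R: "\<And>x. norm x \<ge> R' \<Longrightarrow> g x = 0"
  shows "(LINT \<xi>|lebesgue. ft_trunc R f \<xi> * cnj (g \<xi>))
    = of_real (1 / (2 * pi) ^ DIM('a)) * (LINT x|lebesgue. trunc R f x * cnj (osc_int g x))"
proof -
  let ?k = "of_real (1 / (2 * pi) ^ DIM('a)) :: complex"
  have i: "integrable lebesgue (\<lambda>x. cnj (trunc R f x))"
    by (rule square_integrable_imp_integrable[OF square_integrable_cnj[OF square_integrable_trunc[OF f]], of R])
      (simp add: trunc_eq_0)
  have "(LINT \<xi>|lebesgue. ft_trunc R f \<xi> * cnj (g \<xi>))
      = (LINT \<xi>|lebesgue. ?k * cnj (osc_int (\<lambda>x. cnj (trunc R f x)) \<xi> * g \<xi>))"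
    unfolding ft_trunc_eq by (simp add: mult.assoc)
  also have "\<dots> = ?k * cnj (LINT \<xi>|lebesgue. osc_int (\<lambda>x. cnj (trunc R f x)) \<xi> * g \<xi>)"
    by (simp only: integral_mult_right_zero Bochner_Integration.integral_cnj)
  also have "(LINT \<xi>|lebesgue. osc_int (\<lambda>x. cnj (trunc R f x)) \<xi> * g \<xi>)
      = (LINT x|lebesgue. cnj (trunc R f x) * osc_int g x)"
    by (rule multiplication_formula[OF i square_integrable_imp_integrable[OF g R]])
  also have "cnj \<dots> = (LINT x|lebesgue. trunc R f x * cnj (osc_int g x))"
    by (simp flip: Bochner_Integration.integral_cnj)
  finally show ?thesis .
qed

text \<open>Parseval turns the L^2 convergence of truncations of \<open>f\<close> into a Cauchy
  estimate for their transforms. Completeness then supplies a limit, and so the choice in the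
  definition of \<open>fourier\<close> returns one.\<close>

lemma
  fixes f :: "'a::euclidean_space \<Rightarrow> complex"
  assumes f: "square_integrable f"
  shows square_integrable_fourier: "square_integrable (fourier f)"
    and ft_trunc_tendsto_fourier: "((\<lambda>R. L2sq (\<lambda>\<xi>. ft_trunc R f \<xi> - fourier f \<xi>)) \<longlongrightarrow> 0) at_top"
proof -
  let ?c = "(2 * pi) ^ DIM('a)"
  note t = square_integrable_trunc[OF f]
  have "\<exists>g. square_integrable g \<and> ((\<lambda>R. L2sq (\<lambda>\<xi>. ft_trunc R f \<xi> - g \<xi>)) \<longlongrightarrow> 0) at_top"
  proof (rule L2_complete[OF square_integrable_ft_trunc[OF f]])
    fix e :: real assume "e > 0"
    then have "eventually (\<lambda>R. L2sq (\<lambda>x. trunc R f x - f x) < e * ?c / 4) at_top"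
      by (intro order_tendstoD(2)[OF trunc_tendsto[OF f]]) simp
    then obtain N where N: "\<And>R. R \<ge> N \<Longrightarrow> L2sq (\<lambda>x. trunc R f x - f x) < e * ?c / 4"
      by (auto simp: eventually_at_top_linorder)
    have "L2sq (\<lambda>\<xi>. ft_trunc R f \<xi> - ft_trunc S f \<xi>) \<le> e" if "R \<ge> N" "S \<ge> N" for R S
    proof -
      have "L2sq (\<lambda>x. trunc R f x - trunc S f x)
          \<le> 2 * L2sq (\<lambda>x. trunc R f x - f x) + 2 * L2sq (\<lambda>x. trunc S f x - f x)"
        using L2sq_add_le[OF square_integrable_diff[OF t f] square_integrable_diff[OF f t], of R S]
        by (simp add: L2sq_minus_commute[of f])
      also have "\<dots> \<le> e * ?c" using N[OF that(1)] N[OF that(2)] by simp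
      finally show ?thesis unfolding L2sq_ft_trunc_diff[OF f] by (simp add: divide_le_eq)
    qed
    then show "\<exists>N. \<forall>R\<ge>N. \<forall>S\<ge>N. L2sq (\<lambda>\<xi>. ft_trunc R f \<xi> - ft_trunc S f \<xi>) \<le> e" by blast
  qed
  then obtain g where g: "square_integrable g" "((\<lambda>R. L2sq (\<lambda>\<xi>. ft_trunc R f \<xi> - g \<xi>)) \<longlongrightarrow> 0) at_top" by blast
  have "has_L2_limit (\<lambda>R. ft_trunc R f) g"
    using g has_L2_limit_iff[where F="\<lambda>R. ft_trunc R f", OF square_integrable_ft_trunc[OF f] g(1)] by blast
  then have *: "has_L2_limit (\<lambda>R. ft_trunc R f) (fourier f)"
    unfolding fourier_def ft_trunc_def by (rule someI[of "has_L2_limit _"])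
  then show s: "square_integrable (fourier f)" by (simp add: has_L2_limit_def)
  show "((\<lambda>R. L2sq (\<lambda>\<xi>. ft_trunc R f \<xi> - fourier f \<xi>)) \<longlongrightarrow> 0) at_top"
    using * has_L2_limit_iff[where F="\<lambda>R. ft_trunc R f", OF square_integrable_ft_trunc[OF f] s] by blast
qed

text \<open>The cross term of the expanded square is twice the squared norm of the truncated
  transform. What remains is \<open>L2sq g - L2sq (trunc r ?G) / ?c\<close>, which tends to 0 by
  Parseval.\<close>

lemma fourier_osc_int:
  fixes g :: "'a::euclidean_space \<Rightarrow> complex"
  assumes g: "square_integrable g" and R: "\<And>x. norm x \<ge> R \<Longrightarrow> g x = 0"
  shows "AE \<xi> in lebesgue. fourier (osc_int g) \<xi> = g \<xi>"
proof -
  let ?c = "(2 * pi) ^ DIM('a) :: real"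
  let ?G = "osc_int g"
  have G: "square_integrable ?G" by (rule square_integrable_osc_int[OF g R])
  have P: "L2sq ?G = ?c * L2sq g" by (rule parseval[OF g R])
  have I: "(LINT \<xi>|lebesgue. ft_trunc r ?G \<xi> * cnj (g \<xi>)) = of_real (1 / ?c * L2sq (trunc r ?G))" for r
    unfolding of_real_mult inner_trunc_self[symmetric] by (rule ft_trunc_inner[OF G g R])
  note s = square_integrable_ft_trunc[OF G]
  have "L2sq (\<lambda>\<xi>. ft_trunc r ?G \<xi> - g \<xi>) = L2sq g - L2sq (trunc r ?G) / ?c" for r
    unfolding L2sq_diff[OF s g] L2sq_ft_trunc[OF G] I by simp
  moreover have "((\<lambda>r. L2sq g - L2sq (trunc r ?G) / ?c) \<longlongrightarrow> L2sq g - L2sq ?G / ?c) at_top"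
    by (intro tendsto_intros L2sq_trunc_tendsto G) simp
  ultimately have "((\<lambda>r. L2sq (\<lambda>\<xi>. ft_trunc r ?G \<xi> - g \<xi>)) \<longlongrightarrow> 0) at_top"
    by (simp add: P)
  then show ?thesis
    by (intro L2_limit_unique[OF s square_integrable_fourier[OF G] g ft_trunc_tendsto_fourier[OF G]]) auto
qed

lemma fourier_inversion:
  fixes f :: "'a::euclidean_space \<Rightarrow> complex"
  assumes f: "square_integrable f"
  shows "((\<lambda>r. L2sq (\<lambda>x. osc_int (trunc r (fourier f)) x - f x)) \<longlongrightarrow> 0) at_top"
proof -
  let ?c = "(2 * pi) ^ DIM('a) :: real"
  let ?h = "fourier f"
  note h = square_integrable_fourier[OF f] and lim = ft_trunc_tendsto_fourier[OF f]
  note ht = square_integrable_trunc[OF h]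
  have Es: "square_integrable (osc_int (trunc r ?h))" for r
    by (rule square_integrable_osc_int[OF ht trunc_eq_0])
  have P: "L2sq (osc_int (trunc r ?h)) = ?c * L2sq (trunc r ?h)" for r
    by (rule parseval[OF ht trunc_eq_0])
  have I: "(LINT \<xi>|lebesgue. ft_trunc R f \<xi> * cnj (trunc r ?h \<xi>))
      = of_real (1 / ?c) * (LINT x|lebesgue. trunc R f x * cnj (osc_int (trunc r ?h) x))" for R r
    by (rule ft_trunc_inner[OF f ht trunc_eq_0])
  \<comment> \<open>The adjointness relation concerns truncations of \<open>f\<close>; with
    \<open>r\<close> fixed, both sides pass to the limit in \<open>R\<close>.\<close>
  have inner: "(LINT x|lebesgue. f x * cnj (osc_int (trunc r ?h) x)) = of_real (?c * L2sq (trunc r ?h))" for r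
  proof -
    have "((\<lambda>R. LINT x|lebesgue. trunc R f x * cnj (osc_int (trunc r ?h) x))
        \<longlongrightarrow> (LINT x|lebesgue. f x * cnj (osc_int (trunc r ?h) x))) at_top"
      by (rule L2_inner_tendsto[OF square_integrable_trunc[OF f] f Es trunc_tendsto[OF f]])
    moreover have "(LINT x|lebesgue. trunc R f x * cnj (osc_int (trunc r ?h) x))
        = of_real ?c * (LINT \<xi>|lebesgue. ft_trunc R f \<xi> * cnj (trunc r ?h \<xi>))" for R
      unfolding I by simp
    moreover have "((\<lambda>R. of_real ?c * (LINT \<xi>|lebesgue. ft_trunc R f \<xi> * cnj (trunc r ?h \<xi>)))
        \<longlongrightarrow> of_real ?c * (LINT \<xi>|lebesgue. ?h \<xi> * cnj (trunc r ?h \<xi>))) at_top"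
      by (intro tendsto_intros L2_inner_tendsto[OF square_integrable_ft_trunc[OF f] h ht lim])
    ultimately have "(LINT x|lebesgue. f x * cnj (osc_int (trunc r ?h) x))
        = of_real ?c * (LINT \<xi>|lebesgue. ?h \<xi> * cnj (trunc r ?h \<xi>))"
      by (intro tendsto_unique[of at_top]) auto
    then show ?thesis unfolding inner_trunc_self by simp
  qed
  have "L2sq (\<lambda>x. osc_int (trunc r ?h) x - f x) = L2sq f - ?c * L2sq (trunc r ?h)" for r
    unfolding L2sq_minus_commute[of "osc_int (trunc r ?h)"] L2sq_diff[OF f Es] inner P by simp
  moreover have "((\<lambda>r. L2sq f - ?c * L2sq (trunc r ?h)) \<longlongrightarrow> L2sq f - ?c * L2sq ?h) at_top"
    by (intro tendsto_intros L2sq_trunc_tendsto h)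
  moreover have "L2sq ?h = L2sq f / ?c"
  proof (rule tendsto_unique[of at_top])
    show "((\<lambda>R. L2sq (ft_trunc R f)) \<longlongrightarrow> L2sq ?h) at_top"
      by (rule L2sq_tendsto[OF square_integrable_ft_trunc[OF f] h lim])
    show "((\<lambda>R. L2sq (ft_trunc R f)) \<longlongrightarrow> L2sq f / ?c) at_top"
      unfolding L2sq_ft_trunc[OF f] by (intro tendsto_intros L2sq_trunc_tendsto f) simp
  qed simp
  ultimately show ?thesis by simp
qed

section \<open>The evolution of band-limited data\<close>

text \<open>Said of a function on the frequency side: the band-limited function in the usual sense
  is \<open>osc_int g\<close>.\<close>

definition band_limited :: "('a::euclidean_space \<Rightarrow> complex) \<Rightarrow> bool" where
  "band_limited g \<longleftrightarrow> square_integrable g \<and> (\<exists>R. \<forall>\<xi>. norm \<xi> \<ge> R \<longrightarrow> g \<xi> = 0)"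

lemma band_limitedD:
  assumes "band_limited g"
  shows "square_integrable g" "integrable lebesgue g" "square_integrable (osc_int g)"
  using assms square_integrable_imp_integrable[of g] square_integrable_osc_int[of g]
  by (auto simp: band_limited_def)

text \<open>A continuous factor is bounded on the ball that carries \<open>g\<close>. This one fact
  covers the symbol \<open>P\<close>, the phases, the modulations and the Bessel weights.\<close>

lemma band_limited_mult:
  assumes g: "band_limited g" and \<phi>: "continuous_on UNIV \<phi>"
  shows "band_limited (\<lambda>\<xi>. \<phi> \<xi> * g \<xi>)"
proof -
  from g obtain R where R: "\<And>\<xi>. norm \<xi> \<ge> R \<Longrightarrow> g \<xi> = 0" by (auto simp: band_limited_def)
  have "bounded (\<phi> ` cball 0 R)"
    by (intro compact_imp_bounded compact_continuous_image continuous_on_subset[OF \<phi>]) auto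
  then obtain M where M: "\<forall>y\<in>\<phi> ` cball 0 R. cmod y \<le> M" "M > 0" using bounded_pos by blast
  have "square_integrable (\<lambda>\<xi>. \<phi> \<xi> * g \<xi>)"
  proof (rule square_integrable_bound[OF band_limitedD(1)[OF g]])
    show "(\<lambda>\<xi>. \<phi> \<xi> * g \<xi>) \<in> borel_measurable lebesgue"
      by (intro borel_measurable_times continuous_borel_measurable_lebesgue[OF \<phi>]
          square_integrableD(1)[OF band_limitedD(1)[OF g]])
    show "cmod (\<phi> x * g x) \<le> M * cmod (g x)" for x
      using M R[of x] by (cases "norm x \<le> R") (auto simp: norm_mult intro!: mult_right_mono)
  qed
  then show ?thesis using R by (auto simp: band_limited_def)
qed

lemma band_limited_trunc: "square_integrable f \<Longrightarrow> band_limited (trunc R f)"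
  unfolding band_limited_def using square_integrable_trunc trunc_eq_0 by blast

lemma fourier_osc_int_AE: "band_limited g \<Longrightarrow> AE \<xi> in lebesgue. fourier (osc_int g) \<xi> = g \<xi>"
  using fourier_osc_int[of g] by (auto simp: band_limited_def)

lemma square_integrable_cong_AE:
  assumes "square_integrable f" "AE x in lebesgue. f x = g x" "g \<in> borel_measurable lebesgue"
  shows "square_integrable g"
proof -
  note [measurable] = square_integrableD(1)[OF assms(1)] assms(3)
  have "integrable lebesgue (\<lambda>x. (cmod (g x))\<^sup>2)"
    by (rule iffD1[OF integrable_cong_AE square_integrableD(2)[OF assms(1)]])
      (use assms(2) in auto)
  then show ?thesis using assms(3) by (simp add: square_integrable_def)
qed

lemma L2sq_cong_AE:
  assumes "f \<in> borel_measurable lebesgue" "g \<in> borel_measurable lebesgue" "AE x in lebesgue. f x = g x"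
  shows "L2sq f = L2sq g"
  unfolding L2sq_def by (rule integral_cong_AE) (use assms in auto)

section \<open>Bessel weights and Sobolev norms of band-limited data\<close>

lemma continuous_on_bessel_factor: "continuous_on UNIV (\<lambda>\<xi>. complex_of_real ((1 + (norm \<xi>)\<^sup>2) powr (s / 2)))"
proof -
  have "1 + (norm \<xi>)\<^sup>2 \<noteq> 0" for \<xi> :: 'a
    using zero_le_power2[of "norm \<xi>"] by linarith
  then show ?thesis by (intro continuous_intros) auto
qed

lemma bessel_weight_eq: "bessel_weight s g = (\<lambda>\<xi>. complex_of_real ((1 + (norm \<xi>)\<^sup>2) powr (s / 2)) * g \<xi>)"
  by (simp add: bessel_weight_def scaleR_conv_of_real fun_eq_iff)

lemma band_limited_bessel_weight: "band_limited g \<Longrightarrow> band_limited (bessel_weight s g)"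
  unfolding bessel_weight_eq by (rule band_limited_mult[OF _ continuous_on_bessel_factor])

lemma bessel_weight_measurable:
  "g \<in> borel_measurable lebesgue \<Longrightarrow> bessel_weight s g \<in> borel_measurable lebesgue"
  unfolding bessel_weight_eq
  by (intro borel_measurable_times continuous_borel_measurable_lebesgue[OF continuous_on_bessel_factor])

text \<open>Lets the maximal hypothesis be stated with \<open>g\<close> itself; the chosen
  representative \<open>fourier (osc_int g)\<close> agrees with \<open>g\<close> only almost
  everywhere.\<close>

lemma
  assumes g: "band_limited g"
  shows osc_int_in_sobolev: "osc_int g \<in> sobolev s"
    and sobolev_norm_osc_int: "sobolev_norm s (osc_int g) = sqrt (L2sq (bessel_weight s g))"
proof -
  have F: "square_integrable (fourier (osc_int g))"
    by (rule square_integrable_fourier[OF band_limitedD(3)[OF g]])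
  have m: "bessel_weight s (fourier (osc_int g)) \<in> borel_measurable lebesgue"
    by (rule bessel_weight_measurable[OF square_integrableD(1)[OF F]])
  note b = band_limitedD(1)[OF band_limited_bessel_weight[OF g, of s]]
  have ae: "AE \<xi> in lebesgue. bessel_weight s g \<xi> = bessel_weight s (fourier (osc_int g)) \<xi>"
    using fourier_osc_int_AE[OF g] by eventually_elim (simp add: bessel_weight_def)
  show "osc_int g \<in> sobolev s"
    unfolding sobolev_def using square_integrable_cong_AE[OF b ae m] band_limitedD(3)[OF g] by simp
  show "sobolev_norm s (osc_int g) = sqrt (L2sq (bessel_weight s g))"
    using L2sq_cong_AE[OF square_integrableD(1)[OF b] m ae]
    by (simp add: sobolev_norm_def L2sq_def)
qed

section \<open>The evolution as a multiplier and its time derivative\<close>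

definition evolve :: "('a::euclidean_space \<Rightarrow> real) \<Rightarrow> real \<Rightarrow> ('a \<Rightarrow> complex) \<Rightarrow> 'a \<Rightarrow> complex" where
  "evolve P t g = (\<lambda>\<xi>. cis (t * P \<xi>) * g \<xi>)"

lemma evolve_0 [simp]: "evolve P 0 g = g"
  by (simp add: evolve_def)

lemma trunc_evolve: "trunc R (evolve P t g) = evolve P t (trunc R g)"
  by (simp add: trunc_def evolve_def fun_eq_iff)

lemma cmod_evolve: "cmod (evolve P t g \<xi>) = cmod (g \<xi>)"
  by (simp add: evolve_def norm_mult)

lemma evolve_measurable:
  assumes "continuous_on UNIV P" "g \<in> borel_measurable lebesgue"
  shows "evolve P t g \<in> borel_measurable lebesgue"
  unfolding evolve_def
  by (intro borel_measurable_times continuous_borel_measurable_lebesgue continuous_intros assms)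

lemma square_integrable_evolve:
  assumes "continuous_on UNIV P" "square_integrable g"
  shows "square_integrable (evolve P t g)"
  by (rule square_integrable_bound[OF assms(2) evolve_measurable[OF assms(1) square_integrableD(1)[OF assms(2)]], where C=1])
    (simp add: cmod_evolve)

lemma band_limited_evolve:
  assumes "continuous_on UNIV P" "band_limited g"
  shows "band_limited (evolve P t g)"
  unfolding evolve_def by (intro band_limited_mult assms continuous_intros)

lemma integrable_evolve:
  assumes "continuous_on UNIV P" "integrable lebesgue g"
  shows "integrable lebesgue (evolve P t g)"
  by (rule Bochner_Integration.integrable_bound[OF assms(2)])
    (use evolve_measurable[OF assms(1)] assms(2) in \<open>auto simp: cmod_evolve\<close>)

lemma is_evolution_iff:
  "is_evolution P t f h \<longleftrightarrow> has_L2_limit (\<lambda>R. osc_int (trunc R (evolve P t (fourier f)))) h"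
proof -
  have "(\<lambda>R x. LINT \<xi>:ball 0 R|lebesgue. cis (x \<bullet> \<xi> + t * P \<xi>) * fourier f \<xi>)
      = (\<lambda>R. osc_int (trunc R (evolve P t (fourier f))))"
    unfolding set_lebesgue_integral_def osc_int_def
    by (intro ext Bochner_Integration.integral_cong)
      (auto simp: trunc_def evolve_def indicator_def cis_mult)
  then show ?thesis by (simp add: is_evolution_def)
qed

lemma osc_int_cong_AE:
  assumes "f \<in> borel_measurable lebesgue" "g \<in> borel_measurable lebesgue" "AE x in lebesgue. f x = g x"
  shows "osc_int f = osc_int g"
  unfolding osc_int_def
  by (intro ext integral_cong_AE borel_measurable_times character_measurable_lebesgue)
    (use assms in \<open>auto elim: eventually_mono\<close>)

lemma continuous_on_evolve_time:
  assumes P: "continuous_on UNIV P" and g: "integrable lebesgue g"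
  shows "continuous_on A (\<lambda>t. osc_int (evolve P t g) x)"
proof (rule continuous_on_sequentiallyI)
  fix u :: "nat \<Rightarrow> real" and a assume u: "u \<longlonglongrightarrow> a"
  show "(\<lambda>n. osc_int (evolve P (u n) g) x) \<longlonglongrightarrow> osc_int (evolve P a g) x"
    unfolding osc_int_def
  proof (rule integral_dominated_convergence[where w="\<lambda>\<xi>. norm (g \<xi>)"])
    show "AE \<xi> in lebesgue. (\<lambda>n. cis (x \<bullet> \<xi>) * evolve P (u n) g \<xi>) \<longlonglongrightarrow> cis (x \<bullet> \<xi>) * evolve P a g \<xi>"
      unfolding evolve_def by (intro AE_I2 tendsto_intros u)
  qed (use g integrable_evolve[OF P g] in
      \<open>auto intro!: borel_measurable_integrable[OF integrable_character_mult] simp: norm_mult cmod_evolve\<close>)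
qed

lemma has_vector_derivative_at_iff_tendsto_quotient:
  fixes f :: "real \<Rightarrow> 'b::real_normed_vector"
  shows "(f has_vector_derivative D) (at t) \<longleftrightarrow> ((\<lambda>s. (f s - f t) /\<^sub>R (s - t)) \<longlongrightarrow> D) (at t)"
proof -
  have eq: "norm ((f s - f t) - (s - t) *\<^sub>R D) / norm (s - t) = norm ((f s - f t) /\<^sub>R (s - t) - D)"
    if "s \<noteq> t" for s
  proof -
    have "(f s - f t) /\<^sub>R (s - t) - D = inverse (s - t) *\<^sub>R ((f s - f t) - (s - t) *\<^sub>R D)"
      using that by (simp add: scaleR_diff_right)
    then show ?thesis by (simp add: divide_inverse mult.commute)
  qed
  have "(f has_vector_derivative D) (at t)
      \<longleftrightarrow> ((\<lambda>s. norm ((f s - f t) - (s - t) *\<^sub>R D) / norm (s - t)) \<longlongrightarrow> 0) (at t)"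
    by (simp add: has_vector_derivative_def has_derivative_iff_norm bounded_linear_scaleR_left)
  also have "\<dots> \<longleftrightarrow> ((\<lambda>s. norm ((f s - f t) /\<^sub>R (s - t) - D)) \<longlongrightarrow> 0) (at t)"
    by (intro filterlim_cong refl) (auto simp: eventually_at_filter eq[simplified] intro!: always_eventually)
  finally show ?thesis by (simp add: tendsto_norm_zero_iff Lim_null[symmetric])
qed

text \<open>Differentiation under the integral: the difference quotients of
  \<open>cis (s * P \<xi>)\<close> are bounded by the modulus of \<open>P \<xi>\<close>, so the
  integrable function \<open>P \<xi> * g \<xi>\<close> dominates.\<close>

lemma has_vector_derivative_evolve:
  fixes g :: "'a::euclidean_space \<Rightarrow> complex"
  assumes P: "continuous_on UNIV P" and g: "integrable lebesgue g"
    and Pg: "integrable lebesgue (\<lambda>\<xi>. P \<xi> * g \<xi>)"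
  shows "((\<lambda>t. osc_int (evolve P t g) x) has_vector_derivative
    \<i> * osc_int (evolve P t (\<lambda>\<xi>. P \<xi> * g \<xi>)) x) (at t)"
proof -
  let ?D = "\<lambda>s \<xi>. (cis (s * P \<xi>) - cis (t * P \<xi>)) /\<^sub>R (s - t)"
  let ?Pg = "\<lambda>\<xi>. complex_of_real (P \<xi>) * g \<xi>"
  have deriv: "((\<lambda>s. cis (s * P \<xi>)) has_vector_derivative P \<xi> *\<^sub>R (\<i> * cis (t * P \<xi>))) (at t)" for \<xi> t
  proof -
    have "((\<lambda>s. s * P \<xi>) has_vector_derivative P \<xi>) (at t)"
      by (auto intro!: derivative_eq_intros simp: has_vector_derivative_def)
    from vector_diff_chain_at[OF this has_vector_derivative_iexp] show ?thesis
      by (simp add: o_def cis_conv_exp)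
  qed
  have lip: "cmod (cis (s * P \<xi>) - cis (t * P \<xi>)) \<le> \<bar>P \<xi>\<bar> * \<bar>s - t\<bar>" for s \<xi>
  proof -
    have "norm (cis (s * P \<xi>) - cis (t * P \<xi>)) \<le> \<bar>P \<xi>\<bar> * norm (s - t)"
    proof (rule differentiable_bound[where S=UNIV and f="\<lambda>s. cis (s * P \<xi>)"])
      show "((\<lambda>s. cis (s * P \<xi>)) has_derivative (\<lambda>h. h *\<^sub>R (P \<xi> *\<^sub>R (\<i> * cis (r * P \<xi>))))) (at r within UNIV)" for r
        using deriv by (simp add: has_vector_derivative_def)
      show "onorm (\<lambda>h. h *\<^sub>R (P \<xi> *\<^sub>R (\<i> * cis (r * P \<xi>)))) \<le> \<bar>P \<xi>\<bar>" for r
        by (rule onorm_le) (simp add: norm_mult abs_mult)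
    qed auto
    then show ?thesis by simp
  qed
  have "((\<lambda>s. (osc_int (evolve P s g) x - osc_int (evolve P t g) x) /\<^sub>R (s - t))
      \<longlongrightarrow> \<i> * osc_int (evolve P t ?Pg) x) (at t)"
    unfolding tendsto_at_iff_sequentially
  proof (intro allI impI)
    fix u :: "nat \<Rightarrow> real"
    assume u: "\<forall>i. u i \<in> UNIV - {t}" "u \<longlonglongrightarrow> t"
    have diff: "(osc_int (evolve P (u n) g) x - osc_int (evolve P t g) x) /\<^sub>R (u n - t)
        = (LINT \<xi>|lebesgue. cis (x \<bullet> \<xi>) * (?D (u n) \<xi> * g \<xi>))" for n
    proof -
      have "osc_int (evolve P (u n) g) x - osc_int (evolve P t g) x
          = (LINT \<xi>|lebesgue. cis (x \<bullet> \<xi>) * (evolve P (u n) g \<xi> - evolve P t g \<xi>))"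
        by (subst osc_int_diff[symmetric]) (auto intro: integrable_evolve P g simp: osc_int_def)
      also have "\<dots> /\<^sub>R (u n - t) = (LINT \<xi>|lebesgue. (cis (x \<bullet> \<xi>) * (evolve P (u n) g \<xi> - evolve P t g \<xi>)) /\<^sub>R (u n - t))"
        by simp
      also have "\<dots> = (LINT \<xi>|lebesgue. cis (x \<bullet> \<xi>) * (?D (u n) \<xi> * g \<xi>))"
        by (simp add: evolve_def algebra_simps scaleR_conv_of_real)
      finally show ?thesis .
    qed
    have lim: "(\<lambda>n. LINT \<xi>|lebesgue. cis (x \<bullet> \<xi>) * (?D (u n) \<xi> * g \<xi>))
        \<longlonglongrightarrow> (LINT \<xi>|lebesgue. cis (x \<bullet> \<xi>) * ((P \<xi> *\<^sub>R (\<i> * cis (t * P \<xi>))) * g \<xi>))"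
    proof (rule integral_dominated_convergence[where w="\<lambda>\<xi>. norm (?Pg \<xi>)"])
      have gm: "g \<in> borel_measurable lebesgue" using g by auto
      show "integrable lebesgue (\<lambda>\<xi>. norm (?Pg \<xi>))" using Pg by (rule integrable_norm)
      show "(\<lambda>\<xi>. cis (x \<bullet> \<xi>) * (P \<xi> *\<^sub>R (\<i> * cis (t * P \<xi>)) * g \<xi>)) \<in> borel_measurable lebesgue"
        "(\<lambda>\<xi>. cis (x \<bullet> \<xi>) * (?D (u n) \<xi> * g \<xi>)) \<in> borel_measurable lebesgue" for n
        by (intro borel_measurable_times gm continuous_borel_measurable_lebesgue continuous_intros P)+
      show "AE \<xi> in lebesgue. norm (cis (x \<bullet> \<xi>) * (?D (u n) \<xi> * g \<xi>)) \<le> norm (?Pg \<xi>)" for n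
      proof (intro AE_I2)
        fix \<xi>
        have "norm (?D (u n) \<xi>) = inverse \<bar>u n - t\<bar> * cmod (cis (u n * P \<xi>) - cis (t * P \<xi>))"
          by (simp only: norm_scaleR abs_inverse)
        also have "\<dots> \<le> inverse \<bar>u n - t\<bar> * (\<bar>P \<xi>\<bar> * \<bar>u n - t\<bar>)"
          by (rule mult_left_mono[OF lip]) simp
        also have "\<dots> = \<bar>P \<xi>\<bar>" using u(1) by simp
        finally have "norm (?D (u n) \<xi>) \<le> \<bar>P \<xi>\<bar>" .
        then show "norm (cis (x \<bullet> \<xi>) * (?D (u n) \<xi> * g \<xi>)) \<le> norm (?Pg \<xi>)"
          unfolding norm_mult norm_cis norm_of_real mult_1_left by (rule mult_right_mono) simp
      qed
      show "AE \<xi> in lebesgue. (\<lambda>n. cis (x \<bullet> \<xi>) * (?D (u n) \<xi> * g \<xi>))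
          \<longlonglongrightarrow> cis (x \<bullet> \<xi>) * ((P \<xi> *\<^sub>R (\<i> * cis (t * P \<xi>))) * g \<xi>)"
      proof (intro AE_I2 tendsto_mult tendsto_const)
        fix \<xi>
        have "((\<lambda>s. ?D s \<xi>) \<longlongrightarrow> P \<xi> *\<^sub>R (\<i> * cis (t * P \<xi>))) (at t)"
          using deriv[of \<xi> t] by (simp add: has_vector_derivative_at_iff_tendsto_quotient)
        then show "(\<lambda>n. ?D (u n) \<xi>) \<longlonglongrightarrow> P \<xi> *\<^sub>R (\<i> * cis (t * P \<xi>))"
          using u unfolding tendsto_at_iff_sequentially by (auto simp: o_def)
      qed
    qed
    have "(LINT \<xi>|lebesgue. cis (x \<bullet> \<xi>) * ((P \<xi> *\<^sub>R (\<i> * cis (t * P \<xi>))) * g \<xi>))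
       = (LINT \<xi>|lebesgue. \<i> * (cis (x \<bullet> \<xi>) * evolve P t ?Pg \<xi>))"
      by (simp add: evolve_def scaleR_conv_of_real mult_ac)
    also have "\<dots> = \<i> * osc_int (evolve P t ?Pg) x"
      unfolding osc_int_def by (rule integral_mult_right_zero)
    finally show "((\<lambda>s. (osc_int (evolve P s g) x - osc_int (evolve P t g) x) /\<^sub>R (s - t)) \<circ> u)
        \<longlonglongrightarrow> \<i> * osc_int (evolve P t ?Pg) x"
      using lim by (simp only: o_def diff)
  qed
  then show ?thesis by (simp add: has_vector_derivative_at_iff_tendsto_quotient)
qed

section \<open>Consequences of the maximal estimate\<close>

text \<open>Maximal functions see only times strictly between 0 and 1, while the comparison with the
  initial datum takes place at time 0; continuity bridges the gap.\<close>

lemma norm_le_at_0: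
  fixes \<phi> :: "real \<Rightarrow> complex"
  assumes "continuous_on UNIV \<phi>" "\<And>t. 0 < t \<Longrightarrow> t < 1 \<Longrightarrow> cmod (\<phi> t) \<le> K"
  shows "cmod (\<phi> 0) \<le> K"
proof -
  \<comment> \<open>The double \<open>Suc\<close> keeps the first time at \<open>1 / 2\<close>,
    strictly inside the interval.\<close>
  let ?u = "\<lambda>n. inverse (real (Suc (Suc n)))"
  have "?u \<longlonglongrightarrow> 0" by (rule LIMSEQ_Suc[OF LIMSEQ_inverse_real_of_nat])
  then have "(\<lambda>n. cmod (\<phi> (?u n))) \<longlonglongrightarrow> cmod (\<phi> 0)"
    by (intro tendsto_norm continuous_on_tendsto_compose[OF assms(1)]) auto
  moreover have "cmod (\<phi> (?u n)) \<le> K" for n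
    by (rule assms(2)) (auto simp: inverse_eq_divide)
  ultimately show ?thesis by (intro LIMSEQ_le_const2) auto
qed

text \<open>The mean value inequality: the time derivative is \<open>\<i>\<close> times the
  evolution of the datum with transform \<open>P \<xi> * g \<xi>\<close>.\<close>

lemma cmod_evolve_diff_le:
  fixes g :: "'a::euclidean_space \<Rightarrow> complex"
  assumes P: "continuous_on UNIV P" and g: "band_limited g" and t: "0 < t" "t < 1"
    and K: "\<And>r. 0 < r \<Longrightarrow> r < 1 \<Longrightarrow> cmod (osc_int (evolve P r (\<lambda>\<xi>. P \<xi> * g \<xi>)) x) \<le> K"
  shows "cmod (osc_int (evolve P t g) x - osc_int g x) \<le> K * t"
proof -
  let ?Pg = "\<lambda>\<xi>. complex_of_real (P \<xi>) * g \<xi>"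
  let ?d = "\<lambda>r. \<i> * osc_int (evolve P r ?Pg) x"
  have Pg: "band_limited ?Pg" by (intro band_limited_mult g continuous_intros P)
  note i = band_limitedD(2)[OF g] and iP = band_limitedD(2)[OF Pg]
  have K0: "cmod (osc_int (evolve P r ?Pg) x) \<le> K" if "0 \<le> r" "r < 1" for r
  proof (cases "r = 0")
    case True
    show ?thesis unfolding True
      by (rule norm_le_at_0[OF continuous_on_evolve_time[OF P iP]]) (rule K)
  qed (use K that in auto)
  have "norm (osc_int (evolve P t g) x - osc_int (evolve P 0 g) x) \<le> K * norm (t - 0)"
  proof (rule differentiable_bound[where S="{0..t}" and f="\<lambda>r. osc_int (evolve P r g) x"])
    show "((\<lambda>r. osc_int (evolve P r g) x) has_derivative (\<lambda>h. h *\<^sub>R ?d r)) (at r within {0..t})" for r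
      using has_vector_derivative_at_within[OF has_vector_derivative_evolve[OF P i iP]]
      by (simp add: has_vector_derivative_def)
    show "onorm (\<lambda>h. h *\<^sub>R ?d r) \<le> K" if "r \<in> {0..t}" for r
    proof (rule onorm_le)
      fix h :: real
      have "cmod (osc_int (evolve P r ?Pg) x) \<le> K" using that t by (intro K0) auto
      then show "norm (h *\<^sub>R ?d r) \<le> K * norm h"
        by (simp add: norm_mult mult.commute[of K] mult_left_mono)
    qed
  qed (use t in auto)
  then show ?thesis using t by simp
qed

text \<open>The truncated integrals are stationary once the radius exceeds the band, so the L^2
  limit is attained. This is the version to which the maximal hypothesis is applied.\<close>

lemma evolution_version_osc_int:
  assumes P: "continuous_on UNIV P" and g: "band_limited g"
  shows "evolution_version P (osc_int g) (\<lambda>t. osc_int (evolve P t g))"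
  unfolding evolution_version_def
proof (intro conjI ballI AE_I2)
  note i = band_limitedD(2)[OF g]
  show "continuous_on {0<..<1} (\<lambda>t. osc_int (evolve P t g) x)" for x
    by (rule continuous_on_evolve_time[OF P i])
  fix t :: real
  let ?F = "fourier (osc_int g)"
  have F: "square_integrable ?F" by (rule square_integrable_fourier[OF band_limitedD(3)[OF g]])
  note ev = band_limited_evolve[OF P g, of t]
  have eq: "osc_int (trunc R (evolve P t ?F)) = osc_int (trunc R (evolve P t g))" for R
  proof (rule osc_int_cong_AE)
    show "trunc R (evolve P t ?F) \<in> borel_measurable lebesgue" "trunc R (evolve P t g) \<in> borel_measurable lebesgue"
      by (intro square_integrableD(1)[OF square_integrable_trunc] square_integrable_evolve P F band_limitedD(1)[OF g])+
    show "AE x in lebesgue. trunc R (evolve P t ?F) x = trunc R (evolve P t g) x"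
      using fourier_osc_int_AE[OF g] by eventually_elim (simp add: trunc_def evolve_def)
  qed
  obtain R where R: "\<And>\<xi>. norm \<xi> \<ge> R \<Longrightarrow> g \<xi> = 0" using g by (auto simp: band_limited_def)
  have tr: "trunc r (evolve P t g) = evolve P t g" if "r \<ge> R" for r
  proof (rule ext)
    show "trunc r (evolve P t g) \<xi> = evolve P t g \<xi>" for \<xi>
      using R[of \<xi>] that by (auto simp: trunc_def evolve_def indicator_def)
  qed
  show "is_evolution P t (osc_int g) (osc_int (evolve P t g))"
    unfolding is_evolution_iff eq has_L2_limit_def
  proof (intro conjI band_limitedD(3)[OF ev] tendsto_eventually)
    show "\<forall>\<^sub>F r in at_top. (\<integral>\<^sup>+x. ennreal ((cmod (osc_int (trunc r (evolve P t g)) x - osc_int (evolve P t g) x))\<^sup>2) \<partial>lebesgue) = 0"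
      using eventually_ge_at_top[of R] by eventually_elim (simp add: tr)
  qed
qed

text \<open>A supremum of continuous functions of \<open>x\<close> is lower semicontinuous, however
  many times \<open>t\<close> are involved. Borel rather than Lebesgue measurability is recorded
  because translation is carried out on \<open>lborel\<close>.\<close>

lemma maximal_function_measurable:
  assumes P: "continuous_on UNIV P" and g: "band_limited g"
  shows "maximal_function (\<lambda>t. osc_int (evolve P t g)) \<in> borel_measurable borel"
proof (rule borel_measurableI_greater)
  fix y :: ennreal
  let ?f = "\<lambda>t x. ennreal (cmod (osc_int (evolve P t g) x))"
  have "open (\<Union>t\<in>{0<..<1}. {x. y < ?f t x})"
    by (intro open_UN ballI open_Collect_less continuous_on_const continuous_on_ennreal continuous_on_norm
        continuous_on_osc_int integrable_evolve[OF P] band_limitedD(2)[OF g])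
  moreover have "{x. y < maximal_function (\<lambda>t. osc_int (evolve P t g)) x} = (\<Union>t\<in>{0<..<1}. {x. y < ?f t x})"
    by (auto simp: maximal_function_def less_SUP_iff)
  ultimately show "{x \<in> space borel. y < maximal_function (\<lambda>t. osc_int (evolve P t g)) x} \<in> sets borel"
    by simp
qed

lemma ennreal_powr_measurable [measurable]: "(\<lambda>y. ennreal_powr y a) \<in> borel_measurable borel"
  unfolding ennreal_powr_def by measurable

lemma ennreal_powr_le_imp_le:
  assumes "ennreal_powr y a \<le> ennreal K" "K \<ge> 0" "a > 0"
  shows "y \<le> ennreal (K powr (1 / a))"
proof -
  have y: "y \<noteq> top" using assms(1) by (auto simp: ennreal_powr_def top_unique)
  then have "enn2real y powr a \<le> K"
    using assms by (simp add: ennreal_powr_def ennreal_le_iff)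
  then have "(enn2real y powr a) powr (1 / a) \<le> K powr (1 / a)"
    using assms(3) by (intro powr_mono2) auto
  then have "enn2real y \<le> K powr (1 / a)"
    using assms(3) by (simp add: powr_powr)
  moreover have "ennreal (enn2real y) = y" using y by (simp add: less_top)
  ultimately show ?thesis using ennreal_leI by metis
qed

lemma Lp_norm_on_leD:
  assumes "Lp_norm_on p A \<Phi> \<le> ennreal K" "K \<ge> 0" "p > 0"
  shows "(\<integral>\<^sup>+x\<in>A. ennreal_powr (\<Phi> x) p \<partial>lebesgue) \<le> ennreal (K powr p)"
  using ennreal_powr_le_imp_le[of _ "1 / p" K] assms unfolding Lp_norm_on_def by simp

lemma set_nn_integral_translate_ball:
  fixes \<Phi> :: "'a::euclidean_space \<Rightarrow> ennreal"
  assumes [measurable]: "\<Phi> \<in> borel_measurable borel"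
  shows "(\<integral>\<^sup>+x\<in>ball 0 1. \<Phi> (y + x) \<partial>lebesgue) = (\<integral>\<^sup>+x\<in>ball y 1. \<Phi> x \<partial>lebesgue)"
proof -
  have "(\<integral>\<^sup>+x\<in>ball y 1. \<Phi> x \<partial>lebesgue) = (\<integral>\<^sup>+x. \<Phi> x * indicator (ball y 1) x \<partial>distr lborel borel ((+) y))"
    by (simp add: nn_integral_completion lborel_distr_plus)
  also have "\<dots> = (\<integral>\<^sup>+x. \<Phi> (y + x) * indicator (ball y 1) (y + x) \<partial>lborel)"
    by (rule nn_integral_distr)
      (auto intro!: borel_measurable_times_ennreal borel_measurable_indicator assms)
  also have "(\<lambda>x. indicator (ball y 1) (y + x) :: ennreal) = indicator (ball 0 1)"
    by (auto simp: indicator_def fun_eq_iff dist_norm)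
  finally show ?thesis by (simp add: nn_integral_completion)
qed

lemma osc_int_modulate:
  "osc_int (evolve P t (\<lambda>\<xi>. cis (y \<bullet> \<xi>) * g \<xi>)) x = osc_int (evolve P t g) (y + x)"
  unfolding osc_int_def evolve_def by (simp add: inner_add_left mult_ac flip: cis_mult)

text \<open>Modulation does not change the modulus of the transform, hence not the weighted norm
  either, so the bound is uniform in the centre \<open>y\<close>. It is phrased with p-th powers in
  order to feed \<open>AE_geometric_decay\<close>.\<close>

lemma maximal_estimate_ball:
  assumes P: "continuous_on UNIV P" and p: "p > 0" and C: "C \<ge> 0"
    and maximal: "\<And>g. band_limited g \<Longrightarrow> Lp_norm_on p (ball 0 1)
      (maximal_function (\<lambda>t. osc_int (evolve P t g))) \<le> ennreal (C * sqrt (L2sq (bessel_weight s g)))"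
    and g: "band_limited g"
  shows "(\<integral>\<^sup>+x\<in>ball y 1. ennreal_powr (maximal_function (\<lambda>t. osc_int (evolve P t g)) x) p \<partial>lebesgue)
    \<le> ennreal ((C * sqrt (L2sq (bessel_weight s g))) powr p)"
proof -
  let ?g = "\<lambda>\<xi>. cis (y \<bullet> \<xi>) * g \<xi>"
  let ?\<Phi> = "\<lambda>x. ennreal_powr (maximal_function (\<lambda>t. osc_int (evolve P t g)) x) p"
  have g': "band_limited ?g" by (intro band_limited_mult g continuous_intros)
  have m: "?\<Phi> \<in> borel_measurable borel"
    by (rule measurable_compose[OF maximal_function_measurable[OF P g] ennreal_powr_measurable])
  have eq: "maximal_function (\<lambda>t. osc_int (evolve P t ?g)) x = maximal_function (\<lambda>t. osc_int (evolve P t g)) (y + x)" for x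
    by (simp add: maximal_function_def osc_int_modulate)
  have L: "L2sq (bessel_weight s ?g) = L2sq (bessel_weight s g)"
    by (simp add: L2sq_def bessel_weight_def norm_mult)
  have "(\<integral>\<^sup>+x\<in>ball 0 1. ?\<Phi> (y + x) \<partial>lebesgue) \<le> ennreal ((C * sqrt (L2sq (bessel_weight s g))) powr p)"
    using Lp_norm_on_leD[OF maximal[OF g'] _ p] C by (simp add: eq L L2sq_nonneg)
  then show ?thesis unfolding set_nn_integral_translate_ball[OF m] .
qed

text \<open>Geometric decay of the weighted norms becomes decay with ratio \<open>q powr p\<close>
  of the integrals of p-th powers over a unit ball. The almost everywhere bound there has the ratio
  \<open>q' powr p\<close>, and a p-th root returns \<open>q'\<close>.\<close>

lemma maximal_decay_AE:
  fixes P :: "'a::euclidean_space \<Rightarrow> real"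
  assumes P: "continuous_on UNIV P" and p: "p > 0" and C: "C \<ge> 0"
    and maximal: "\<And>g. band_limited g \<Longrightarrow> Lp_norm_on p (ball 0 1)
      (maximal_function (\<lambda>t. osc_int (evolve P t g))) \<le> ennreal (C * sqrt (L2sq (bessel_weight s g)))"
    and g: "\<And>k. band_limited (g k)"
    and decay: "\<And>k. sqrt (L2sq (bessel_weight s (g k))) \<le> D * q ^ k" and q: "0 < q" "q < q'"
  shows "AE x in lebesgue. \<exists>B\<ge>0. \<forall>k. \<forall>t\<in>{0<..<1}. cmod (osc_int (evolve P t (g k)) x) \<le> B * q' ^ k"
proof -
  let ?M = "\<lambda>k. maximal_function (\<lambda>t. osc_int (evolve P t (g k)))"
  let ?good = "\<lambda>x. \<exists>B\<ge>0. \<forall>k. \<forall>t\<in>{0<..<1}. cmod (osc_int (evolve P t (g k)) x) \<le> B * q' ^ k"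
  have D: "D \<ge> 0" using decay[of 0] order_trans[OF real_sqrt_ge_zero[OF L2sq_nonneg]] by fastforce
  have loc: "AE x in lebesgue. x \<in> ball y 1 \<longrightarrow> ?good x" for y
  proof -
    have "AE x in lebesgue. \<exists>B::real. B \<ge> 0 \<and>
        (\<forall>k. ennreal_powr (?M k x) p * indicator (ball y 1) x \<le> ennreal (B * (q' powr p) ^ k))"
    proof (rule AE_geometric_decay)
      show "(\<lambda>x. ennreal_powr (?M k x) p * indicator (ball y 1) x) \<in> borel_measurable lebesgue" for k
        using maximal_function_measurable[OF P g[of k]]
        by (intro borel_measurable_lebesgueI borel_measurable_times_ennreal
            measurable_compose[OF _ ennreal_powr_measurable] borel_measurable_indicator) auto
      show "(\<integral>\<^sup>+x. ennreal_powr (?M k x) p * indicator (ball y 1) x \<partial>lebesgue)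
          \<le> ennreal ((C * D) powr p * (q powr p) ^ k)" for k
      proof -
        have "(C * sqrt (L2sq (bessel_weight s (g k)))) powr p \<le> ((C * D) * q ^ k) powr p"
          using mult_left_mono[OF decay[of k] C] C p by (intro powr_mono2) (auto simp: L2sq_nonneg mult_ac)
        also have "\<dots> = (C * D) powr p * (q powr p) ^ k"
          using C D q by (simp add: powr_mult powr_power powr_powr mult.commute flip: powr_realpow)
        finally show ?thesis
          using maximal_estimate_ball[OF P p C maximal g[of k], where y=y] by (meson ennreal_leI order_trans)
      qed
      show "q powr p < q' powr p" using q p by (intro powr_less_mono2) auto
    qed (use q in auto)
    then show ?thesis
    proof eventually_elim
      case (elim x)
      show ?case
      proof
        assume x: "x \<in> ball y 1"
        from elim obtain B where B: "B \<ge> 0" "\<And>k. ennreal_powr (?M k x) p \<le> ennreal (B * (q' powr p) ^ k)"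
          using x by (auto simp: indicator_def)
        show "?good x"
        proof (intro exI[of _ "B powr (1 / p)"] conjI allI ballI)
          fix k and t :: real assume t: "t \<in> {0<..<1}"
          have "ennreal (cmod (osc_int (evolve P t (g k)) x)) \<le> ?M k x"
            unfolding maximal_function_def by (rule SUP_upper[OF t])
          also have "\<dots> \<le> ennreal ((B * (q' powr p) ^ k) powr (1 / p))"
            by (rule ennreal_powr_le_imp_le[OF B(2)]) (use B p in auto)
          also have "(B * (q' powr p) ^ k) powr (1 / p) = B powr (1 / p) * q' ^ k"
          proof -
            have "(q' powr p) ^ k = (q' ^ k) powr p"
              using q by (simp add: powr_power powr_powr mult.commute flip: powr_realpow)
            then show ?thesis using B q p by (simp add: powr_mult powr_powr)
          qed
          finally show "cmod (osc_int (evolve P t (g k)) x) \<le> B powr (1 / p) * q' ^ k"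
            using q by (subst (asm) ennreal_le_iff) auto
        qed simp
      qed
    qed
  qed
  \<comment> \<open>Unit balls about a countable dense set cover the space, so countably many
    exceptional sets suffice.\<close>
  obtain Y :: "'a set" where Y: "countable Y" "\<And>X. open X \<Longrightarrow> X \<noteq> {} \<Longrightarrow> \<exists>y\<in>Y. y \<in> X"
    using countable_dense_exists by blast
  have "AE x in lebesgue. \<forall>y\<in>Y. x \<in> ball y 1 \<longrightarrow> ?good x"
    unfolding AE_ball_countable[OF Y(1)] using loc by blast
  then show ?thesis
  proof eventually_elim
    case (elim x)
    obtain y where "y \<in> Y" "y \<in> ball x 1" using Y(2)[of "ball x 1"] by auto
    then show ?case using elim by (auto simp: dist_commute)
  qed
qed

section \<open>Dyadic decomposition\<close>

text \<open>The bound on the increments is uniform in \<open>t\<close>, so the Weierstrass test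
  makes the limit continuous. Time 0 is included in the convergence because the limit there will be
  compared with \<open>f\<close>.\<close>

lemma geometric_increments_limit:
  fixes S :: "nat \<Rightarrow> real \<Rightarrow> complex"
  assumes S: "\<And>K. continuous_on UNIV (S K)" and S0: "\<And>t. S 0 t = 0"
    and incr: "\<And>k t. 0 < t \<Longrightarrow> t < 1 \<Longrightarrow> cmod (S (Suc k) t - S k t) \<le> B * q ^ k"
    and q: "0 \<le> q" "q < 1"
  shows "0 \<le> t \<Longrightarrow> t < 1 \<Longrightarrow> (\<lambda>K. S K t) \<longlonglongrightarrow> lim (\<lambda>K. S K t)"
    and "continuous_on {0<..<1} (\<lambda>t. lim (\<lambda>K. S K t))"
proof -
  show lim: "(\<lambda>K. S K t) \<longlonglongrightarrow> lim (\<lambda>K. S K t)" if t: "0 \<le> t" "t < 1" for t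
  proof -
    have "cmod (S (Suc k) t - S k t) \<le> B * q ^ k" for k
    proof (cases "t = 0")
      case True
      show ?thesis unfolding True
        by (rule norm_le_at_0[of "\<lambda>t. S (Suc k) t - S k t"]) (auto intro!: continuous_intros S incr)
    qed (use incr t in auto)
    then have "convergent (\<lambda>K. S K t)" by (rule convergent_geometric_increments) (use q in auto)
    then show ?thesis by (simp add: convergent_LIMSEQ_iff)
  qed
  let ?d = "\<lambda>k t. S (Suc k) t - S k t"
  have sum: "(\<Sum>k<n. ?d k t) = S n t" for n t
    using sum_lessThan_telescope[of "\<lambda>k. S k t" n] by (simp add: S0)
  have "uniform_limit {0<..<1} (\<lambda>n t. \<Sum>k<n. ?d k t) (\<lambda>t. suminf (\<lambda>k. ?d k t)) sequentially"
    by (rule Weierstrass_m_test[where M="\<lambda>k. B * q ^ k"])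
      (use incr q in \<open>auto intro!: summable_mult summable_geometric\<close>)
  then have u: "uniform_limit {0<..<1} S (\<lambda>t. suminf (\<lambda>k. ?d k t)) sequentially"
    by (simp only: sum)
  have "continuous_on {0<..<1} (\<lambda>t. suminf (\<lambda>k. ?d k t))"
    by (rule uniform_limit_theorem[OF _ u])
      (auto intro!: always_eventually continuous_on_subset[OF S])
  moreover have "suminf (\<lambda>k. ?d k t) = lim (\<lambda>K. S K t)" if "t \<in> {0<..<1}" for t
    using LIMSEQ_unique[OF tendsto_uniform_limitI[OF u that] lim] that by auto
  ultimately show "continuous_on {0<..<1} (\<lambda>t. lim (\<lambda>K. S K t))"
    by (rule continuous_on_eq)
qed

lemma norm_le_geometric_increments:
  fixes a :: "nat \<Rightarrow> complex"
  assumes lim: "a \<longlonglongrightarrow> L" and a0: "a 0 = 0"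
    and incr: "\<And>k. cmod (a (Suc k) - a k) \<le> A * q ^ k" and q: "0 \<le> q" "q < 1"
  shows "cmod L \<le> A / (1 - q)"
proof (rule LIMSEQ_le_const2[OF tendsto_norm[OF lim]], intro exI allI impI)
  fix n
  have A: "A \<ge> 0" using order_trans[OF norm_ge_zero incr[of 0]] by simp
  have "cmod (a n) = cmod (\<Sum>k<n. a (Suc k) - a k)"
    by (simp only: sum_lessThan_telescope a0 diff_zero)
  also have "\<dots> \<le> (\<Sum>k<n. A * q ^ k)" by (intro sum_norm_le incr)
  also have "\<dots> \<le> (\<Sum>k. A * q ^ k)"
    using A q by (intro sum_le_suminf summable_mult summable_geometric) auto
  also have "\<dots> = A / (1 - q)" using q by (simp add: suminf_mult summable_geometric suminf_geometric)
  finally show "cmod (a n) \<le> A / (1 - q)" .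
qed

text \<open>The interpolation between the size bound (1) and the time derivative bound
  (\<open>z\<close>) for a dyadic piece.\<close>

lemma min_one_le_powr:
  fixes z :: real
  assumes "z > 0" "0 \<le> \<theta>" "\<theta> \<le> 1"
  shows "min 1 z \<le> z powr \<theta>"
proof (cases "z \<ge> 1")
  case True
  then show ?thesis using assms ge_one_powr_ge_zero[of z \<theta>] by simp
next
  case False
  then have "z powr 1 \<le> z powr \<theta>" using assms by (intro powr_mono') auto
  then show ?thesis using assms False by simp
qed

lemma powr_two_realpow: "(2 powr x) ^ k = (2::real) powr (x * real k)"
  by (simp add: powr_power mult.commute)

text \<open>Identifies a pointwise limit along a sequence of radii with the L^2 limit over all
  radii: by Parseval the truncated integrals are Cauchy, and Fatou transfers the estimate to
  \<open>v\<close>.\<close>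

lemma has_L2_limit_of_AE_limit:
  fixes h :: "'a::euclidean_space \<Rightarrow> complex"
  assumes h: "square_integrable h" and r: "filterlim r at_top sequentially"
    and v: "v \<in> borel_measurable lebesgue"
    and lim: "AE x in lebesgue. (\<lambda>K. osc_int (trunc (r K) h) x) \<longlonglongrightarrow> v x"
  shows "square_integrable v" "((\<lambda>R. L2sq (\<lambda>x. osc_int (trunc R h) x - v x)) \<longlongrightarrow> 0) at_top"
proof -
  let ?c = "(2 * pi) ^ DIM('a) :: real"
  have c: "?c > 0" by simp
  let ?E = "\<lambda>R. osc_int (trunc R h)"
  note t = band_limited_trunc[OF h]
  note E = band_limitedD(3)[OF t]
  have Em: "?E R \<in> borel_measurable lebesgue" for R by (rule square_integrableD(1)[OF E])
  define a where "a R = L2sq (\<lambda>x. trunc R h x - h x)" for R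
  have a: "(a \<longlongrightarrow> 0) at_top" unfolding a_def by (rule trunc_tendsto[OF h])
  have a0: "a R \<ge> 0" for R by (simp add: a_def L2sq_nonneg)
  have diff: "L2sq (\<lambda>x. ?E R x - ?E R' x) \<le> ?c * (2 * a R + 2 * a R')" for R R'
  proof -
    let ?d = "\<lambda>x. trunc R h x - trunc R' h x"
    note s = square_integrable_trunc[OF h]
    have d0: "?d x = 0" if "norm x \<ge> max R R'" for x using that by (simp add: trunc_eq_0)
    have "L2sq ?d \<le> 2 * a R + 2 * a R'"
      using L2sq_add_le[OF square_integrable_diff[OF s h] square_integrable_diff[OF h s], of R R']
      by (simp add: a_def L2sq_minus_commute[of h])
    moreover have "L2sq (osc_int ?d) = ?c * L2sq ?d"
      by (rule parseval[OF square_integrable_diff[OF s s]]) (rule d0)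
    moreover have "(\<lambda>x. ?E R x - ?E R' x) = osc_int ?d"
      by (intro ext osc_int_diff[symmetric] band_limitedD(2)[OF t])
    ultimately show ?thesis by simp
  qed
  have bd: "(\<integral>\<^sup>+x. ennreal ((cmod (?E R x - v x))\<^sup>2) \<partial>lebesgue) \<le> ennreal (?c * (2 * a R + e))"
    if "e > 0" for R e
  proof (rule L2_fatou)
    show "AE x in lebesgue. (\<lambda>K. ?E R x - ?E (r K) x) \<longlonglongrightarrow> ?E R x - v x"
      using lim by eventually_elim (intro tendsto_intros)
    have "eventually (\<lambda>K. a (r K) < e / 2) sequentially"
      using order_tendstoD(2)[OF filterlim_compose[OF a r], of "e / 2"] that by simp
    then show "\<forall>\<^sub>F K in sequentially. (\<integral>\<^sup>+x. ennreal ((cmod (?E R x - ?E (r K) x))\<^sup>2) \<partial>lebesgue)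
        \<le> ennreal (?c * (2 * a R + e))"
    proof eventually_elim
      case (elim K)
      have "L2sq (\<lambda>x. ?E R x - ?E (r K) x) \<le> ?c * (2 * a R + e)"
        using elim c by (intro order_trans[OF diff] mult_left_mono) auto
      then show ?case
        unfolding square_integrable_nn_integral[OF square_integrable_diff[OF E E]] by (rule ennreal_leI)
    qed
  qed (intro borel_measurable_diff Em v)+
  have ds: "square_integrable (\<lambda>x. ?E R x - v x)" for R
  proof (rule square_integrableI_nn_integral)
    show "(\<integral>\<^sup>+x. ennreal ((cmod (?E R x - v x))\<^sup>2) \<partial>lebesgue) < \<infinity>"
      using bd[of 1 R] by (auto intro: le_less_trans)
  qed (intro borel_measurable_diff Em v)
  show "square_integrable v"
    using square_integrable_diff[OF E[of 0] ds[of 0]] by simp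
  have le: "L2sq (\<lambda>x. ?E R x - v x) \<le> ?c * (2 * a R)" for R
  proof (rule field_le_epsilon)
    fix e :: real assume "e > 0"
    then have e: "e / ?c > 0" using c by simp
    then have "0 \<le> ?c * (2 * a R + e / ?c)" using c a0[of R] by simp
    then have "L2sq (\<lambda>x. ?E R x - v x) \<le> ?c * (2 * a R + e / ?c)"
      using bd[OF e, of R] by (simp only: square_integrable_nn_integral[OF ds] ennreal_le_iff)
    then show "L2sq (\<lambda>x. ?E R x - v x) \<le> ?c * (2 * a R) + e"
      using c by (simp add: distrib_left)
  qed
  have "((\<lambda>R. ?c * (2 * a R)) \<longlongrightarrow> ?c * (2 * 0)) at_top" by (intro tendsto_intros a)
  then have up: "((\<lambda>R. ?c * (2 * a R)) \<longlongrightarrow> 0) at_top" by simp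
  show "((\<lambda>R. L2sq (\<lambda>x. ?E R x - v x)) \<longlongrightarrow> 0) at_top"
    by (rule tendsto_sandwich[OF _ _ tendsto_const up]) (intro always_eventually allI L2sq_nonneg le)+
qed

text \<open>The annuli are dyadic in \<open>1 + norm \<xi>\<close>. Since
  \<open>2 ^ 0 - 1 = 0\<close>, piece 0 takes in the origin and the telescoping sum starts from the
  empty truncation.\<close>

definition dyadic_piece :: "nat \<Rightarrow> ('a::euclidean_space \<Rightarrow> complex) \<Rightarrow> 'a \<Rightarrow> complex" where
  "dyadic_piece k h \<xi> = trunc (2 ^ Suc k - 1) h \<xi> - trunc (2 ^ k - 1) h \<xi>"

lemma dyadic_piece_eq:
  "dyadic_piece k h \<xi> = (if 2 ^ k \<le> 1 + norm \<xi> \<and> 1 + norm \<xi> < 2 ^ Suc k then h \<xi> else 0)"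
proof -
  have "\<not> (norm \<xi> < 2 ^ k - 1 \<and> \<not> norm \<xi> < 2 * 2 ^ k - 1)"
    using zero_less_power[of "2::real" k] by linarith
  then show ?thesis by (auto simp: dyadic_piece_def trunc_def indicator_def)
qed

lemma band_limited_dyadic_piece:
  assumes "square_integrable h"
  shows "band_limited (dyadic_piece k h)"
proof -
  have "square_integrable (dyadic_piece k h)"
    unfolding dyadic_piece_def[abs_def] by (intro square_integrable_diff square_integrable_trunc assms)
  moreover have "dyadic_piece k h \<xi> = 0" if "norm \<xi> \<ge> 2 ^ Suc k" for \<xi>
    using that by (auto simp: dyadic_piece_eq)
  ultimately show ?thesis unfolding band_limited_def by blast
qed

lemma osc_int_dyadic_piece:
  assumes P: "continuous_on UNIV P" and h: "square_integrable h"
  shows "osc_int (evolve P t (dyadic_piece k h)) x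
    = osc_int (evolve P t (trunc (2 ^ Suc k - 1) h)) x - osc_int (evolve P t (trunc (2 ^ k - 1) h)) x"
proof -
  have "evolve P t (dyadic_piece k h)
      = (\<lambda>\<xi>. evolve P t (trunc (2 ^ Suc k - 1) h) \<xi> - evolve P t (trunc (2 ^ k - 1) h) \<xi>)"
    by (simp add: evolve_def dyadic_piece_def[abs_def] right_diff_distrib)
  then show ?thesis
    by (simp only: osc_int_diff[OF integrable_evolve[OF P integrable_trunc[OF h]]
          integrable_evolve[OF P integrable_trunc[OF h]]])
qed

text \<open>On the \<open>k\<close>-th annulus \<open>1 + \<bar>\<xi>\<bar>\<^sup>2 \<ge> (1 + \<bar>\<xi>\<bar>)\<^sup>2 / 2 \<ge> 2 powr (2 * k - 1)\<close>.\<close>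

lemma bessel_factor_dyadic:
  fixes r :: real
  assumes "2 ^ k \<le> 1 + r" "0 \<le> r" "a \<ge> 0"
  shows "(1 + r\<^sup>2) powr (- a / 2) \<le> 2 powr (a / 2) * (2 powr - a) ^ k"
proof -
  have "(2::real) powr real (k * 2) = (2 ^ k)\<^sup>2"
    unfolding power_mult[symmetric] by (rule powr_realpow) simp
  then have "(2::real) powr (2 * real k - 1) = (2 ^ k)\<^sup>2 / 2"
    by (simp add: powr_diff mult.commute)
  also have "\<dots> \<le> (1 + r)\<^sup>2 / 2"
    using assms by (intro divide_right_mono power_mono) auto
  also have "\<dots> \<le> 1 + r\<^sup>2"
    using sum_squares_bound[of 1 r] by (simp add: power2_sum)
  finally have "(1 + r\<^sup>2) powr (- a / 2) \<le> (2 powr (2 * real k - 1)) powr (- a / 2)"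
    using assms by (intro powr_mono2') auto
  also have "\<dots> = 2 powr (a / 2 + - a * real k)"
    unfolding powr_powr by (rule arg_cong[where f="\<lambda>x. 2 powr x"]) (simp add: field_simps)
  also have "\<dots> = 2 powr (a / 2) * (2 powr - a) ^ k"
    by (simp only: powr_add powr_two_realpow)
  finally show ?thesis .
qed

text \<open>On the annulus, lowering the order of the weight from \<sigma> to \<open>s\<close> gains
  \<open>2 powr (s - \<sigma>)\<close> per dyadic step. The multiplier \<phi> will be 1 or
  \<open>P\<close>.\<close>

lemma bessel_weight_dyadic_piece:
  assumes h: "square_integrable h" and hs: "square_integrable (bessel_weight \<sigma> h)"
    and \<phi>: "\<And>\<xi>. 1 + norm \<xi> < 2 ^ Suc k \<Longrightarrow> cmod (\<phi> \<xi>) \<le> M" "continuous_on UNIV \<phi>" "M \<ge> 0"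
    and s: "s \<le> \<sigma>"
  shows "sqrt (L2sq (bessel_weight s (\<lambda>\<xi>. \<phi> \<xi> * dyadic_piece k h \<xi>)))
    \<le> M * 2 powr ((\<sigma> - s) / 2) * sqrt (L2sq (bessel_weight \<sigma> h)) * (2 powr (s - \<sigma>)) ^ k"
proof -
  let ?K = "M * 2 powr ((\<sigma> - s) / 2) * (2 powr (s - \<sigma>)) ^ k"
  let ?g = "\<lambda>\<xi>. \<phi> \<xi> * dyadic_piece k h \<xi>"
  have g: "band_limited ?g" by (intro band_limited_mult band_limited_dyadic_piece h \<phi>)
  have K: "?K \<ge> 0" using \<phi>(3) by simp
  have pw: "cmod (bessel_weight s ?g \<xi>) \<le> cmod (of_real ?K * bessel_weight \<sigma> h \<xi>)" for \<xi>
  proof (cases "2 ^ k \<le> 1 + norm \<xi> \<and> 1 + norm \<xi> < 2 ^ Suc k")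
    case True
    let ?w = "1 + (norm \<xi>)\<^sup>2"
    have w: "?w > 0" using zero_le_power2[of "norm \<xi>"] by linarith
    have "?w powr (s / 2) = ?w powr (- (\<sigma> - s) / 2) * ?w powr (\<sigma> / 2)"
      by (simp add: field_simps flip: powr_add)
    also have "\<dots> \<le> (2 powr ((\<sigma> - s) / 2) * (2 powr - (\<sigma> - s)) ^ k) * ?w powr (\<sigma> / 2)"
      using True s by (intro mult_right_mono bessel_factor_dyadic) auto
    finally have "cmod (\<phi> \<xi>) * ?w powr (s / 2)
        \<le> M * ((2 powr ((\<sigma> - s) / 2) * (2 powr - (\<sigma> - s)) ^ k) * ?w powr (\<sigma> / 2))"
      using \<phi>(1)[of \<xi>] \<phi>(3) True by (intro mult_mono) auto
    then have "cmod (\<phi> \<xi>) * ?w powr (s / 2) * cmod (h \<xi>)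
        \<le> M * ((2 powr ((\<sigma> - s) / 2) * (2 powr - (\<sigma> - s)) ^ k) * ?w powr (\<sigma> / 2)) * cmod (h \<xi>)"
      by (rule mult_right_mono) simp
    then show ?thesis using True K
      by (simp add: bessel_weight_def dyadic_piece_eq norm_mult norm_power mult_ac \<phi>(3))
  next
    case False
    then have "dyadic_piece k h \<xi> = 0" by (simp only: dyadic_piece_eq if_False)
    then show ?thesis by (simp add: bessel_weight_def)
  qed
  have "L2sq (bessel_weight s ?g) \<le> L2sq (\<lambda>\<xi>. of_real ?K * bessel_weight \<sigma> h \<xi>)"
    by (rule L2sq_mono[OF square_integrable_cmult[OF hs]
          square_integrableD(1)[OF band_limitedD(1)[OF band_limited_bessel_weight[OF g]]] pw])
  also have "\<dots> = ?K\<^sup>2 * L2sq (bessel_weight \<sigma> h)"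
    unfolding L2sq_cmult norm_of_real power2_abs ..
  finally have "sqrt (L2sq (bessel_weight s ?g)) \<le> sqrt (?K\<^sup>2 * L2sq (bessel_weight \<sigma> h))"
    by (rule real_sqrt_le_mono)
  also have "\<dots> = ?K * sqrt (L2sq (bessel_weight \<sigma> h))"
    unfolding real_sqrt_mult real_sqrt_abs abs_of_nonneg[OF K] ..
  finally show ?thesis by (simp only: mult_ac)
qed

text \<open>For each rational time the two L^2 limits agree almost everywhere, and the countably
  many null sets merge. At a remaining \<open>x\<close> the set of times of disagreement is open and
  contains no rational.\<close>

lemma evolution_version_unique:
  fixes P :: "'a::euclidean_space \<Rightarrow> real"
  assumes P: "continuous_on UNIV P" and f: "square_integrable f"
    and u: "evolution_version P f u" and v: "evolution_version P f v"
  shows "AE x in lebesgue. \<forall>t\<in>{0<..<1}. u t x = v t x"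
proof -
  have eq: "AE x in lebesgue. u t x = v t x" if t: "t \<in> {0<..<1}" for t
  proof -
    let ?F = "\<lambda>R. osc_int (trunc R (evolve P t (fourier f)))"
    have F: "square_integrable (?F R)" for R
      by (intro band_limitedD(3) band_limited_trunc square_integrable_evolve P square_integrable_fourier f)
    have lim: "square_integrable (w t)" "((\<lambda>R. L2sq (\<lambda>x. ?F R x - w t x)) \<longlongrightarrow> 0) at_top"
      if "evolution_version P f w" for w
    proof -
      have *: "has_L2_limit ?F (w t)"
        using that t by (auto simp: evolution_version_def is_evolution_iff)
      then show s: "square_integrable (w t)" by (simp add: has_L2_limit_def)
      show "((\<lambda>R. L2sq (\<lambda>x. ?F R x - w t x)) \<longlongrightarrow> 0) at_top"
        using * has_L2_limit_iff[where F="?F", OF F s] by blast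
    qed
    show ?thesis
      by (rule L2_limit_unique[OF F lim(1)[OF u] lim(1)[OF v] lim(2)[OF u] lim(2)[OF v]]) simp
  qed
  have "AE x in lebesgue. \<forall>t\<in>\<rat> \<inter> {0<..<1}. u t x = v t x"
    by (subst AE_ball_countable) (auto intro!: countable_Int1 countable_rat eq)
  moreover have "AE x in lebesgue. continuous_on {0<..<1} (\<lambda>t. u t x)"
    "AE x in lebesgue. continuous_on {0<..<1} (\<lambda>t. v t x)"
    using u v by (auto simp: evolution_version_def)
  ultimately show ?thesis
  proof eventually_elim
    case (elim x)
    let ?d = "\<lambda>t. u t x - v t x"
    have "continuous_on {0<..<1} ?d" by (intro continuous_intros elim)
    then have op: "open ({0<..<1} \<inter> ?d -` (- {0}))"
      by (rule continuous_open_preimage) auto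
    have "{0<..<1} \<inter> ?d -` (- {0}) = {}"
    proof (rule ccontr)
      assume "{0<..<1} \<inter> ?d -` (- {0}) \<noteq> {}"
      then obtain t where t: "t \<in> {0<..<1} \<inter> ?d -` (- {0})" by blast
      then obtain e where e: "e > 0" "ball t e \<subseteq> {0<..<1} \<inter> ?d -` (- {0})"
        using op open_contains_ball by blast
      obtain q where "q \<in> \<rat>" "t < q" "q < t + e" using Rats_dense_in_real[of t "t + e"] e(1) by auto
      moreover from this have "q \<in> ball t e" by (simp add: dist_real_def)
      then have "q \<in> {0<..<1}" "?d q \<noteq> 0" using e(2) by auto
      ultimately show False using elim(1) by auto
    qed
    then show ?case by auto
  qed
qed

lemma smallo_of_powr_bound:
  fixes w :: "real \<Rightarrow> complex"
  assumes "\<And>t. 0 < t \<Longrightarrow> t < 1 \<Longrightarrow> cmod (w t) \<le> B * t powr \<beta>" "\<alpha> < \<beta>"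
  shows "w \<in> o[at_right 0](\<lambda>t. complex_of_real (t powr \<alpha>))"
proof (rule landau_o.smallI)
  fix c :: real assume c: "c > 0"
  have "((\<lambda>t. t powr (\<beta> - \<alpha>)) \<longlongrightarrow> 0) (at_right 0)"
    by (rule tendsto_zero_powrI[where b="\<beta> - \<alpha>"])
      (use assms(2) in \<open>auto intro: tendsto_ident_at simp: eventually_at_right_less eventually_at_filter\<close>)
  then have "((\<lambda>t. B * t powr (\<beta> - \<alpha>)) \<longlongrightarrow> 0) (at_right 0)" by (rule tendsto_mult_right_zero)
  then have "eventually (\<lambda>t. B * t powr (\<beta> - \<alpha>) < c) (at_right 0)" using c by (rule order_tendstoD(2))
  moreover have "eventually (\<lambda>t. t \<in> {0<..<1}) (at_right (0::real))"
    by (rule eventually_at_right_real) simp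
  ultimately show "eventually (\<lambda>t. norm (w t) \<le> c * norm (complex_of_real (t powr \<alpha>))) (at_right 0)"
  proof eventually_elim
    case (elim t)
    have "cmod (w t) \<le> B * t powr \<beta>" using assms(1) elim by simp
    also have "\<dots> = (B * t powr (\<beta> - \<alpha>)) * t powr \<alpha>" by (simp flip: powr_add)
    also have "\<dots> \<le> c * t powr \<alpha>" using elim by (intro mult_right_mono) auto
    finally show ?case by simp
  qed
qed

section \<open>Rate of convergence\<close>

text \<open>Continuity bounds \<open>P\<close> on the ball where the growth hypothesis is silent,
  and \<open>1 + norm \<xi>\<close> is at least 1 there. In this form the estimate fits every
  annulus, including the one around the origin.\<close>

lemma growth_bound:
  fixes P :: "'a::euclidean_space \<Rightarrow> real"
  assumes P: "continuous_on UNIV P" and m: "m > 0"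
    and growth: "\<exists>C>0. \<exists>R\<^sub>0>0. \<forall>\<xi>. norm \<xi> \<ge> R\<^sub>0 \<longrightarrow> \<bar>P \<xi>\<bar> \<le> C * norm \<xi> powr m"
  obtains C where "C > 0" "\<And>\<xi>. \<bar>P \<xi>\<bar> \<le> C * (1 + norm \<xi>) powr m"
proof -
  obtain C R where C: "C > 0" "\<And>\<xi>. norm \<xi> \<ge> R \<Longrightarrow> \<bar>P \<xi>\<bar> \<le> C * norm \<xi> powr m"
    using growth by blast
  have "bounded (P ` cball 0 R)"
    by (intro compact_imp_bounded compact_continuous_image continuous_on_subset[OF P]) auto
  then obtain K where K: "\<forall>y\<in>P ` cball 0 R. norm y \<le> K" "K > 0" using bounded_pos by blast
  have "\<bar>P \<xi>\<bar> \<le> (C + K) * (1 + norm \<xi>) powr m" for \<xi>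
  proof (cases "norm \<xi> \<ge> R")
    case True
    have "\<bar>P \<xi>\<bar> \<le> C * norm \<xi> powr m" by (rule C(2)[OF True])
    also have "\<dots> \<le> (C + K) * (1 + norm \<xi>) powr m"
      using C K m by (intro mult_mono powr_mono2) auto
    finally show ?thesis .
  next
    case False
    then have "\<bar>P \<xi>\<bar> \<le> K * 1" using K by auto
    also have "\<dots> \<le> (C + K) * (1 + norm \<xi>) powr m"
      using C K m by (intro mult_mono ge_one_powr_ge_zero) auto
    finally show ?thesis .
  qed
  then show ?thesis using C(1) K(2) that[of "C + K"] by simp
qed

proposition evolution_convergence_rate:
  fixes P :: "'a::euclidean_space \<Rightarrow> real"
  assumes P: "continuous_on UNIV P" and p: "p > 0" and m: "m > 0"
    and growth: "\<exists>C>0. \<exists>R\<^sub>0>0. \<forall>\<xi>. norm \<xi> \<ge> R\<^sub>0 \<longrightarrow> \<bar>P \<xi>\<bar> \<le> C * norm \<xi> powr m"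
    and C: "C \<ge> 0"
    and maximal: "\<And>g. band_limited g \<Longrightarrow> Lp_norm_on p (ball 0 1)
      (maximal_function (\<lambda>t. osc_int (evolve P t g))) \<le> ennreal (C * sqrt (L2sq (bessel_weight s g)))"
    and f: "f \<in> sobolev \<sigma>" and \<delta>: "0 < \<delta>" "\<delta> < m" "\<delta> < \<sigma> - s"
  shows "\<exists>u. evolution_version P f u \<and>
    (AE x in lebesgue. \<exists>B. \<forall>t\<in>{0<..<1}. cmod (u t x - f x) \<le> B * t powr (\<delta> / m))"
proof -
  define h where "h = fourier f"
  have fs: "square_integrable f" and hs: "square_integrable (bessel_weight \<sigma> h)"
    using f by (auto simp: sobolev_def h_def)
  have h: "square_integrable h" unfolding h_def by (rule square_integrable_fourier[OF fs])
  have s: "s \<le> \<sigma>" using \<delta> by simp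
  define a where "a = \<sigma> - s"
  \<comment> \<open>The gap below \<open>a\<close> absorbs the loss in
    \<open>maximal_decay_AE\<close>; the gap above \<delta> makes the final geometric series, of
    ratio \<open>2 powr (\<delta> - b)\<close>, converge.\<close>
  obtain b where b: "\<delta> < b" "b < a" using \<delta>(3) dense unfolding a_def by blast
  obtain C1 where C1: "C1 > 0" "\<And>\<xi>. \<bar>P \<xi>\<bar> \<le> C1 * (1 + norm \<xi>) powr m"
    using growth_bound[OF P m growth] by blast
  define g where "g k = dyadic_piece k h" for k
  define Pg where "Pg k = (\<lambda>\<xi>. complex_of_real (P \<xi>) * g k \<xi>)" for k
  have gb: "band_limited (g k)" for k unfolding g_def by (rule band_limited_dyadic_piece[OF h])
  have Pgb: "band_limited (Pg k)" for k
    unfolding Pg_def by (intro band_limited_mult gb continuous_intros P)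
  let ?N = "2 powr (a / 2) * sqrt (L2sq (bessel_weight \<sigma> h))"
  have g_decay: "sqrt (L2sq (bessel_weight s (g k))) \<le> ?N * (2 powr - a) ^ k" for k
    using bessel_weight_dyadic_piece[OF h hs _ continuous_on_const _ s, of k 1 1]
    by (simp add: g_def a_def)
  have Pg_decay: "sqrt (L2sq (bessel_weight s (Pg k))) \<le> (C1 * 2 powr m * ?N) * (2 powr (m - a)) ^ k" for k
  proof -
    \<comment> \<open>This is \<open>C1 * (2 ^ Suc k) powr m\<close>, the largest size allowed to
      \<open>P\<close> on the k-th annulus.\<close>
    let ?M = "C1 * (2 powr m * (2 powr m) ^ k)"
    have bound: "cmod (complex_of_real (P \<xi>)) \<le> ?M" if "1 + norm \<xi> < 2 ^ Suc k" for \<xi> :: 'a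
    proof -
      have "(1 + norm \<xi>) powr m \<le> (2 ^ Suc k) powr m" using that m by (intro powr_mono2) auto
      also have "\<dots> = 2 powr m * (2 powr m) ^ k"
        by (simp add: powr_mult powr_power powr_powr mult.commute flip: powr_realpow)
      finally show ?thesis using C1(2)[of \<xi>] C1(1)
        by (simp add: order_trans[OF _ mult_left_mono])
    qed
    have "sqrt (L2sq (bessel_weight s (Pg k))) \<le> ?M * 2 powr (a / 2) * sqrt (L2sq (bessel_weight \<sigma> h)) * (2 powr - a) ^ k"
      using bessel_weight_dyadic_piece[OF h hs bound _ _ s] C1(1)
      by (simp add: Pg_def g_def a_def P continuous_on_of_real)
    also have "\<dots> = (C1 * 2 powr m * ?N) * (2 powr m * 2 powr - a) ^ k"
      by (simp add: power_mult_distrib)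
    also have "2 powr m * 2 powr - a = 2 powr (m - a)" by (simp flip: powr_add)
    finally show ?thesis .
  qed
  define S where "S K t x = osc_int (evolve P t (trunc (2 ^ K - 1) h)) x" for K t x
  have S_incr: "S (Suc k) t x - S k t x = osc_int (evolve P t (g k)) x" for k t x
    unfolding S_def g_def by (rule osc_int_dyadic_piece[OF P h, symmetric])
  have S_0: "S 0 t x = 0" for t x
  proof -
    have "trunc 0 h = (\<lambda>_. 0)" by (simp add: trunc_def fun_eq_iff)
    then show ?thesis by (simp add: S_def evolve_def osc_int_def)
  qed
  have S_cont: "continuous_on UNIV (\<lambda>t. S K t x)" for K x
    unfolding S_def by (rule continuous_on_evolve_time[OF P integrable_trunc[OF h]])
  \<comment> \<open>Outside the good set \<open>lim\<close> may return an arbitrary value;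
    measurability holds all the same.\<close>
  define u where "u t x = lim (\<lambda>K. S K t x)" for t x
  have um: "u t \<in> borel_measurable lebesgue" for t
    unfolding u_def S_def
    by (intro borel_measurable_lim_metric osc_int_measurable integrable_evolve P integrable_trunc h)
  define good where "good x \<longleftrightarrow>
    (\<exists>B\<ge>0. \<forall>k. \<forall>t\<in>{0<..<1}. cmod (osc_int (evolve P t (g k)) x) \<le> B * (2 powr - b) ^ k) \<and>
    (\<exists>B\<ge>0. \<forall>k. \<forall>t\<in>{0<..<1}. cmod (osc_int (evolve P t (Pg k)) x) \<le> B * (2 powr (m - b)) ^ k)" for x
  have good: "AE x in lebesgue. good x"
    unfolding good_def
    using maximal_decay_AE[OF P p C maximal gb g_decay, of "2 powr - b"]
      maximal_decay_AE[OF P p C maximal Pgb Pg_decay, of "2 powr (m - b)"] b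
    by simp
  have q: "0 \<le> 2 powr - b" "2 powr - b < (1::real)"
    using b \<delta> by (auto simp: powr_less_one)
  have S_lim: "(\<forall>t. 0 \<le> t \<and> t < 1 \<longrightarrow> (\<lambda>K. S K t x) \<longlonglongrightarrow> u t x) \<and> continuous_on {0<..<1} (\<lambda>t. u t x)"
    if "good x" for x
  proof -
    obtain B where B: "\<And>k t. 0 < t \<Longrightarrow> t < 1 \<Longrightarrow> cmod (S (Suc k) t x - S k t x) \<le> B * (2 powr - b) ^ k"
      using \<open>good x\<close> unfolding good_def S_incr by fastforce
    note * = geometric_increments_limit[where S="\<lambda>K t. S K t x", OF S_cont S_0 B q]
    show ?thesis unfolding u_def using * by blast
  qed
  have lim: "(\<lambda>K. S K t x) \<longlonglongrightarrow> u t x" if "good x" "0 \<le> t" "t < 1" for t x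
    using S_lim that by blast
  have rate: "\<exists>B. \<forall>t\<in>{0<..<1}. cmod (u t x - u 0 x) \<le> B * t powr (\<delta> / m)" if x: "good x" for x
  proof -
    obtain B1 B2 where B1: "B1 \<ge> 0" "\<And>k t. 0 < t \<Longrightarrow> t < 1 \<Longrightarrow> cmod (osc_int (evolve P t (g k)) x) \<le> B1 * (2 powr - b) ^ k"
      and B2: "B2 \<ge> 0" "\<And>k t. 0 < t \<Longrightarrow> t < 1 \<Longrightarrow> cmod (osc_int (evolve P t (Pg k)) x) \<le> B2 * (2 powr (m - b)) ^ k"
      using x unfolding good_def by fastforce
    \<comment> \<open>One constant for both bounds: \<open>2 * B1\<close> from the triangle
      inequality, \<open>B2\<close> from the derivative estimate.\<close>
    define B where "B = 2 * B1 + B2"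
    have step: "cmod (osc_int (evolve P t (g k)) x - osc_int (g k) x)
        \<le> (B * t powr (\<delta> / m)) * (2 powr (\<delta> - b)) ^ k" if t: "0 < t" "t < 1" for t k
    proof -
      \<comment> \<open>The derivative bound is \<open>?z\<close> times the size bound, so the two
        balance at the frequency where \<open>(2 powr m) ^ k\<close> is about
        \<open>1 / t\<close>.\<close>
      let ?w = "(2 powr - b) ^ k :: real" and ?z = "t * (2 powr m) ^ k"
      have z: "?z > 0" using t by simp
      have w: "?w \<ge> 0" by simp
      have "cmod (osc_int (evolve P 0 (g k)) x) \<le> B1 * ?w"
        by (rule norm_le_at_0[OF continuous_on_evolve_time[OF P band_limitedD(2)[OF gb]]]) (rule B1(2))
      then have "cmod (osc_int (evolve P t (g k)) x - osc_int (g k) x) \<le> B1 * ?w + B1 * ?w"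
        by (intro norm_triangle_le_diff add_mono B1(2) t) simp
      also have "\<dots> \<le> B * ?w" using mult_right_mono[OF B2(1) w] by (simp add: B_def distrib_right)
      finally have 1: "cmod (osc_int (evolve P t (g k)) x - osc_int (g k) x) \<le> B * ?w" .
      have "cmod (osc_int (evolve P t (g k)) x - osc_int (g k) x) \<le> B2 * (2 powr (m - b)) ^ k * t"
        by (rule cmod_evolve_diff_le[OF P gb t]) (use B2(2) in \<open>simp add: Pg_def\<close>)
      also have "(2 powr (m - b)) ^ k = (2 powr m) ^ k * ?w"
        by (simp flip: power_mult_distrib powr_add)
      also have "B2 * ((2 powr m) ^ k * ?w) * t = B2 * (?w * ?z)" by (simp add: mult_ac)
      also have "\<dots> \<le> B * (?w * ?z)"
        using B1(1) z by (intro mult_right_mono) (auto simp: B_def)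
      finally have 2: "cmod (osc_int (evolve P t (g k)) x - osc_int (g k) x) \<le> B * ?w * ?z"
        by (simp add: mult_ac)
      have "cmod (osc_int (evolve P t (g k)) x - osc_int (g k) x) \<le> B * ?w * min 1 ?z"
        using 1 2 by (auto simp: min_def)
      also have "\<dots> \<le> B * ?w * ?z powr (\<delta> / m)"
        using B1(1) B2(1) \<delta> m z by (intro mult_left_mono min_one_le_powr) (auto simp: B_def)
      also have "?z powr (\<delta> / m) = t powr (\<delta> / m) * (2 powr \<delta>) ^ k"
        using t m by (simp add: powr_mult powr_powr powr_two_realpow mult.commute)
      also have "B * ?w * (t powr (\<delta> / m) * (2 powr \<delta>) ^ k) = (B * t powr (\<delta> / m)) * (2 powr \<delta> * 2 powr - b) ^ k"
        by (simp add: power_mult_distrib mult_ac)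
      also have "2 powr \<delta> * 2 powr - b = 2 powr (\<delta> - b)" by (simp flip: powr_add)
      finally show ?thesis .
    qed
    have q': "0 \<le> 2 powr (\<delta> - b)" "2 powr (\<delta> - b) < (1::real)" using b by (auto simp: powr_less_one)
    have "cmod (u t x - u 0 x) \<le> B / (1 - 2 powr (\<delta> - b)) * t powr (\<delta> / m)" if t: "t \<in> {0<..<1}" for t
    proof -
      have "cmod (u t x - u 0 x) \<le> B * t powr (\<delta> / m) / (1 - 2 powr (\<delta> - b))"
      proof (rule norm_le_geometric_increments[OF _ _ _ q'])
        show "(\<lambda>K. S K t x - S K 0 x) \<longlonglongrightarrow> u t x - u 0 x"
          using t by (intro tendsto_diff lim x) auto
        show "cmod ((S (Suc k) t x - S (Suc k) 0 x) - (S k t x - S k 0 x))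
            \<le> B * t powr (\<delta> / m) * (2 powr (\<delta> - b)) ^ k" for k
          using step[of t k] t S_incr[of k t x] S_incr[of k 0 x] by (simp add: algebra_simps)
      qed (simp add: S_0)
      then show ?thesis by simp
    qed
    then show ?thesis by blast
  qed
  have r: "filterlim (\<lambda>K. 2 ^ K - 1 :: real) at_top sequentially"
  proof (rule filterlim_at_top_mono[OF filterlim_real_sequentially], intro always_eventually allI)
    fix K :: nat
    have "real (Suc K) \<le> real (2 ^ K)" by (intro of_nat_mono Suc_leI less_exp)
    then show "real K \<le> 2 ^ K - 1" by simp
  qed
  have L2: "square_integrable (u t)"
      "((\<lambda>R. L2sq (\<lambda>x. osc_int (trunc R (evolve P t h)) x - u t x)) \<longlongrightarrow> 0) at_top"
    if t: "0 \<le> t" "t < 1" for t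
  proof -
    have "AE x in lebesgue. (\<lambda>K. osc_int (trunc (2 ^ K - 1) (evolve P t h)) x) \<longlonglongrightarrow> u t x"
      using good by eventually_elim (use lim t in \<open>simp add: S_def trunc_evolve\<close>)
    from has_L2_limit_of_AE_limit[OF square_integrable_evolve[OF P h] r um this]
    show "square_integrable (u t)"
      "((\<lambda>R. L2sq (\<lambda>x. osc_int (trunc R (evolve P t h)) x - u t x)) \<longlongrightarrow> 0) at_top" .
  qed
  have E: "square_integrable (osc_int (trunc R (evolve P t h)))" for R t
    by (intro band_limitedD(3) band_limited_trunc square_integrable_evolve P h)
  have version: "evolution_version P f u"
    unfolding evolution_version_def
  proof (intro conjI ballI)
    show "AE x in lebesgue. continuous_on {0<..<1} (\<lambda>t. u t x)"
      using good by eventually_elim (use S_lim in blast)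
    fix t :: real assume t: "t \<in> {0<..<1}"
    show "is_evolution P t f (u t)"
      unfolding is_evolution_iff h_def[symmetric]
      using has_L2_limit_iff[where F="\<lambda>R. osc_int (trunc R (evolve P t h))", OF E L2(1)[of t]] L2(2)[of t] t
      by auto
  qed
  \<comment> \<open>At time 0 the truncated integrals converge in L^2 both to \<open>u 0\<close>, by
    construction, and to \<open>f\<close>, by Fourier inversion.\<close>
  have f0: "AE x in lebesgue. u 0 x = f x"
  proof (rule L2_limit_unique)
    show "((\<lambda>R. L2sq (\<lambda>x. osc_int (trunc R h) x - u 0 x)) \<longlongrightarrow> 0) at_top" using L2(2)[of 0] by simp
    show "((\<lambda>R. L2sq (\<lambda>x. osc_int (trunc R h) x - f x)) \<longlongrightarrow> 0) at_top"
      unfolding h_def by (rule fourier_inversion[OF fs])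
  qed (use L2(1)[of 0] E[of _ 0] fs in auto)
  have "AE x in lebesgue. \<exists>B. \<forall>t\<in>{0<..<1}. cmod (u t x - f x) \<le> B * t powr (\<delta> / m)"
    using good f0
  proof eventually_elim
    case (elim x)
    from rate[OF elim(1)] show ?case by (simp only: elim(2))
  qed
  with version show ?thesis by blast
qed

theorem theorem1p4:
  fixes P :: "real ^ 'n \<Rightarrow> real" and p m s\<^sub>0 :: real
  assumes "continuous_on UNIV P"
    and "p \<ge> 1"
    and "m > 0" and "s\<^sub>0 > 0"
    and growth: "\<exists>C>0. \<exists>R\<^sub>0>0. \<forall>\<xi>. norm \<xi> \<ge> R\<^sub>0 \<longrightarrow> \<bar>P \<xi>\<bar> \<le> C * norm \<xi> powr m"
    and maximal: "\<forall>s>s\<^sub>0. \<exists>C>0. \<forall>f\<in>sobolev s. \<forall>u. evolution_version P f u \<longrightarrow>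
           Lp_norm_on p (ball 0 1) (maximal_function u) \<le> ennreal (C * sobolev_norm s f)"
  shows "\<forall>s>s\<^sub>0. \<forall>\<delta>. 0 \<le> \<delta> \<and> \<delta> < m \<longrightarrow> (\<forall>f\<in>sobolev (s + \<delta>).
           (\<exists>u. evolution_version P f u) \<and>
           (\<forall>u. evolution_version P f u \<longrightarrow>
              (AE x in lebesgue.
                 (\<lambda>t. u t x - f x) \<in> o[at_right 0](\<lambda>t. complex_of_real (t powr (\<delta> / m))))))"
proof (intro allI impI ballI)
  fix s \<delta> :: real and f :: "real ^ 'n \<Rightarrow> complex"
  assume s: "s > s\<^sub>0" and \<delta>: "0 \<le> \<delta> \<and> \<delta> < m" and f: "f \<in> sobolev (s + \<delta>)"
  note P = assms(1)
  \<comment> \<open>The maximal estimate is used strictly between \<open>s\<^sub>0\<close> and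
    \<open>s\<close>, so that \<open>s + \<delta> - s'\<close> exceeds \<delta>.\<close>
  define s' where "s' = (s\<^sub>0 + s) / 2"
  have s': "s\<^sub>0 < s'" "s' < s" using s by (auto simp: s'_def)
  \<comment> \<open>A slightly larger exponent upgrades O to o and is positive even for \<delta> =
    0; the upper bound is what \<open>evolution_convergence_rate\<close> allows at regularity
    \<open>s + \<delta>\<close>.\<close>
  obtain \<delta>' where \<delta>': "\<delta> < \<delta>'" "\<delta>' < min m (s + \<delta> - s')"
    using \<delta> s' dense[of \<delta> "min m (s + \<delta> - s')"] by auto
  obtain C where C: "C > 0" "\<forall>f\<in>sobolev s'. \<forall>u. evolution_version P f u \<longrightarrow>
      Lp_norm_on p (ball 0 1) (maximal_function u) \<le> ennreal (C * sobolev_norm s' f)"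
    using maximal s' by blast
  have "Lp_norm_on p (ball 0 1) (maximal_function (\<lambda>t. osc_int (evolve P t g)))
      \<le> ennreal (C * sqrt (L2sq (bessel_weight s' g)))" if "band_limited g" for g
    using C(2) osc_int_in_sobolev[OF that] evolution_version_osc_int[OF P that]
    unfolding sobolev_norm_osc_int[OF that, symmetric] by blast
  then have "\<exists>u. evolution_version P f u \<and>
      (AE x in lebesgue. \<exists>B. \<forall>t\<in>{0<..<1}. cmod (u t x - f x) \<le> B * t powr (\<delta>' / m))"
    using C(1) assms(2,3) \<delta> \<delta>' by (intro evolution_convergence_rate[where C=C and p=p and s=s', OF P _ _ growth _ _ f]) auto
  then obtain v where v: "evolution_version P f v"
    and rate: "AE x in lebesgue. \<exists>B. \<forall>t\<in>{0<..<1}. cmod (v t x - f x) \<le> B * t powr (\<delta>' / m)"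
    by blast
  have fs: "square_integrable f" using f by (simp add: sobolev_def)
  have "AE x in lebesgue. (\<lambda>t. u t x - f x) \<in> o[at_right 0](\<lambda>t. complex_of_real (t powr (\<delta> / m)))"
    if u: "evolution_version P f u" for u
    using rate evolution_version_unique[OF P fs u v]
  proof eventually_elim
    case (elim x)
    then obtain B where "\<forall>t\<in>{0<..<1}. cmod (v t x - f x) \<le> B * t powr (\<delta>' / m)" by blast
    with elim(2) show ?case
      using \<delta>' assms(3) by (intro smallo_of_powr_bound[where \<beta>="\<delta>' / m"]) (auto simp: divide_strict_right_mono)
  qed
  with v show "(\<exists>u. evolution_version P f u) \<and>
      (\<forall>u. evolution_version P f u \<longrightarrow>
        (AE x in lebesgue. (\<lambda>t. u t x - f x) \<in> o[at_right 0](\<lambda>t. complex_of_real (t powr (\<delta> / m)))))"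
    by blast
qed

end
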